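(* Let $k,a,b$ be integers such that $k\ne 0$, $a>b\ge 1$ and $\gcd(a,b)=1$. (a) If $k\ge 1$, $ab\mid k$, and $\sigma(k/a)=k/b$, then $$\#S(a,b;k;x)\sim\frac{a}{k}\,\frac{x}{\log(ax/k)}$$ as $x\to\infty$. (b) Otherwise (that is, if the three conditions $k\ge1$, $ab\mid k$, $\sigma(k/a)=k/b$ do not all hold), $$\#S(a,b;k;x)=O(b^2x^{2/3+o(1)})$$ for any $x\ge 1$, where the implicit constants are absolute. In particular, this bound is uniform in $a$.
   Context: $\sigma(n)$ denotes the sum of all positive divisors of the positive integer $n$. $S(a,b;k)$ denotes the set of all positive integers $n$ with $b\sigma(n)=an+k$, and $S(a,b;k;x):=S(a,b;k)\cap[1,x]$. Here $f(x)\sim g(x)$ means $f(x)/g(x)\to1$ as $x\to\infty$, and $o(1)$ denotes a quantity depending only on $x$ that tends to $0$ as $x\to\infty$ (so, like the implied constant, it does not depend on $a$, $b$ or $k$). *)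

theory Defs
  imports Complex_Main "HOL-Library.Landau_Symbols"
begin

definition divisor_sum :: "nat \<Rightarrow> nat" where
  "divisor_sum n = (\<Sum>d | d dvd n. d)"

definition sol_set :: "int \<Rightarrow> int \<Rightarrow> int \<Rightarrow> nat set" where
  "sol_set a b k = {n. n \<ge> 1 \<and> b * int (divisor_sum n) = a * int n + k}"

definition sol_set_upto :: "int \<Rightarrow> int \<Rightarrow> int \<Rightarrow> real \<Rightarrow> nat set" where
  "sol_set_upto a b k x = {n \<in> sol_set a b k. real n \<le> x}"

(* For a, b \<ge> 1, the first two conjuncts make k div a and k div b exact positive
   quotients, so neither div nor nat loses information. *)
definition exceptional :: "int \<Rightarrow> int \<Rightarrow> int \<Rightarrow> bool" where
  "exceptional a b k \<longleftrightarrow>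
     k \<ge> 1 \<and> a * b dvd k \<and> int (divisor_sum (nat (k div a))) = k div b"

end

(* For n = pm with p prime and p not dividing m, the equation b sigma(n) = a n + k reads
   p (b sigma(m) - a m) = k - b sigma(m). It holds for every p when b sigma(m) = a m, which forces k = am = b sigma(m),
   i.e. the exceptional case with m = k/a; such n are counted by the prime number theorem (obtained by Newman's
   contour argument). Otherwise m determines p. All remaining n up to x are, outside a set of size x^(2/3+o(1)), of
   the form n = md with m, d coprime and x^(1/3) < m <= x^(2/3). Given m, sigma(d) determines n and lies in a fixed
   residue class modulo m / gcd(m, b sigma(m)). Summing over m requires gcd(m, sigma(m)) to be small on average,
   which follows from a Wirsing-type argument: at most x^(o(1)) integers m up to x satisfy m | v sigma(m) for a given v. *)

theory Submission
  imports Defs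
    "HOL-Complex_Analysis.Complex_Analysis"
    "HOL-Number_Theory.Prime_Powers"
    "HOL-Real_Asymp.Real_Asymp"
begin

text \<open>The exponent 2/3 comes from a balance at z = x^(1/3): each m in (z, z^2] costs 1, in
  total z^2, and its residue class costs about x / m^2, in total x / z = z^2. The window has this
  shape because a product of prime powers that are at most z cannot step over it. Neither a nor k
  enters the count: a n + k only has to determine n and to be constant mod m. One factor b is lost
  when gcd(m, b sigma(m)) is bounded by b gcd(m, sigma(m)). The sum of gcd(m, sigma(m)) / m^2 is
  handled by grouping m by the reduced denominator v of sigma(m) / m, since then m divides v
  sigma(m); hence the Wirsing-type count must be uniform in v <= x. That count is an encoding
  argument in the form of a Kraft inequality: few large primes have to be recorded, and a number B >
  1 with only few, large primes cannot divide sigma(B), because B < sigma(B) < 2 B. The prime number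
  theorem serves there a second time, to count the small primes.\<close>

section \<open>Newman's Tauberian theorem\<close>

text \<open>Cauchy's formula with the circle cut into its right and left half, because the two
  halves are estimated separately. The difference quotient \<open>q\<close> is entire and integrates
  to 0 over the closed curve; the remaining \<open>f 0 / z\<close> contributes i pi f(0) on each
  half.\<close>

lemma contour_integral_half_circles:
  assumes f: "f holomorphic_on UNIV" and R: "R > 0"
  shows "contour_integral (part_circlepath 0 R (-pi/2) (pi/2)) (\<lambda>z. f z / z) +
         contour_integral (part_circlepath 0 R (pi/2) (3*pi/2)) (\<lambda>z. f z / z) = 2 * pi * \<i> * f 0"
proof -
  define p1 where "p1 = part_circlepath 0 R (-pi/2) (pi/2)"
  define p2 where "p2 = part_circlepath 0 R (pi/2) (3*pi/2)"
  define q where "q = (\<lambda>z. if z = 0 then deriv f 0 else (f z - f 0) / (z - 0))"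
  have q: "q holomorphic_on UNIV"
    unfolding q_def using pole_lemma_open[OF f open_UNIV] by simp
  have ends: "pathfinish p1 = pathstart p2" "pathfinish p2 = pathstart p1"
    unfolding p1_def p2_def using cos_3over2_pi sin_3over2_pi
    by (auto simp: complex_eq_iff Re_exp Im_exp)
  have v: "valid_path p1" "valid_path p2"
    unfolding p1_def p2_def by auto
  have "(q has_contour_integral 0) (p1 +++ p2)"
    by (rule Cauchy_theorem_convex_simple[OF q]) (use ends v in auto)
  moreover have qi: "q contour_integrable_on p1" "q contour_integrable_on p2"
    unfolding p1_def p2_def
    by (intro contour_integrable_continuous_part_circlepath holomorphic_on_imp_continuous_on holomorphic_on_subset[OF q]; simp)+
  ultimately have sum0: "contour_integral p1 q + contour_integral p2 q = 0"
    using contour_integral_join[OF qi v] contour_integral_unique by metis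
  have ne: "z \<noteq> 0" if "z \<in> path_image p1 \<union> path_image p2" for z
    using that R in_path_image_part_circlepath[of z 0 R] unfolding p1_def p2_def by fastforce
  have i1: "((\<lambda>z. f 0 / z) has_contour_integral \<i> * pi * f 0) p1"
    unfolding p1_def has_contour_integral_part_circlepath_iff[of "-pi/2" "pi/2", simplified]
    using R has_integral_const_real[of "f 0 * \<i>" "-pi/2" "pi/2"]
    by (simp add: has_contour_integral_part_circlepath_iff scaleR_conv_of_real mult_ac)
  have i2: "((\<lambda>z. f 0 / z) has_contour_integral \<i> * pi * f 0) p2"
    unfolding p2_def
    using R has_integral_const_real[of "f 0 * \<i>" "pi/2" "3*pi/2"]
    by (simp add: has_contour_integral_part_circlepath_iff scaleR_conv_of_real mult_ac)
  have eq: "contour_integral p (\<lambda>z. f z / z) = contour_integral p q + \<i> * pi * f 0"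
    if "p = p1 \<or> p = p2" for p
  proof -
    have "contour_integral p (\<lambda>z. f z / z) = contour_integral p (\<lambda>z. q z + f 0 / z)"
      by (rule contour_integral_cong) (use that ne in \<open>auto simp: q_def diff_divide_distrib\<close>)
    also have "\<dots> = contour_integral p q + contour_integral p (\<lambda>z. f 0 / z)"
      by (rule contour_integral_add) (use that qi i1 i2 in \<open>auto intro: has_contour_integral_integrable\<close>)
    finally show ?thesis
      using that contour_integral_unique[OF i1] contour_integral_unique[OF i2] by auto
  qed
  show ?thesis
    using eq[of p1] eq[of p2] sum0 unfolding p1_def[symmetric] p2_def[symmetric]
    by (simp add: algebra_simps)
qed

lemma path_image_right_half_circle:
  assumes "z \<in> path_image (part_circlepath 0 R (-pi/2) (pi/2))" "R > 0"
  shows "norm z = R" "Re z \<ge> 0"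
proof -
  from assms obtain t where "t \<in> {-pi/2..pi/2}" "z = of_real R * cis t"
    by (auto simp: path_image_part_circlepath' closed_segment_eq_real_ivl)
  thus "norm z = R" "Re z \<ge> 0"
    using assms by (auto simp: norm_mult Re_exp intro!: mult_nonneg_nonneg cos_ge_zero)
qed

lemma path_image_left_half_circle:
  assumes "z \<in> path_image (part_circlepath 0 R (pi/2) (3*pi/2))" "R > 0"
  shows "norm z = R" "Re z \<le> 0"
proof -
  from assms obtain t where t: "t \<in> {pi/2..3*pi/2}" "z = of_real R * cis t"
    by (auto simp: path_image_part_circlepath' closed_segment_eq_real_ivl)
  have "cos (t - pi) \<ge> 0" using t by (intro cos_ge_zero) auto
  hence "cos t \<le> 0" by (simp add: cos_diff)
  thus "norm z = R" "Re z \<le> 0"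
    using t assms by (auto simp: norm_mult Re_exp mult_le_0_iff)
qed

lemma circle_imag_points:
  assumes "Re z = 0" "norm z = R"
  shows "z \<in> {\<i> * of_real R, - \<i> * of_real R}"
proof -
  have "\<bar>Im z\<bar> = R" using assms by (simp add: cmod_eq_Im)
  thus ?thesis using assms by (auto simp: complex_eq_iff abs_if split: if_splits)
qed



text \<open>Since \<^term>\<open>F 0 = 0\<close>, the right half of Newman's contour can be moved onto the imaginary axis for the
  term \<^term>\<open>F\<close>, where integration by parts gives decay; no contour in the left half plane is needed for it.\<close>

lemma newman_tauberian:
  fixes a :: "nat \<Rightarrow> complex \<Rightarrow> complex" and F :: "complex \<Rightarrow> complex"
  assumes hol: "\<And>n. a n holomorphic_on UNIV"
    and bnd: "\<And>n z. norm z > 1 \<Longrightarrow> Re z \<noteq> 0 \<Longrightarrow>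
      norm (a n z) \<le> C * ((real (n + 1) powr (- Re z) - real (n + 2) powr (- Re z)) / Re z)"
    and C: "C > 0"
    and F: "F holomorphic_on S" "open S" "{z. Re z \<ge> 0} \<subseteq> S"
    and sums: "\<And>z. Re z > 0 \<Longrightarrow> (\<lambda>n. a n z) sums F z"
    and F0: "F 0 = 0"
  shows "(\<lambda>N. \<Sum>n<N. a n 0) \<longlonglongrightarrow> 0"
proof -
  define A where "A = (\<lambda>N z. \<Sum>n<N. a n z)"
  \<comment> \<open>The weight (N + 1)^z cancels the factor (N + 1)^(-Re z) in \<open>norm_A\<close>
    and \<open>norm_FA\<close>, so the integrands become bounded independently of N.\<close>
  define K where "K = (\<lambda>N z. of_nat (N + 1) powr z :: complex)"
  define q where "q = (\<lambda>z. if z = 0 then deriv F 0 else (F z - F 0) / (z - 0))"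
  have q: "q holomorphic_on S"
    unfolding q_def using pole_lemma_open[OF F(1,2), of 0] by simp
  have S0: "Re z \<ge> 0 \<Longrightarrow> z \<in> S" for z using F(3) by auto
  have K: "K N holomorphic_on B" for N B
    unfolding K_def by (intro holomorphic_intros)
  have A: "A N holomorphic_on B" for N B
    unfolding A_def by (intro holomorphic_intros holomorphic_on_subset[OF hol]) auto
  have norm_K: "norm (K N z) = real (N + 1) powr Re z" for N z
    unfolding K_def by (subst norm_powr_real_powr) (auto simp del: of_nat_add of_nat_Suc)
  have norm_A: "norm (A N z) \<le> C * real (N + 1) powr (- Re z) / \<bar>Re z\<bar>"
    if z: "norm z > 1" "Re z < 0" for N z
  proof -
    have "norm (A N z) \<le> (\<Sum>n<N. C * ((real (n + 1) powr (- Re z) - real (n + 2) powr (- Re z)) / Re z))"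
      unfolding A_def by (rule sum_norm_le) (use bnd z in auto)
    also have "\<dots> = C * (\<Sum>n<N. real (n + 1) powr (- Re z) - real (Suc n + 1) powr (- Re z)) / Re z"
      by (simp add: sum_distrib_left sum_divide_distrib add_ac)
    also have "(\<Sum>n<N. real (n + 1) powr (- Re z) - real (Suc n + 1) powr (- Re z)) = 1 - real (N + 1) powr (- Re z)"
      using sum_lessThan_telescope'[of "\<lambda>n. real (n + 1) powr (- Re z)" N] by simp
    also have "C * (1 - real (N + 1) powr (- Re z)) / Re z \<le> C * real (N + 1) powr (- Re z) / \<bar>Re z\<bar>"
      using z C by (simp add: divide_simps mult_left_mono) (simp add: algebra_simps)
    finally show ?thesis .
  qed
  have norm_FA: "norm (F z - A N z) \<le> C * real (N + 1) powr (- Re z) / Re z"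
    if z: "norm z > 1" "Re z > 0" for N z
  proof -
    have 1: "(\<lambda>n. a (n + N) z) sums (F z - A N z)"
      unfolding A_def using sums[OF z(2)] by (subst sums_iff_shift) auto
    have lim: "(\<lambda>n. real (n + 1) powr (- Re z)) \<longlonglongrightarrow> 0"
      using z by real_asymp
    have "(\<lambda>n. real (n + N + 1) powr (- Re z)) \<longlonglongrightarrow> 0"
      using LIMSEQ_ignore_initial_segment[OF lim, of N] by simp
    from telescope_sums'[OF this]
    have 2: "(\<lambda>n. C * ((real (n + N + 1) powr (- Re z) - real (n + N + 2) powr (- Re z)) / Re z))
             sums (C * (real (N + 1) powr (- Re z) / Re z))"
      by (intro sums_mult sums_divide) (simp add: add_ac)
    have "norm (F z - A N z) \<le> C * (real (N + 1) powr (- Re z) / Re z)"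
      using norm_sums_le[OF 1 2] bnd[of z "n + N" for n] z by auto
    thus ?thesis by simp
  qed
  \<comment> \<open>Newman's correction 1 + z^2 / R^2: on |z| = R the kernel has size proportional
    to |Re z| and compensates the 1 / |Re z| in the bounds for \<open>A\<close> and
    \<open>F - A\<close>.\<close>
  have kernel: "norm ((1 + z\<^sup>2 / R\<^sup>2) / z) = 2 * \<bar>Re z\<bar> / R\<^sup>2" if "norm z = R" "R > 0" for z :: complex and R :: real
  proof -
    have "z * cnj z = of_real (R\<^sup>2)" using that complex_norm_square[of z] by simp
    moreover have "z \<noteq> 0" using that by auto
    ultimately have "(1 + z\<^sup>2 / R\<^sup>2) / z = (z + cnj z) / of_real (R\<^sup>2)"
      using that by (simp add: field_simps power2_eq_square)
    also have "\<dots> = of_real (2 * Re z / R\<^sup>2)" by (simp add: complex_add_cnj)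
    finally show ?thesis by (simp only: norm_of_real) (simp add: abs_mult)
  qed
  \<comment> \<open>After division by 2 pi each half circle contributes C / R, and \<open>J\<close>
    eventually adds at most C / R.\<close>
  have key: "eventually (\<lambda>N. norm (A N 0) \<le> 3 * C / R) sequentially" if R: "R > 1" for R
  proof -
    have Rpos: "R > 0" using R by simp
    \<comment> \<open>\<open>q\<close> is F(z) / z, regular at 0 because F(0) = 0. So this integrand
      has no pole, and its half circle can be replaced by the diameter on the imaginary axis, where
      |K| = 1.\<close>
    define G where "G = (\<lambda>z. q z * (1 + z\<^sup>2 / R\<^sup>2))"
    have G: "G holomorphic_on S" unfolding G_def by (intro holomorphic_intros q) (use R in auto)
    define p1 where "p1 = part_circlepath 0 R (-pi/2) (pi/2)"
    define p2 where "p2 = part_circlepath 0 R (pi/2) (3*pi/2)"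
    define L where "L = linepath (- \<i> * of_real R) (\<i> * of_real R)"
    have v: "valid_path p1" "valid_path L" by (auto simp: p1_def L_def)
    have ends: "pathstart p1 = - \<i> * R" "pathfinish p1 = \<i> * R"
      unfolding p1_def by (auto simp: complex_eq_iff Re_exp Im_exp)
    have pl: "pathstart L = - \<i> * R" "pathfinish L = \<i> * R" by (auto simp: L_def)
    have imL: "Re z = 0" if "z \<in> path_image L" for z
      using that by (auto simp: L_def closed_segment_def)
    have im1: "norm z = R" "Re z \<ge> 0" if "z \<in> path_image p1" for z
      using path_image_right_half_circle[of z R] that R by (auto simp: p1_def)
    have im2: "norm z = R" "Re z \<le> 0" if "z \<in> path_image p2" for z
      using path_image_left_half_circle[of z R] that R by (auto simp: p2_def)
    define J where "J = (\<lambda>N. contour_integral L (\<lambda>z. G z * K N z))"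
    have GK: "(\<lambda>z. G z * K N z) holomorphic_on S" for N
      by (intro holomorphic_intros G K)
    have int1: "(\<lambda>z. G z * K N z) contour_integrable_on p1" for N
      unfolding p1_def
      by (intro contour_integrable_continuous_part_circlepath holomorphic_on_imp_continuous_on
          holomorphic_on_subset[OF GK]) (use im1 S0 p1_def in auto)
    have intL: "(\<lambda>z. G z * K N z) contour_integrable_on L" for N
      unfolding L_def
      by (intro contour_integrable_continuous_linepath holomorphic_on_imp_continuous_on
          holomorphic_on_subset[OF GK]) (use imL S0 L_def in auto)
    have J: "contour_integral p1 (\<lambda>z. G z * K N z) = J N" for N
    proof -
      have "((\<lambda>z. G z * K N z) has_contour_integral 0) (p1 +++ reversepath L)"
      proof (rule Cauchy_theorem_convex[where S = "{z. Re z \<ge> 0}" and K = "{}"])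
        show "continuous_on {z. 0 \<le> Re z} (\<lambda>z. G z * K N z)"
          using GK F(3) holomorphic_on_imp_continuous_on holomorphic_on_subset by metis
        show "convex {z. 0 \<le> Re z}" using convex_halfspace_Re_ge[of 0] by simp
        fix z assume "z \<in> interior {z. 0 \<le> Re z} - {}"
        hence "z \<in> S" using interior_subset F(3) by auto
        thus "(\<lambda>z. G z * K N z) field_differentiable at z"
          using GK F(2) holomorphic_on_imp_differentiable_at by metis
      next
        show "path_image (p1 +++ reversepath L) \<subseteq> {z. 0 \<le> Re z}"
          using im1 imL ends pl by (subst path_image_join) auto
      qed (use v ends pl in auto)
      moreover have "((\<lambda>z. G z * K N z) has_contour_integral (contour_integral p1 (\<lambda>z. G z * K N z) + - J N)) (p1 +++ reversepath L)"
        unfolding J_def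
        by (intro has_contour_integral_join has_contour_integral_integral has_contour_integral_reversepath)
           (use int1 intL v in auto)
      ultimately show ?thesis using has_contour_integral_unique by force
    qed
    \<comment> \<open>Integration by parts along the imaginary segment: \<open>K N\<close> is its
      own derivative divided by ln (N + 1), so each of the three terms of \<open>E\<close> below
      gains the factor 1 / ln (N + 1).\<close>
    have Jlim: "J \<longlonglongrightarrow> 0"
    proof -
      have "compact (path_image L)" unfolding L_def by (simp add: compact_segment)
      moreover have dG: "deriv G holomorphic_on S" using G F(2) by (rule holomorphic_deriv)
      ultimately have "compact (deriv G ` path_image L)"
        using imL S0 by (intro compact_continuous_image holomorphic_on_imp_continuous_on
          holomorphic_on_subset[OF dG]) auto
      hence "bounded (deriv G ` path_image L)" by (rule compact_imp_bounded)
      then obtain B where B: "\<And>z. z \<in> path_image L \<Longrightarrow> norm (deriv G z) \<le> B"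
        unfolding bounded_iff by auto
      have B0: "B \<ge> 0" by (rule order_trans[OF norm_ge_zero B[OF pathstart_in_path_image]])
      define E where "E = norm (G (\<i> * R)) + norm (G (- \<i> * R)) + B * (2 * R)"
      have bound: "norm (J N) \<le> E / ln (real (N + 1))" if N: "N > 0" for N
      proof -
        define l where "l = ln (real (N + 1))"
        have l: "l > 0" using N by (auto simp: l_def)
        have nz: "Ln (of_nat (N + 1)) = of_real l" unfolding l_def
          by (simp flip: Ln_of_real add: of_nat_Suc)
        define P where "P = (\<lambda>z. G z * K N z / of_real l)"
        define Q where "Q = (\<lambda>z. deriv G z * K N z / of_real l)"
        have dP: "(P has_field_derivative (Q z + G z * K N z)) (at z)" if "z \<in> S" for z
        proof -
          have "(G has_field_derivative deriv G z) (at z)"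
            by (rule holomorphic_derivI[OF G F(2) that])
          moreover have "(K N has_field_derivative (K N z * of_real l)) (at z)"
          proof -
            have "of_nat (N + 1) \<noteq> (0 :: complex)" by (simp only: of_nat_eq_0_iff)
            from has_field_derivative_powr_right[OF this, of z] show ?thesis
              unfolding K_def nz by (simp add: mult.commute)
          qed
          ultimately show ?thesis unfolding P_def Q_def
            using l by (auto intro!: derivative_eq_intros simp: field_simps)
        qed
        have 1: "((\<lambda>z. Q z + G z * K N z) has_contour_integral (P (\<i> * R) - P (- \<i> * R))) L"
          using contour_integral_primitive[of S P "\<lambda>z. Q z + G z * K N z" L] dP v imL S0
          by (force simp: L_def intro: has_field_derivative_at_within)
        have Qint: "Q contour_integrable_on L" unfolding L_def Q_def
          by (intro contour_integrable_continuous_linepath holomorphic_on_imp_continuous_on holomorphic_intros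
              holomorphic_on_subset[OF dG] K) (use imL S0 L_def l in auto)
        have "J N = (P (\<i> * R) - P (- \<i> * R)) - contour_integral L Q"
          using contour_integral_unique[OF 1] contour_integral_add[OF Qint intL[of N]]
          by (simp add: J_def algebra_simps)
        hence "norm (J N) \<le> norm (P (\<i> * R)) + norm (P (- \<i> * R)) + norm (contour_integral L Q)"
          by (smt (verit) norm_triangle_ineq4)
        also have "norm (contour_integral L Q) \<le> (B / l) * norm (\<i> * of_real R - (- \<i> * of_real R))"
          unfolding L_def
        proof (rule contour_integral_bound_linepath)
          fix z assume z: "z \<in> closed_segment (- \<i> * of_real R) (\<i> * of_real R)"
          hence "norm (deriv G z) \<le> B" "Re z = 0" using B imL by (auto simp: L_def)
          thus "norm (Q z) \<le> B / l" using l by (simp add: Q_def norm_mult norm_divide norm_K divide_right_mono)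
        qed (use Qint B0 l in \<open>auto simp: L_def\<close>)
        also have "norm (\<i> * of_real R - (- \<i> * of_real R)) = 2 * R"
          using R by (simp add: norm_mult flip: distrib_left)
        also have "norm (P (\<i> * R)) + norm (P (- \<i> * R)) + B / l * (2 * R) = E / l"
          using l by (simp add: P_def E_def norm_mult norm_divide norm_K add_divide_distrib)
        finally show ?thesis by (simp add: l_def)
      qed
      show ?thesis
      proof (rule Lim_null_comparison)
        show "\<forall>\<^sub>F N in sequentially. norm (J N) \<le> E / ln (real (N + 1))"
          using eventually_gt_at_top[of 0] by eventually_elim (use bound in auto)
        show "(\<lambda>N. E / ln (real (N + 1))) \<longlonglongrightarrow> 0" by real_asymp
      qed
    qed
    have main: "norm (A N 0) \<le> norm (J N) + 2 * C / R" for N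
    proof -
      \<comment> \<open>On the right half circle f / z is G K minus the contribution of F - A. Thus
        the tail F - A is estimated on the right and the partial sum A on the left, each where its
        bound is valid.\<close>
      define f where "f = (\<lambda>z. A N z * K N z * (1 + z\<^sup>2 / R\<^sup>2))"
      have f: "f holomorphic_on B" for B
        unfolding f_def by (intro holomorphic_intros A K) (use R in auto)
      have ne: "z \<noteq> 0" if "z \<in> path_image p1 \<union> path_image p2" for z
        using that im1 im2 R by fastforce
      have fint1: "(\<lambda>z. f z / z) contour_integrable_on p1"
        unfolding p1_def
        by (intro contour_integrable_continuous_part_circlepath holomorphic_on_imp_continuous_on
          holomorphic_intros f) (use ne p1_def in auto)
      have fint2: "(\<lambda>z. f z / z) contour_integrable_on p2"
        unfolding p2_def
        by (intro contour_integrable_continuous_part_circlepath holomorphic_on_imp_continuous_on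
          holomorphic_intros f) (use ne p2_def in auto)
      have "of_nat (N + 1) \<noteq> (0 :: complex)" by (simp only: of_nat_eq_0_iff)
      hence "K N 0 = 1" unfolding K_def powr_def by (simp only: if_False mult_zero_left exp_zero)
      hence "f 0 = A N 0" by (simp add: f_def)
      hence 1: "contour_integral p1 (\<lambda>z. f z / z) + contour_integral p2 (\<lambda>z. f z / z) = 2 * pi * \<i> * A N 0"
        unfolding p1_def p2_def using contour_integral_half_circles[of f R] f R by auto
      have 2: "norm (contour_integral p2 (\<lambda>z. f z / z)) \<le> (2 * C / R\<^sup>2) * R * (3 * pi / 2 - pi / 2)"
        unfolding p2_def
      \<comment> \<open>The bound for \<open>A\<close> says nothing at the two points with Re z = 0;
        a finite set may be left out of the length estimate.\<close>
      proof (rule contour_integral_bound_part_circlepath_strong[where k = "{\<i> * of_real R, - \<i> * of_real R}"])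
        fix z assume z: "z \<in> path_image (part_circlepath 0 R (pi / 2) (3 * pi / 2)) - {\<i> * of_real R, - \<i> * of_real R}"
        hence nz: "norm z = R" "Re z \<le> 0" using im2 by (auto simp: p2_def)
        moreover have "Re z \<noteq> 0" using circle_imag_points nz z by blast
        ultimately have z': "norm z = R" "Re z < 0" by auto
        have "norm (f z / z) = norm (A N z) * real (N + 1) powr Re z * (2 * \<bar>Re z\<bar> / R\<^sup>2)"
          unfolding f_def times_divide_eq_right[symmetric] norm_mult norm_K
          by (simp only: kernel[OF z'(1) Rpos])
        also have "\<dots> \<le> C * real (N + 1) powr (- Re z) / \<bar>Re z\<bar> * real (N + 1) powr Re z * (2 * \<bar>Re z\<bar> / R\<^sup>2)"
          using z' R by (intro mult_right_mono norm_A) (auto simp: divide_le_0_iff)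
        also have "\<dots> = 2 * C / R\<^sup>2"
          using z' R by (simp add: powr_minus field_simps)
        finally show "norm (f z / z) \<le> 2 * C / R\<^sup>2" .
      qed (use fint2 C R p2_def in auto)
      have 3: "norm (contour_integral p1 (\<lambda>z. G z * K N z - f z / z)) \<le> (2 * C / R\<^sup>2) * R * (pi / 2 - (- pi / 2))"
        unfolding p1_def
      proof (rule contour_integral_bound_part_circlepath_strong[where k = "{\<i> * of_real R, - \<i> * of_real R}"])
        fix z assume z: "z \<in> path_image (part_circlepath 0 R (- pi / 2) (pi / 2)) - {\<i> * of_real R, - \<i> * of_real R}"
        hence nz: "norm z = R" "Re z \<ge> 0" using im1 by (auto simp: p1_def)
        moreover have "Re z \<noteq> 0" using circle_imag_points nz z by blast
        ultimately have z': "norm z = R" "Re z > 0" by auto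
        have "G z * K N z - f z / z = (F z - A N z) * K N z * ((1 + z\<^sup>2 / R\<^sup>2) / z)"
          using z' by (auto simp: G_def f_def q_def F0 field_simps)
        hence "norm (G z * K N z - f z / z) = norm (F z - A N z) * real (N + 1) powr Re z * (2 * \<bar>Re z\<bar> / R\<^sup>2)"
          by (simp only: norm_mult norm_K kernel[OF z'(1) Rpos])
        also have "\<dots> \<le> C * real (N + 1) powr (- Re z) / Re z * real (N + 1) powr Re z * (2 * \<bar>Re z\<bar> / R\<^sup>2)"
          using z' R by (intro mult_right_mono norm_FA) auto
        also have "\<dots> = 2 * C / R\<^sup>2"
          using z' R by (simp add: powr_minus field_simps)
        finally show "norm (G z * K N z - f z / z) \<le> 2 * C / R\<^sup>2" .
      qed (use fint1 int1 C R p1_def in \<open>auto intro!: contour_integrable_diff\<close>)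
      have "2 * pi * \<i> * A N 0 = J N - contour_integral p1 (\<lambda>z. G z * K N z - f z / z)
              + contour_integral p2 (\<lambda>z. f z / z)"
        unfolding contour_integral_diff[OF int1[of N] fint1] J 1[symmetric] by simp
      hence "norm (2 * pi * \<i> * A N 0) \<le> norm (J N) + norm (contour_integral p1 (\<lambda>z. G z * K N z - f z / z))
              + norm (contour_integral p2 (\<lambda>z. f z / z))"
        by (smt (verit) norm_triangle_ineq norm_triangle_ineq4)
      also have "\<dots> \<le> norm (J N) + 2 * pi * C / R + 2 * pi * C / R"
        using 2 3 R by (simp add: power2_eq_square field_simps)
      finally have "2 * pi * norm (A N 0) \<le> norm (J N) + 2 * pi * (2 * C / R)"
        by (simp add: norm_mult field_simps)
      moreover have "norm (J N) \<le> 2 * pi * norm (J N)"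
        using pi_gt3 by (intro mult_right_mono[of 1 "2 * pi", simplified]) auto
      ultimately have "2 * pi * norm (A N 0) \<le> 2 * pi * (norm (J N) + 2 * C / R)"
        by (simp add: distrib_left)
      thus ?thesis using pi_gt_zero by simp
    qed
    have "eventually (\<lambda>N. norm (J N) < C / R) sequentially"
      using tendsto_norm_zero[OF Jlim] \<open>C > 0\<close> R by (intro order_tendstoD) auto
    thus ?thesis
    proof eventually_elim
      case (elim N)
      have "C / R + 2 * C / R = 3 * C / R" by (simp flip: add_divide_distrib)
      thus ?case using main[of N] elim by linarith
    qed
  qed
  have "(\<lambda>N. A N 0) \<longlonglongrightarrow> 0"
  proof (rule tendstoI)
    fix e :: real assume e: "e > 0"
    define R where "R = max 2 (6 * C / e)"
    have R: "R > 1" "3 * C / R < e"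
      using e C by (auto simp: R_def field_simps max_def)
    show "\<forall>\<^sub>F N in sequentially. dist (A N 0) 0 < e"
      using key[OF R(1)] by eventually_elim (use R in auto)
  qed
  thus ?thesis by (simp add: A_def)
qed

section \<open>The zeta function and the von Mangoldt series\<close>

lemma norm_nat_powr: "norm (of_nat (Suc n) powr s :: complex) = real (Suc n) powr Re s"
  by (simp add: norm_powr_real_powr del: of_nat_Suc)

lemma summable_Suc_powr: "s > 1 \<Longrightarrow> summable (\<lambda>n. real (Suc n) powr - s)"
  by (subst summable_Suc_iff) (simp add: summable_real_powr_iff)

text \<open>With \<open>m = n + 1\<close>, this is \<open>s - 1\<close> times the difference of \<open>m powr (- s)\<close> and the integral of
  \<open>t powr (- s)\<close> over \<open>t \<in> [m, m + 1]\<close>; the sum continues \<open>(s - 1) \<zeta>(s)\<close> to \<open>Re s > 0\<close>.\<close>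

definition zeta_term :: "nat \<Rightarrow> complex \<Rightarrow> complex" where
  "zeta_term n s = (s - 1) * of_nat (Suc n) powr (- s) + of_nat (Suc (Suc n)) powr (1 - s) - of_nat (Suc n) powr (1 - s)"

text \<open>A mean value estimate used twice: the term is f(m + 1) - f(m) with f'(z) = (s -
  1)(m^(-s) - z^(-s)), and this difference of powers is again bounded through its derivative. The
  gain of a factor 1 / m gives convergence for Re s > 0.\<close>

lemma norm_zeta_term_le:
  assumes "Re s > 0"
  shows "norm (zeta_term n s) \<le> norm (s - 1) * norm s * real (Suc n) powr (- Re s - 1)"
proof -
  define m where "m = real (Suc n)"
  have m: "m > 0" by (simp add: m_def)
  define S where "S = closed_segment (of_real m :: complex) (of_real (m + 1))"
  have S_ends: "of_real m \<in> S" "of_real (m + 1) \<in> S" by (auto simp: S_def)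
  have S: "\<exists>t. z = of_real t \<and> m \<le> t \<and> t \<le> m + 1" if "z \<in> S" for z
  proof -
    from that obtain u where u: "z = of_real (m + u)" "0 \<le> u" "u \<le> 1"
      by (auto simp: S_def closed_segment_def scaleR_conv_of_real algebra_simps)
    thus ?thesis by (intro exI[of _ "m + u"]) auto
  qed
  have S': "z \<notin> \<real>\<^sub>\<le>\<^sub>0" "z \<noteq> 0" if "z \<in> S" for z
    using S[OF that] m by auto
  have norm_powr: "norm ((of_real t :: complex) powr w) = t powr Re w" if "t \<ge> m" for t w
    using that m by (simp add: norm_powr_real_powr)
  have mono: "t powr (- Re s - 1) \<le> m powr (- Re s - 1)" if "t \<ge> m" for t
    using that m assms by (intro powr_mono2') auto
  have b1: "norm ((of_real m :: complex) powr (-s) - z powr (-s)) \<le> norm s * m powr (- Re s - 1)" if z: "z \<in> S" for z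
  proof -
    have "norm ((of_real m :: complex) powr (-s) - z powr (-s)) \<le> (norm s * m powr (- Re s - 1)) * norm (of_real m - z)"
    proof (rule field_differentiable_bound[where S = S and f' = "\<lambda>z. - s * z powr (- s - 1)"])
      fix w assume w: "w \<in> S"
      show "((\<lambda>z. z powr - s) has_field_derivative - s * w powr (- s - 1)) (at w within S)"
        by (rule has_field_derivative_at_within, rule has_field_derivative_powr, rule S'[OF w])
      show "norm (- s * w powr (- s - 1)) \<le> norm s * m powr (- Re s - 1)"
        using S[OF w] norm_powr mono by (auto simp: norm_mult intro!: mult_left_mono)
    qed (use S_ends z in \<open>auto simp: S_def\<close>)
    also have "\<dots> \<le> (norm s * m powr (- Re s - 1)) * 1"
    proof (intro mult_left_mono)
      obtain t where "z = of_real t" "m \<le> t" "t \<le> m + 1" using S[OF z] by auto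
      thus "norm (of_real m - z) \<le> 1"
        by (simp flip: of_real_diff)
    qed auto
    finally show ?thesis by simp
  qed
  define f where "f = (\<lambda>z. (s - 1) * of_real m powr (- s) * z + z powr (1 - s))"
  have "norm (f (of_real (m + 1)) - f (of_real m)) \<le> (norm (s - 1) * (norm s * m powr (- Re s - 1))) * norm (of_real (m + 1) - of_real m :: complex)"
  proof (rule field_differentiable_bound[where S = S and f' = "\<lambda>z. (s - 1) * (of_real m powr (- s) - z powr (- s))"])
    fix w assume w: "w \<in> S"
    show "(f has_field_derivative (s - 1) * (of_real m powr (- s) - w powr (- s))) (at w within S)"
      unfolding f_def using S'[OF w]
      by (auto intro!: derivative_eq_intros simp: algebra_simps)
    show "norm ((s - 1) * (of_real m powr (- s) - w powr (- s))) \<le> norm (s - 1) * (norm s * m powr (- Re s - 1))"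
      unfolding norm_mult by (intro mult_left_mono b1 w) auto
  qed (use S_ends in \<open>auto simp: S_def\<close>)
  also have "f (of_real (m + 1)) - f (of_real m) = zeta_term n s"
    by (simp add: f_def zeta_term_def m_def algebra_simps)
  finally show ?thesis by (simp add: m_def mult_ac)
qed

text \<open>The summand 1 compensates the telescoping part of \<open>zeta_term\<close>, which sums
  to -1 for Re s > 1.\<close>

definition reg_zeta :: "complex \<Rightarrow> complex" where
  "reg_zeta s = 1 + (\<Sum>n. zeta_term n s)"

lemma zeta_term_sums:
  assumes "Re s > 0"
  shows "(\<lambda>n. zeta_term n s) sums (reg_zeta s - 1)"
proof -
  have "summable (\<lambda>n. norm (s - 1) * norm s * real (Suc n) powr (- (Re s + 1)))"
    by (intro summable_mult summable_Suc_powr) (use assms in auto)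
  hence "summable (\<lambda>n. zeta_term n s)"
    by (rule summable_comparison_test') (use norm_zeta_term_le[OF assms] in auto)
  thus ?thesis by (simp add: reg_zeta_def summable_sums)
qed

lemma holomorphic_reg_zeta: "reg_zeta holomorphic_on {s. Re s > 0}"
proof -
  have op: "open {s. Re s > 0}" by (rule open_halfspace_Re_gt)
  define d where "d = (\<lambda>n. deriv (zeta_term n))"
  have hol: "zeta_term n holomorphic_on UNIV" for n
    unfolding zeta_term_def by (intro holomorphic_intros)
  have "\<exists>g g'. \<forall>x \<in> {s. Re s > 0}. ((\<lambda>n. zeta_term n x) sums g x) \<and> ((\<lambda>n. d n x) sums g' x) \<and> (g has_field_derivative g' x) (at x)"
  proof (rule series_and_derivative_comparison_complex[OF op])
    show "(zeta_term n has_field_derivative d n x) (at x)" for n x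
      unfolding d_def by (rule holomorphic_derivI[OF hol]) auto
  next
    fix x assume x: "x \<in> {s. Re s > 0}"
    \<comment> \<open>Half the distance to the line Re s = 0: the whole ball has Re y >= r, so the
      terms share the summable majorant \<open>h\<close>.\<close>
    define r where "r = Re x / 2"
    have r: "r > 0" using x by (auto simp: r_def)
    define B where "B = (norm x + r + 1) * (norm x + r)"
    define h where "h = (\<lambda>n. complex_of_real (B * real (Suc n) powr (- (r + 1))))"
    have "summable h" unfolding h_def
      by (intro summable_of_real summable_mult summable_Suc_powr) (use r in auto)
    moreover have "B \<ge> 0" using r by (auto simp: B_def)
    hence "range h \<subseteq> \<real>\<^sub>\<ge>\<^sub>0" by (auto simp: h_def simp del: of_nat_Suc)
    moreover have "norm (zeta_term n y) \<le> norm (h n)" if y: "y \<in> ball x r" for n y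
    proof -
      have "norm (x - y) < r" using y by (auto simp: dist_norm)
      moreover have "Re x - Re y \<le> norm (x - y)" using complex_Re_le_cmod[of "x - y"] by simp
      ultimately have Re: "Re y \<ge> r" by (simp add: r_def)
      have ny: "norm y \<le> norm x + r" using \<open>norm (x - y) < r\<close> norm_triangle_ineq2[of y x] by (simp add: norm_minus_commute)
      have "norm (zeta_term n y) \<le> norm (y - 1) * norm y * real (Suc n) powr (- Re y - 1)"
        using norm_zeta_term_le[of y] Re r by auto
      also have "\<dots> \<le> B * real (Suc n) powr (- (r + 1))"
        unfolding B_def using ny Re r norm_triangle_ineq4[of y 1]
        by (intro mult_mono powr_mono) auto
      also have "\<dots> = norm (h n)" using \<open>B \<ge> 0\<close> by (simp only: h_def norm_of_real) simp
      finally show ?thesis .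
    qed
    ultimately show "\<exists>d h. 0 < d \<and> summable h \<and> range h \<subseteq> \<real>\<^sub>\<ge>\<^sub>0 \<and> (\<forall>\<^sub>F n in sequentially. \<forall>y\<in>ball x d \<inter> {s. Re s > 0}. cmod(zeta_term n y) \<le> cmod (h n))"
      using r by (intro exI[of _ r] exI[of _ h]) auto
  qed
  then obtain g g' where g: "\<And>x. Re x > 0 \<Longrightarrow> (\<lambda>n. zeta_term n x) sums g x"
     "\<And>x. Re x > 0 \<Longrightarrow> (g has_field_derivative g' x) (at x)" by blast
  have "g holomorphic_on {s. Re s > 0}"
    unfolding holomorphic_on_open[OF op] using g(2) by blast
  hence "(\<lambda>s. 1 + g s) holomorphic_on {s. Re s > 0}" by (intro holomorphic_intros)
  moreover have "1 + g s = reg_zeta s" if "Re s > 0" for s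
    using sums_unique[OF g(1)[OF that]] by (simp add: reg_zeta_def)
  ultimately show ?thesis by (subst holomorphic_cong[OF refl]) auto
qed

lemma reg_zeta_1: "reg_zeta 1 = 1"
  by (simp add: reg_zeta_def zeta_term_def del: of_nat_Suc)

definition zeta_series :: "complex \<Rightarrow> complex" where
  "zeta_series s = (\<Sum>n. of_nat (Suc n) powr (- s))"

lemma zeta_series_sums:
  assumes "Re s > 1"
  shows "(\<lambda>n. of_nat (Suc n) powr (- s)) sums zeta_series s"
  unfolding zeta_series_def
  by (rule summable_sums, rule summable_norm_cancel, subst norm_nat_powr)
     (use summable_Suc_powr[OF assms] in simp)

lemma reg_zeta_eq:
  assumes s: "Re s > 1"
  shows "reg_zeta s = (s - 1) * zeta_series s"
proof -
  have "(\<lambda>n. real (Suc n) powr Re (1 - s)) \<longlonglongrightarrow> 0" using s by real_asymp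
  hence "(\<lambda>n. of_nat (Suc n) powr (1 - s) :: complex) \<longlonglongrightarrow> 0"
    by (intro tendsto_norm_zero_cancel[where f = "\<lambda>n. of_nat (Suc n) powr (1 - s)"]) (simp only: norm_nat_powr)
  from telescope_sums[OF this] have "(\<lambda>n. of_nat (Suc (Suc n)) powr (1 - s) - of_nat (Suc n) powr (1 - s)) sums (-1 :: complex)"
    by simp
  from sums_add[OF sums_mult[OF zeta_series_sums[OF s], of "s - 1"] this]
  have "(\<lambda>n. zeta_term n s) sums ((s - 1) * zeta_series s - 1)"
    by (simp add: zeta_term_def algebra_simps)
  thus ?thesis using zeta_term_sums[of s] s sums_unique2 by fastforce
qed

text \<open>Half of the excess s - 1 pays for the logarithm.\<close>

lemma ln_powr_le:
  assumes "s > 1" "r = (s - 1) / 2"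
  shows "ln (real (Suc n)) * real (Suc n) powr (- s) \<le> 1 / r * real (Suc n) powr (- (1 + r))"
proof -
  have r: "r > 0" using assms by simp
  have "ln (real (Suc n)) * real (Suc n) powr (- s) \<le> (real (Suc n) powr r / r) * real (Suc n) powr (- s)"
    by (intro mult_right_mono ln_powr_bound) (use r in auto)
  also have "\<dots> = 1 / r * real (Suc n) powr (r - s)"
    by (simp add: powr_diff powr_minus field_simps)
  also have "r - s = - (1 + r)" using assms by (simp add: field_simps)
  finally show ?thesis .
qed

lemma summable_ln_powr:
  assumes "s > 1"
  shows "summable (\<lambda>n. ln (real (Suc n)) * real (Suc n) powr (- s))"
proof -
  define r where "r = (s - 1) / 2"
  have r: "r > 0" using assms by (simp add: r_def)
  have "summable (\<lambda>n. 1 / r * real (Suc n) powr (- (1 + r)))"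
    by (intro summable_mult summable_Suc_powr) (use r in auto)
  thus ?thesis
    by (rule summable_comparison_test') (use ln_powr_le[OF assms r_def] in \<open>auto simp: abs_mult\<close>)
qed

lemma zeta_series_derivative:
  assumes s: "Re s > 1"
  shows "(zeta_series has_field_derivative - (\<Sum>n. of_real (ln (real (Suc n))) * of_nat (Suc n) powr (- s))) (at s)"
proof -
  have op: "open {s. Re s > 1}" by (rule open_halfspace_Re_gt)
  define f :: "nat \<Rightarrow> complex \<Rightarrow> complex" where "f = (\<lambda>n s. of_nat (Suc n) powr (- s))"
  define d where "d = (\<lambda>n s. - (of_real (ln (real (Suc n))) * of_nat (Suc n) powr (- s) :: complex))"
  have "\<exists>g g'. \<forall>x \<in> {s. Re s > 1}. ((\<lambda>n. f n x) sums g x) \<and> ((\<lambda>n. d n x) sums g' x) \<and> (g has_field_derivative g' x) (at x)"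
  proof (rule series_and_derivative_comparison_complex[OF op])
    have nz: "Ln (of_nat (Suc n)) = of_real (ln (real (Suc n)))" for n
      using Ln_of_real[of "real (Suc n)"] by (simp del: of_nat_Suc)
    show "(f n has_field_derivative d n x) (at x)" for n x
      unfolding d_def f_def
      by (rule DERIV_cong[OF DERIV_chain2[where f = "\<lambda>z. of_nat (Suc n) powr z" and g = uminus, OF has_field_derivative_powr_right DERIV_minus[OF DERIV_ident]]])
         (use nz[of n] in \<open>auto simp del: of_nat_Suc\<close>)
  next
    fix x assume x: "x \<in> {s. Re s > 1}"
    define r where "r = (Re x - 1) / 2"
    have r: "r > 0" using x by (auto simp: r_def)
    define h where "h = (\<lambda>n. complex_of_real (real (Suc n) powr (- (r + 1))))"
    have "summable h" unfolding h_def
      by (intro summable_of_real summable_Suc_powr) (use r in auto)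
    moreover have "range h \<subseteq> \<real>\<^sub>\<ge>\<^sub>0" by (auto simp: h_def simp del: of_nat_Suc)
    moreover have "norm (f n y) \<le> norm (h n)" if y: "y \<in> ball x r" for n y
    proof -
      have "norm (x - y) < r" using y by (auto simp: dist_norm)
      moreover have "Re x - Re y \<le> norm (x - y)" using complex_Re_le_cmod[of "x - y"] by simp
      ultimately have Re: "Re y \<ge> r + 1" by (simp add: r_def field_simps)
      thus ?thesis unfolding f_def h_def norm_nat_powr norm_of_real by (simp add: powr_mono)
    qed
    ultimately show "\<exists>d h. 0 < d \<and> summable h \<and> range h \<subseteq> \<real>\<^sub>\<ge>\<^sub>0 \<and> (\<forall>\<^sub>F n in sequentially. \<forall>y\<in>ball x d \<inter> {s. Re s > 1}. cmod(f n y) \<le> cmod (h n))"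
      using r by (intro exI[of _ r] exI[of _ h]) auto
  qed
  then obtain g g' where g: "\<And>x. Re x > 1 \<Longrightarrow> (\<lambda>n. f n x) sums g x"
     "\<And>x. Re x > 1 \<Longrightarrow> (\<lambda>n. d n x) sums g' x"
     "\<And>x. Re x > 1 \<Longrightarrow> (g has_field_derivative g' x) (at x)" by blast
  have "(zeta_series has_field_derivative g' s) (at s)"
  proof (rule has_field_derivative_transform_within_open[OF g(3)[OF s] op])
    show "g x = zeta_series x" if "x \<in> {s. Re s > 1}" for x
      using g(1)[of x] that sums_unique by (force simp: zeta_series_def f_def)
  qed (use s in auto)
  moreover have "(\<lambda>n. of_real (ln (real (Suc n))) * of_nat (Suc n) powr (- s)) sums (- g' s)"
    using sums_minus[OF g(2)[OF s]] by (simp add: d_def)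
  hence "g' s = - (\<Sum>n. of_real (ln (real (Suc n))) * of_nat (Suc n) powr (- s))"
    by (simp add: sums_iff)
  ultimately show ?thesis by simp
qed

section \<open>The von Mangoldt series as minus the logarithmic derivative of zeta\<close>

definition mangoldt_series :: "complex \<Rightarrow> complex" where
  "mangoldt_series s = (\<Sum>n. mangoldt (Suc n) * of_nat (Suc n) powr (- s))"

lemma summable_mangoldt_powr:
  assumes "s > 1"
  shows "summable (\<lambda>n. mangoldt (Suc n) * real (Suc n) powr (- s))"
proof (rule summable_comparison_test'[OF summable_ln_powr[OF assms]])
  fix n :: nat
  show "norm (mangoldt (Suc n) * real (Suc n) powr (- s)) \<le> ln (real (Suc n)) * real (Suc n) powr (- s)"
    using mangoldt_le[of "Suc n"] mangoldt_nonneg by (auto simp: abs_mult intro!: mult_right_mono)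
qed

lemma norm_mangoldt_term:
  "norm (mangoldt (Suc n) * of_nat (Suc n) powr (- s) :: complex) = mangoldt (Suc n) * real (Suc n) powr (- Re s)"
  by (simp add: norm_mult norm_nat_powr del: of_nat_Suc)

lemma mangoldt_series_sums:
  assumes "Re s > 1"
  shows "(\<lambda>n. mangoldt (Suc n) * of_nat (Suc n) powr (- s)) sums mangoldt_series s"
  unfolding mangoldt_series_def
  by (rule summable_sums, rule summable_norm_cancel, subst norm_mangoldt_term)
     (rule summable_mangoldt_powr[OF assms])

text \<open>Dirichlet convolution: the von Mangoldt function summed over the divisors of n gives ln
  n. Absolute convergence allows the double series over (i, j) to be regrouped by the product of its
  indices.\<close>

lemma mangoldt_series_times_zeta:
  assumes s: "Re s > 1"
  shows "mangoldt_series s * zeta_series s = (\<Sum>n. of_real (ln (real (Suc n))) * of_nat (Suc n) powr (- s))"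
proof -
  define a where "a = (\<lambda>n. mangoldt (Suc n) * of_nat (Suc n) powr (- s) :: complex)"
  define b where "b = (\<lambda>n. of_nat (Suc n) powr (- s) :: complex)"
  define l where "l = (\<lambda>n. of_real (ln (real (Suc n))) * of_nat (Suc n) powr (- s) :: complex)"
  \<comment> \<open>Pairs (n, i) with i + 1 a divisor of n + 1. All series are indexed from 0, so a
    factor pair (i, j) corresponds to n = (i + 1)(j + 1) - 1.\<close>
  define D where "D = Sigma (UNIV :: nat set) (\<lambda>n. {i. Suc i dvd Suc n})"
  have na: "summable (\<lambda>n. norm (a n))"
    unfolding a_def norm_mangoldt_term by (rule summable_mangoldt_powr[OF s])
  have nb: "summable (\<lambda>n. norm (b n))"
    unfolding b_def norm_nat_powr using summable_Suc_powr[OF s] by simp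
  have nl: "summable (\<lambda>n. norm (l n))"
    unfolding l_def norm_mult norm_nat_powr using summable_ln_powr[OF s] by simp
  have Ha: "(a has_sum mangoldt_series s) UNIV"
    using norm_summable_imp_has_sum[OF na] mangoldt_series_sums[OF s] by (simp add: a_def)
  have Hb: "(b has_sum zeta_series s) UNIV"
    using norm_summable_imp_has_sum[OF nb] zeta_series_sums[OF s] by (simp add: b_def)
  have Hl: "(l has_sum suminf l) UNIV"
    using norm_summable_imp_has_sum[OF nl] summable_sums[OF summable_norm_cancel[OF nl]] by simp
  have absa: "(\<lambda>i. norm (a i)) summable_on UNIV" and absb: "(\<lambda>i. norm (b i)) summable_on UNIV"
    using na nb by (auto intro!: norm_summable_imp_summable_on)
  define F where "F = (\<lambda>(i, j). a i * b j)"
  have "(\<lambda>x. norm (F x)) summable_on UNIV \<times> UNIV"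
  proof (rule summable_on_SigmaI)
    show "((\<lambda>j. norm (F (i, j))) has_sum norm (a i) * infsum (\<lambda>j. norm (b j)) UNIV) UNIV" for i
      using has_sum_cmult_right[OF has_sum_infsum[OF absb], of "norm (a i)"] by (simp add: F_def norm_mult)
    show "(\<lambda>i. norm (a i) * infsum (\<lambda>j. norm (b j)) UNIV) summable_on UNIV"
      by (rule summable_on_cmult_left[OF absa])
  qed auto
  hence FS: "F summable_on UNIV \<times> UNIV"
    using abs_summable_summable by blast
  have "infsum F (UNIV \<times> UNIV) = infsum (\<lambda>i. infsum (\<lambda>j. F (i, j)) UNIV) UNIV"
    using infsum_Sigma_banach[OF FS] by simp
  also have "\<dots> = mangoldt_series s * zeta_series s"
    using infsumI[OF Ha] infsumI[OF Hb] by (simp add: F_def infsum_cmult_right' infsum_cmult_left')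
  finally have 1: "infsum F (UNIV \<times> UNIV) = mangoldt_series s * zeta_series s" .
  define h where "h = (\<lambda>(n, i). mangoldt (Suc i) * of_nat (Suc n) powr (- s) :: complex)"
  have mult: "of_nat (Suc i) powr (- s) * of_nat (Suc j) powr (- s) = (of_nat (Suc i * Suc j) powr (- s) :: complex)" for i j
    unfolding of_nat_mult by (subst powr_times_real) (auto simp del: of_nat_Suc)
  have fwd: "h (Suc i * Suc j - 1, i) = F (i, j)" for i j
    using mult[of i j] unfolding h_def F_def a_def b_def
    by (simp del: of_nat_Suc mult_Suc mult_Suc_right)
  have bw: "(Suc i * Suc (Suc n div Suc i - 1) - 1, i) = (n, i)" if "Suc i dvd Suc n" for n i
  proof -
    from that obtain k where k: "Suc n = Suc i * k" by (elim dvdE)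
    then obtain k' where "k = Suc k'" by (cases k) auto
    hence "Suc i * Suc (Suc n div Suc i - 1) = Suc n"
      unfolding k by (simp del: mult_Suc mult_Suc_right)
    thus ?thesis by simp
  qed
  have fw': "Suc (Suc i * Suc j - 1) div Suc i - 1 = j" for i j
    by (simp del: mult_Suc mult_Suc_right)
  have eq: "infsum F (UNIV \<times> UNIV) = infsum h D"
    by (rule infsum_reindex_bij_witness[where i = "\<lambda>(n, i). (i, Suc n div Suc i - 1)" and j = "\<lambda>(i, j). (Suc i * Suc j - 1, i)"])
       (use fwd bw fw' in \<open>auto simp: D_def simp del: mult_Suc mult_Suc_right\<close>)
  have hS: "h summable_on D"
    by (rule iffD1[OF summable_on_reindex_bij_witness[where i = "\<lambda>(n, i). (i, Suc n div Suc i - 1)" and j = "\<lambda>(i, j). (Suc i * Suc j - 1, i)"] FS])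
       (use fwd bw fw' in \<open>auto simp: D_def simp del: mult_Suc mult_Suc_right\<close>)
  have inner: "infsum (\<lambda>i. h (n, i)) {i. Suc i dvd Suc n} = l n" for n
  proof -
    have fin: "finite {i. Suc i dvd Suc n}"
      by (rule finite_subset[of _ "{..n}"]) (auto dest: dvd_imp_le)
    have "infsum (\<lambda>i. h (n, i)) {i. Suc i dvd Suc n} = (\<Sum>i | Suc i dvd Suc n. mangoldt (Suc i)) * of_nat (Suc n) powr (- s)"
      using fin by (simp add: h_def sum_distrib_right del: of_nat_Suc)
    also have "(\<Sum>i | Suc i dvd Suc n. mangoldt (Suc i)) = (\<Sum>d | d dvd Suc n. mangoldt d :: complex)"
      by (rule sum.reindex_bij_witness[where i = "\<lambda>d. d - 1" and j = Suc]) (use dvd_pos_nat[of "Suc n"] in auto)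
    also have "\<dots> = of_real (ln (real (Suc n)))" by (rule mangoldt_sum) auto
    finally show ?thesis by (simp add: l_def)
  qed
  have "infsum h D = infsum (\<lambda>n. infsum (\<lambda>i. h (n, i)) {i. Suc i dvd Suc n}) UNIV"
    using infsum_Sigma_banach[of h UNIV "\<lambda>n. {i. Suc i dvd Suc n}"] hS by (simp add: D_def)
  also have "\<dots> = suminf l" using infsumI[OF Hl] by (simp add: inner)
  finally show ?thesis using 1 eq by (simp add: l_def)
qed

text \<open>The logarithmic derivative of (s - 1) zeta(s), multiplied by \<open>reg_zeta s\<close>
  so that it can be stated before zeros have been excluded.\<close>

lemma deriv_reg_zeta:
  assumes s: "Re s > 1"
  shows "mangoldt_series s * reg_zeta s = reg_zeta s / (s - 1) - deriv reg_zeta s"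
proof -
  have ne: "s \<noteq> 1" using s by auto
  define z' where "z' = - (\<Sum>n. of_real (ln (real (Suc n))) * of_nat (Suc n) powr (- s) :: complex)"
  have "((\<lambda>s. (s - 1) * zeta_series s) has_field_derivative (zeta_series s + (s - 1) * z')) (at s)"
    using zeta_series_derivative[OF s] unfolding z'_def[symmetric]
    by (auto intro!: derivative_eq_intros)
  hence "(reg_zeta has_field_derivative (zeta_series s + (s - 1) * z')) (at s)"
    by (rule has_field_derivative_transform_within_open[where S = "{s. Re s > 1}"])
       (use s reg_zeta_eq in \<open>auto simp: open_halfspace_Re_gt\<close>)
  hence d: "deriv reg_zeta s = zeta_series s + (s - 1) * z'" by (rule DERIV_imp_deriv)
  have p: "mangoldt_series s * zeta_series s = - z'"
    using mangoldt_series_times_zeta[OF s] by (simp add: z'_def)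
  have q: "reg_zeta s / (s - 1) = zeta_series s" using reg_zeta_eq[OF s] ne by simp
  have r: "mangoldt_series s * reg_zeta s = (s - 1) * (mangoldt_series s * zeta_series s)"
    using reg_zeta_eq[OF s] by simp
  show ?thesis unfolding r p q d by (simp add: algebra_simps)
qed

section \<open>Non-vanishing of zeta for Re s >= 1\<close>

text \<open>\<open>m\<close> is the order of vanishing of \<^const>\<open>reg_zeta\<close> at \<open>s0\<close>.\<close>

lemma reg_zeta_log_deriv_limit:
  assumes "Re s0 > 0"
  shows "\<exists>m::nat. (m = 0 \<longleftrightarrow> reg_zeta s0 \<noteq> 0) \<and>
    ((\<lambda>e::real. e * (deriv reg_zeta (s0 + e) / reg_zeta (s0 + e))) \<longlongrightarrow> of_nat m) (at_right 0) \<and>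
    eventually (\<lambda>e::real. reg_zeta (s0 + e) \<noteq> 0) (at_right 0)"
proof -
  let ?S = "{s. Re s > 0}"
  have op: "open ?S" by (rule open_halfspace_Re_gt)
  have shift: "((\<lambda>e::real. s0 + of_real e) \<longlongrightarrow> s0) (at_right 0)"
    by (rule tendsto_eq_intros refl | simp)+
  have ev_in: "eventually (\<lambda>e::real. s0 + of_real e \<in> B) (at_right 0)" if "open B" "s0 \<in> B" for B
    using topological_tendstoD[OF shift that] .
  obtain g r m where g: "(m::nat) = 0 \<longleftrightarrow> reg_zeta s0 \<noteq> 0" "0 < r" "ball s0 r \<subseteq> ?S"
      "g holomorphic_on ball s0 r" "\<And>w. w \<in> ball s0 r \<Longrightarrow> reg_zeta w = (w - s0) ^ m * g w" "g s0 \<noteq> 0"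
  proof (cases "reg_zeta s0 = 0")
    case True
    \<comment> \<open>The value at 1 is 1, so a zero of this function has finite order.\<close>
    have nc: "\<not> reg_zeta constant_on ?S"
      using True reg_zeta_1 assms by (force simp: constant_on_def)
    have conn: "connected ?S" by (intro convex_connected convex_halfspace_Re_gt)
    show ?thesis
      using holomorphic_factor_zero_nonconstant[OF holomorphic_reg_zeta op conn _ True nc] that assms True
      by (metis (mono_tags) bot_nat_0.not_eq_extremum centre_in_ball mem_Collect_eq)
  next
    case False
    obtain r where "r > 0" "ball s0 r \<subseteq> ?S" using op assms openE[of ?S s0] by auto
    thus ?thesis using that[of 0 r reg_zeta] False holomorphic_on_subset[OF holomorphic_reg_zeta] by auto
  qed
  have cont_g: "continuous (at s0) g" and cont_g': "continuous (at s0) (deriv g)"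
    using g(2,4) by (auto intro!: holomorphic_deriv continuous_on_interior[where S = "ball s0 r"] holomorphic_on_imp_continuous_on)
  have lim_g: "((\<lambda>e::real. g (s0 + e)) \<longlongrightarrow> g s0) (at_right 0)"
    by (rule isCont_tendsto_compose[OF cont_g shift])
  have lim_g': "((\<lambda>e::real. deriv g (s0 + e)) \<longlongrightarrow> deriv g s0) (at_right 0)"
    by (rule isCont_tendsto_compose[OF cont_g' shift])
  have nz: "eventually (\<lambda>e::real. g (s0 + e) \<noteq> 0) (at_right 0)"
    using tendsto_imp_eventually_ne[OF lim_g g(6)] .
  have ball: "eventually (\<lambda>e::real. s0 + e \<in> ball s0 r) (at_right 0)"
    by (rule ev_in) (use g in auto)
  have pos: "eventually (\<lambda>e::real. e > 0) (at_right 0)" by (simp add: eventually_at_right_less)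
  have H: "eventually (\<lambda>e::real. reg_zeta (s0 + e) \<noteq> 0) (at_right 0)"
    using nz ball pos by eventually_elim (use g(5) in auto)
  have "((\<lambda>e::real. of_nat m + of_real e * (deriv g (s0 + e) / g (s0 + e))) \<longlongrightarrow> of_nat m + of_real 0 * (deriv g s0 / g s0)) (at_right 0)"
    by (intro tendsto_intros lim_g lim_g' g(6))
  moreover have "eventually (\<lambda>e::real. of_nat m + of_real e * (deriv g (s0 + e) / g (s0 + e)) =
      e * (deriv reg_zeta (s0 + e) / reg_zeta (s0 + e))) (at_right 0)"
    using nz ball pos
  proof eventually_elim
    case (elim e)
    let ?w = "s0 + complex_of_real e"
    have "(g has_field_derivative deriv g ?w) (at ?w)"
      using g(4) elim holomorphic_derivI open_ball by blast
    hence "((\<lambda>w. (w - s0) ^ m * g w) has_field_derivative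
       (of_nat m * (?w - s0) ^ (m - 1) * g ?w + (?w - s0) ^ m * deriv g ?w)) (at ?w)"
      by (auto intro!: derivative_eq_intros)
    hence "(reg_zeta has_field_derivative
       (of_nat m * (?w - s0) ^ (m - 1) * g ?w + (?w - s0) ^ m * deriv g ?w)) (at ?w)"
      by (rule has_field_derivative_transform_within_open[where S = "ball s0 r"]) (use g(5) elim in auto)
    hence "deriv reg_zeta ?w = of_nat m * of_real e ^ (m - 1) * g ?w + of_real e ^ m * deriv g ?w"
      using DERIV_imp_deriv by fastforce
    moreover have "reg_zeta ?w = of_real e ^ m * g ?w" using g(5)[of ?w] elim by simp
    moreover have "of_nat m * of_real e * of_real e ^ (m - 1) = (of_nat m * of_real e ^ m :: complex)"
      by (cases m) auto
    ultimately show ?case using elim by (auto simp: field_simps)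
  qed
  ultimately have "((\<lambda>e::real. e * (deriv reg_zeta (s0 + e) / reg_zeta (s0 + e))) \<longlongrightarrow> of_nat m + of_real 0 * (deriv g s0 / g s0)) (at_right 0)"
    by (rule Lim_transform_eventually)
  thus ?thesis using g(1) H by (intro exI[of _ m]) simp
qed

text \<open>The residue of -zeta'/zeta at s0, read off along the horizontal ray to the right: the
  pole of zeta at 1 contributes 1, a zero of order m contributes -m.\<close>

lemma mangoldt_series_residue:
  assumes "Re s0 \<ge> 1"
  obtains m :: nat where "m = 0 \<longleftrightarrow> reg_zeta s0 \<noteq> 0"
    "((\<lambda>e::real. e * mangoldt_series (s0 + e)) \<longlongrightarrow> (if s0 = 1 then 1 else 0) - of_nat m) (at_right 0)"
proof -
  obtain m :: nat where m: "m = 0 \<longleftrightarrow> reg_zeta s0 \<noteq> 0"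
     "((\<lambda>e::real. e * (deriv reg_zeta (s0 + e) / reg_zeta (s0 + e))) \<longlongrightarrow> of_nat m) (at_right 0)"
     "eventually (\<lambda>e::real. reg_zeta (s0 + e) \<noteq> 0) (at_right 0)"
    using reg_zeta_log_deriv_limit[of s0] assms by auto
  have pos: "eventually (\<lambda>e::real. e > 0) (at_right 0)" by (simp add: eventually_at_right_less)
  have lim: "((\<lambda>e::real. of_real e / (s0 + of_real e - 1)) \<longlongrightarrow> (if s0 = 1 then 1 else 0)) (at_right 0)"
  proof (cases "s0 = 1")
    case True
    have "eventually (\<lambda>e::real. of_real e / (s0 + of_real e - 1) = (1::complex)) (at_right 0)"
      using pos by eventually_elim (auto simp: True)
    hence "((\<lambda>e::real. of_real e / (s0 + of_real e - 1)) \<longlongrightarrow> (1::complex)) (at_right 0)"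
      by (rule tendsto_eventually)
    thus ?thesis using True by simp
  next
    case False
    have "((\<lambda>e::real. of_real e / (s0 + of_real e - 1)) \<longlongrightarrow> of_real 0 / (s0 + of_real 0 - 1)) (at_right 0)"
      by (intro tendsto_intros) (use False in auto)
    thus ?thesis using False by simp
  qed
  have "((\<lambda>e::real. of_real e / (s0 + of_real e - 1) - e * (deriv reg_zeta (s0 + e) / reg_zeta (s0 + e)))
      \<longlongrightarrow> (if s0 = 1 then 1 else 0) - of_nat m) (at_right 0)"
    by (intro tendsto_diff lim m)
  moreover have "eventually (\<lambda>e::real. of_real e / (s0 + of_real e - 1) - e * (deriv reg_zeta (s0 + e) / reg_zeta (s0 + e))
       = e * mangoldt_series (s0 + e)) (at_right 0)"
    using m(3) pos
  proof eventually_elim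
    case (elim e)
    have "mangoldt_series (s0 + e) = 1 / (s0 + e - 1) - deriv reg_zeta (s0 + e) / reg_zeta (s0 + e)"
      using deriv_reg_zeta[of "s0 + e"] elim assms by (simp add: field_simps)
    thus ?case by (simp only: right_diff_distrib) simp
  qed
  ultimately have "((\<lambda>e::real. e * mangoldt_series (s0 + e)) \<longlongrightarrow> (if s0 = 1 then 1 else 0) - of_nat m) (at_right 0)"
    by (rule Lim_transform_eventually)
  thus ?thesis by (rule that[OF m(1)])
qed

text \<open>Termwise from 3 + 4 cos u + cos 2u = 2 (1 + cos u)^2 >= 0 with u = t ln n, because the
  von Mangoldt weights are nonnegative.\<close>

lemma three_four_one:
  assumes "e > 0"
  shows "3 * Re (mangoldt_series (1 + of_real e)) + 4 * Re (mangoldt_series (1 + \<i> * of_real t + of_real e))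
     + Re (mangoldt_series (1 + 2 * \<i> * of_real t + of_real e)) \<ge> 0"
proof -
  have sums: "(\<lambda>n. Re (mangoldt (Suc n) * of_nat (Suc n) powr (- s))) sums Re (mangoldt_series s)" if "Re s > 1" for s
    using sums_Re[OF mangoldt_series_sums[OF that]] .
  have trm: "Re (mangoldt (Suc n) * of_nat (Suc n) powr (- (1 + \<i> * of_real u + of_real e))) =
      mangoldt (Suc n) * real (Suc n) powr (- (1 + e)) * cos (u * ln (real (Suc n)))" for n u
  proof -
    have nz: "Ln (of_nat (Suc n)) = of_real (ln (real (Suc n)))"
      using Ln_of_real[of "real (Suc n)"] by (simp del: of_nat_Suc)
    have "(of_nat (Suc n) :: complex) powr (- (1 + \<i> * of_real u + of_real e)) =
       exp (- (1 + \<i> * of_real u + of_real e) * of_real (ln (real (Suc n))))"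
      using nz by (simp add: powr_def del: of_nat_Suc)
    hence "Re (of_nat (Suc n) powr (- (1 + \<i> * of_real u + of_real e))) =
       exp (- (1 + e) * ln (real (Suc n))) * cos (u * ln (real (Suc n)))"
      by (simp add: Re_exp algebra_simps del: of_nat_Suc)
    also have "exp (- (1 + e) * ln (real (Suc n))) = real (Suc n) powr (- (1 + e))"
      by (simp add: powr_def del: of_nat_Suc)
    finally show ?thesis by (simp del: of_nat_Suc)
  qed
  have trm0: "Re (mangoldt (Suc n) * of_nat (Suc n) powr (- (1 + of_real e))) =
      mangoldt (Suc n) * real (Suc n) powr (- (1 + e))" for n
    using trm[of n 0] by simp
  have trm2: "Re (mangoldt (Suc n) * of_nat (Suc n) powr (- (1 + 2 * \<i> * of_real t + of_real e))) =
      mangoldt (Suc n) * real (Suc n) powr (- (1 + e)) * cos (2 * (t * ln (real (Suc n))))" for n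
    using trm[of n "2 * t"] by (simp add: mult_ac)
  have S: "(\<lambda>n. 3 * (mangoldt (Suc n) * real (Suc n) powr (- (1 + e)))
       + 4 * (mangoldt (Suc n) * real (Suc n) powr (- (1 + e)) * cos (t * ln (real (Suc n))))
       + (mangoldt (Suc n) * real (Suc n) powr (- (1 + e)) * cos (2 * (t * ln (real (Suc n))))))
     sums (3 * Re (mangoldt_series (1 + of_real e)) + 4 * Re (mangoldt_series (1 + \<i> * of_real t + of_real e))
     + Re (mangoldt_series (1 + 2 * \<i> * of_real t + of_real e)))"
    using sums[of "1 + of_real e"] sums[of "1 + \<i> * of_real t + of_real e"] sums[of "1 + 2 * \<i> * of_real t + of_real e"] assms
    unfolding trm trm0 trm2 by (intro sums_add sums_mult) auto
  show ?thesis
  proof (rule sums_le[OF _ sums_zero S])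
    fix n
    define c where "c = cos (t * ln (real (Suc n)))"
    define w where "w = mangoldt (Suc n) * real (Suc n) powr (- (1 + e))"
    have "w \<ge> 0" using mangoldt_nonneg by (auto simp: w_def)
    have "w * (2 * (1 + c)\<^sup>2) \<ge> 0" using \<open>w \<ge> 0\<close> by auto
    also have "w * (2 * (1 + c)\<^sup>2) = 3 * w + 4 * (w * c) + w * cos (2 * (t * ln (real (Suc n))))"
      unfolding cos_double_cos c_def[symmetric] by (simp add: power2_eq_square algebra_simps)
    finally show "0 \<le> 3 * (mangoldt (Suc n) * real (Suc n) powr (- (1 + e)))
       + 4 * (mangoldt (Suc n) * real (Suc n) powr (- (1 + e)) * cos (t * ln (real (Suc n))))
       + (mangoldt (Suc n) * real (Suc n) powr (- (1 + e)) * cos (2 * (t * ln (real (Suc n)))))"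
      by (simp add: w_def c_def)
  qed
qed

text \<open>For Re s0 > 1 the von Mangoldt series stays bounded near s0, so its residue, minus the
  order of the zero, is 0. For s0 = 1 + i t with t nonzero, \<open>three_four_one\<close> times e
  gives 3 - 4 m2 - m3 >= 0 in the limit, where m2 and m3 are the orders at s0 and 1 + 2 i t; hence
  m2 = 0.\<close>

lemma reg_zeta_nonzero:
  assumes "Re s0 \<ge> 1"
  shows "reg_zeta s0 \<noteq> 0"
proof (cases "Re s0 > 1")
  case True
  obtain m :: nat where m: "m = 0 \<longleftrightarrow> reg_zeta s0 \<noteq> 0"
    "((\<lambda>e::real. e * mangoldt_series (s0 + e)) \<longlongrightarrow> (if s0 = 1 then 1 else 0) - of_nat m) (at_right 0)"
    by (rule mangoldt_series_residue[OF assms])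
  define B where "B = (\<Sum>n. mangoldt (Suc n) * real (Suc n) powr (- Re s0))"
  have pos: "eventually (\<lambda>e::real. e > 0) (at_right 0)" by (simp add: eventually_at_right_less)
  have bound: "norm (mangoldt_series (s0 + of_real e)) \<le> B" if "e > 0" for e
    unfolding B_def
  proof (rule norm_sums_le[OF mangoldt_series_sums summable_sums[OF summable_mangoldt_powr[OF True]]])
    show "Re (s0 + of_real e) > 1" using that True by simp
    show "norm (mangoldt (Suc n) * of_nat (Suc n) powr (- (s0 + of_real e)) :: complex) \<le> mangoldt (Suc n) * real (Suc n) powr (- Re s0)" for n
      unfolding norm_mangoldt_term using that by (intro mult_left_mono powr_mono mangoldt_nonneg) auto
  qed
  have "((\<lambda>e::real. e * mangoldt_series (s0 + e)) \<longlongrightarrow> 0) (at_right 0)"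
  proof (rule Lim_null_comparison)
    show "\<forall>\<^sub>F e in at_right 0. norm (of_real e * mangoldt_series (s0 + of_real e)) \<le> e * B"
      using pos by eventually_elim (use bound in \<open>auto simp: norm_mult\<close>)
    have "((\<lambda>e. e * B) \<longlongrightarrow> 0 * B) (at_right 0)" by (intro tendsto_intros)
    thus "((\<lambda>e. e * B) \<longlongrightarrow> 0) (at_right 0)" by simp
  qed
  from tendsto_unique[OF _ m(2) this] have "m = 0" using True by (auto split: if_splits)
  thus ?thesis using m by simp
next
  case False
  define t where "t = Im s0"
  have s0: "s0 = 1 + \<i> * of_real t" using False assms by (auto simp: complex_eq_iff t_def)
  show ?thesis
  proof (cases "t = 0")
    case True
    thus ?thesis using s0 reg_zeta_1 by simp
  next
    case t: False
    obtain m1 :: nat where m1: "m1 = 0 \<longleftrightarrow> reg_zeta 1 \<noteq> 0"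
      "((\<lambda>e::real. e * mangoldt_series (1 + e)) \<longlongrightarrow> (if (1::complex) = 1 then 1 else 0) - of_nat m1) (at_right 0)"
      by (rule mangoldt_series_residue[of 1]) simp
    obtain m2 :: nat where m2: "m2 = 0 \<longleftrightarrow> reg_zeta s0 \<noteq> 0"
      "((\<lambda>e::real. e * mangoldt_series (s0 + e)) \<longlongrightarrow> (if s0 = 1 then 1 else 0) - of_nat m2) (at_right 0)"
      by (rule mangoldt_series_residue[OF assms])
    define s1 where "s1 = 1 + 2 * \<i> * of_real t"
    obtain m3 :: nat where m3:
      "((\<lambda>e::real. e * mangoldt_series (s1 + e)) \<longlongrightarrow> (if s1 = 1 then 1 else 0) - of_nat m3) (at_right 0)"
      by (rule mangoldt_series_residue[of s1]) (simp add: s1_def)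
    have ne: "s0 \<noteq> 1" "s1 \<noteq> 1" using t by (auto simp: s0 s1_def)
    have "m1 = 0" using m1 reg_zeta_1 by simp
    have "((\<lambda>e::real. Re (3 * (e * mangoldt_series (1 + e)) + 4 * (e * mangoldt_series (s0 + e)) + e * mangoldt_series (s1 + e)))
      \<longlongrightarrow> Re (3 * ((if (1::complex) = 1 then 1 else 0) - of_nat m1) + 4 * ((if s0 = 1 then 1 else 0) - of_nat m2) + ((if s1 = 1 then 1 else 0) - of_nat m3))) (at_right 0)"
      by (intro tendsto_Re tendsto_add tendsto_mult tendsto_const m1 m2 m3)
    moreover have "eventually (\<lambda>e::real. 0 \<le> Re (3 * (e * mangoldt_series (1 + e)) + 4 * (e * mangoldt_series (s0 + e)) + e * mangoldt_series (s1 + e))) (at_right 0)"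
      using eventually_at_right_less[of "0::real"]
    proof eventually_elim
      case (elim e)
      have "0 \<le> e * (3 * Re (mangoldt_series (1 + of_real e)) + 4 * Re (mangoldt_series (s0 + of_real e))
     + Re (mangoldt_series (s1 + of_real e)))"
        using three_four_one[OF elim, of t] elim unfolding s0 s1_def by simp
      thus ?case by (simp add: algebra_simps)
    qed
    ultimately have "0 \<le> Re (3 * ((if (1::complex) = 1 then 1 else 0) - of_nat m1) + 4 * ((if s0 = 1 then 1 else 0) - of_nat m2) + ((if s1 = 1 then 1 else 0) - of_nat m3))"
      by (rule tendsto_lowerbound) auto
    hence "m2 = 0" using ne \<open>m1 = 0\<close> by simp
    thus ?thesis using m2 by simp
  qed
qed

section \<open>Chebyshev's estimates\<close>

definition primes_upto :: "nat \<Rightarrow> nat set" where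
  "primes_upto n = {p. prime p \<and> p \<le> n}"

definition chebyshev_theta :: "nat \<Rightarrow> real" where
  "chebyshev_theta n = (\<Sum>p\<in>primes_upto n. ln (real p))"

definition chebyshev_psi :: "nat \<Rightarrow> real" where
  "chebyshev_psi n = (\<Sum>k\<in>{1..n}. mangoldt k)"

lemma finite_primes_upto [simp]: "finite (primes_upto n)"
  by (rule finite_subset[of _ "{..n}"]) (auto simp: primes_upto_def)

lemma prod_primes_dvd:
  assumes "finite P" "\<And>p. p \<in> P \<Longrightarrow> prime (p::nat)" "\<And>p. p \<in> P \<Longrightarrow> p dvd n"
  shows "\<Prod>P dvd n"
  using assms
proof (induction P rule: finite_induct)
  case (insert p P)
  have "coprime p (\<Prod>P)"
    by (rule prod_coprime_right) (use insert in \<open>auto intro!: primes_coprime\<close>)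
  thus ?case using insert by (simp add: divides_mult)
qed auto

text \<open>Every prime in (n - m, n] divides the binomial coefficient: it divides n! but, since m
  <= n - m, neither m! nor (n - m)!.\<close>

lemma chebyshev_theta_diff_le:
  assumes "m \<le> n - m" "m \<le> n"
  shows "chebyshev_theta n - chebyshev_theta (n - m) \<le> ln (real (n choose m))"
proof -
  define P where "P = {p. prime p \<and> n - m < p \<and> p \<le> n}"
  have fin: "finite P" by (rule finite_subset[of _ "{..n}"]) (auto simp: P_def)
  have "p dvd (n choose m)" if "p \<in> P" for p
  proof -
    have p: "prime p" "n - m < p" "p \<le> n" using that by (auto simp: P_def)
    have "p dvd fact n" using p by (simp add: prime_dvd_fact_iff)
    hence "p dvd fact m * fact (n - m) * (n choose m)"
      using binomial_fact_lemma[OF assms(2)] by simp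
    moreover have "\<not> p dvd fact m" "\<not> p dvd fact (n - m)"
      using p assms by (auto simp: prime_dvd_fact_iff)
    ultimately show ?thesis using p prime_dvd_mult_iff by blast
  qed
  hence "(\<Prod>p\<in>P. p) dvd (n choose m)"
    using fin by (intro prod_primes_dvd) (auto simp: P_def)
  hence "(\<Prod>p\<in>P. p) \<le> (n choose m)" using assms by (intro dvd_imp_le) auto
  hence "real (\<Prod>p\<in>P. p) \<le> real (n choose m)" by (rule of_nat_mono)
  hence le: "(\<Prod>p\<in>P. real p) \<le> real (n choose m)" by simp
  have "chebyshev_theta n = (\<Sum>p\<in>primes_upto (n - m) \<union> P. ln (real p))"
    unfolding chebyshev_theta_def by (rule sum.cong) (auto simp: P_def primes_upto_def)
  also have "\<dots> = chebyshev_theta (n - m) + (\<Sum>p\<in>P. ln (real p))"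
    unfolding chebyshev_theta_def using fin
    by (intro sum.union_disjoint) (auto simp: P_def primes_upto_def)
  also have "(\<Sum>p\<in>P. ln (real p)) = ln (\<Prod>p\<in>P. real p)"
    by (rule ln_prod[symmetric]) (use fin in \<open>auto simp: P_def dest: prime_gt_0_nat\<close>)
  also have "\<dots> \<le> ln (real (n choose m))"
    by (subst ln_le_cancel_iff) (use le assms in \<open>auto simp: P_def dest: prime_gt_0_nat intro!: prod_pos\<close>)
  finally show ?thesis by simp
qed

text \<open>Induction by halving n. Both middle coefficients are at most 4^m, in the odd case
  because the coefficient occurs twice in a row with sum 2^(2m + 1).\<close>

lemma chebyshev_theta_le: "chebyshev_theta n \<le> real n * ln 4"
proof (induction n rule: less_induct)
  case (less n)
  have ln4: "ln (4::real) = 2 * ln 2" using ln_realpow[of 2 2] by simp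
  define m where "m = n div 2"
  consider "n \<le> 1" | "n = 2 * m" "m > 0" | "n = 2 * m + 1" "m > 0"
    unfolding m_def by linarith
  thus ?case
  proof cases
    case 1
    hence "primes_upto n = {}" by (auto simp: primes_upto_def dest: prime_gt_1_nat)
    thus ?thesis by (simp add: chebyshev_theta_def)
  next
    case 2
    have "(2 * m choose m) \<le> 2 ^ (2 * m)" by (rule binomial_le_pow2)
    hence "ln (real (2 * m choose m)) \<le> ln (2 ^ (2 * m))"
      by (subst ln_le_cancel_iff) (auto simp flip: of_nat_le_iff)
    also have "\<dots> = 2 * m * ln 2" by (simp add: ln_realpow)
    finally have "chebyshev_theta n \<le> chebyshev_theta m + 2 * m * ln 2"
      using chebyshev_theta_diff_le[of m n] 2 by simp
    also have "chebyshev_theta m \<le> m * ln 4" using less[of m] 2 by simp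
    finally show ?thesis using 2 by (simp add: ln4 algebra_simps)
  next
    case 3
    have "(\<Sum>k\<in>{m, m + 1}. (2 * m + 1 choose k)) \<le> (\<Sum>k\<le>2 * m + 1. (2 * m + 1 choose k))"
      by (rule sum_mono2) auto
    also have "\<dots> = 2 ^ (2 * m + 1)" by (rule choose_row_sum)
    also have "(\<Sum>k\<in>{m, m + 1}. (2 * m + 1 choose k)) = 2 * (2 * m + 1 choose m)"
      using binomial_symmetric[of m "2 * m + 1"] by simp
    finally have "(2 * m + 1 choose m) \<le> 2 ^ (2 * m)" by simp
    hence "real (2 * m + 1 choose m) \<le> real (2 ^ (2 * m))" by (rule of_nat_mono)
    hence "real (2 * m + 1 choose m) \<le> 2 ^ (2 * m)" by simp
    hence "ln (real (2 * m + 1 choose m)) \<le> ln (2 ^ (2 * m))"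
      by (subst ln_le_cancel_iff) auto
    also have "\<dots> = 2 * m * ln 2" by (simp add: ln_realpow)
    finally have "chebyshev_theta n \<le> chebyshev_theta (m + 1) + 2 * m * ln 2"
      using chebyshev_theta_diff_le[of m n] 3 by simp
    also have "chebyshev_theta (m + 1) \<le> (m + 1) * ln 4" using less[of "m + 1"] 3 by simp
    finally show ?thesis using 3 by (simp add: ln4 algebra_simps)
  qed
qed

text \<open>A prime p has at most ln n / ln p powers up to n, each of weight ln p, so it contributes
  at most ln n.\<close>

lemma chebyshev_psi_le_primes: "chebyshev_psi n \<le> real (card (primes_upto n)) * ln (real n)"
proof (cases "n = 0")
  case False
  define Q where "Q = {q\<in>{1..n}. primepow q}"
  have finQ: "finite Q" by (simp add: Q_def)
  have im: "aprimedivisor ` Q \<subseteq> primes_upto n"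
  proof (intro subsetI, elim imageE)
    fix p q assume pq: "p = aprimedivisor q" "q \<in> Q"
    then obtain r k where rk: "prime r" "k > 0" "q = r ^ k" "q \<le> n"
      by (auto simp: Q_def primepow_def)
    hence "p = r" using pq by (simp add: aprimedivisor_prime_power)
    moreover have "r \<le> r ^ k" using rk by (intro self_le_power) (auto dest: prime_gt_0_nat intro: Suc_leI)
    ultimately show "p \<in> primes_upto n" using rk by (simp add: primes_upto_def)
  qed
  have fib: "(\<Sum>q | q \<in> Q \<and> aprimedivisor q = p. mangoldt q :: real) \<le> ln (real n)" if p: "p \<in> primes_upto n" for p
  proof -
    have pr: "prime p" using p by (auto simp: primes_upto_def)
    define K where "K = {k. k > 0 \<and> p ^ k \<le> n}"
    have p1: "real p > 1" using prime_gt_1_nat[OF pr] by simp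
    have Kle: "real k * ln (real p) \<le> ln (real n)" if "p ^ k \<le> n" for k
    proof -
      have "ln (real p ^ k) \<le> ln (real n)"
        using that p1 False by (subst ln_le_cancel_iff) (auto simp flip: of_nat_power)
      thus ?thesis using p1 by (simp add: ln_realpow)
    qed
    have "K \<subseteq> {1..nat \<lfloor>ln (real n) / ln (real p)\<rfloor>}"
      using Kle p1 by (auto simp: K_def pos_le_divide_eq intro!: le_nat_floor)
    hence cK: "card K \<le> nat \<lfloor>ln (real n) / ln (real p)\<rfloor>" and finK: "finite K"
      using card_mono[of "{1..nat \<lfloor>ln (real n) / ln (real p)\<rfloor>}" K] finite_subset by auto
    have "real (card K) \<le> ln (real n) / ln (real p)"
      by (rule order_trans[OF of_nat_mono[OF cK] of_nat_floor]) (use False p1 in auto)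
    hence card: "real (card K) * ln (real p) \<le> ln (real n)" using p1 by (simp add: field_simps)
    have sub: "{q. q \<in> Q \<and> aprimedivisor q = p} \<subseteq> (\<lambda>k. p ^ k) ` K"
      by (auto simp: Q_def K_def primepow_def aprimedivisor_prime_power)
    have "(\<Sum>q | q \<in> Q \<and> aprimedivisor q = p. mangoldt q :: real) \<le> (\<Sum>q\<in>(\<lambda>k. p ^ k) ` K. mangoldt q)"
      using finK sub mangoldt_nonneg by (intro sum_mono2) auto
    also have "\<dots> \<le> (\<Sum>k\<in>K. mangoldt (p ^ k))"
      using sum_image_le[OF finK, of "mangoldt :: nat \<Rightarrow> real" "\<lambda>k. p ^ k"] mangoldt_nonneg
      by (simp add: o_def)
    also have "\<dots> = real (card K) * ln (real p)"
      using pr by (simp add: K_def)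
    finally show ?thesis using card by simp
  qed
  have "chebyshev_psi n = (\<Sum>q\<in>Q. mangoldt q)"
    unfolding chebyshev_psi_def Q_def by (rule sum.mono_neutral_right) (auto simp: mangoldt_def)
  also have "\<dots> = (\<Sum>p\<in>primes_upto n. \<Sum>q | q \<in> Q \<and> aprimedivisor q = p. mangoldt q)"
    by (rule sum.group[symmetric]) (use finQ im in auto)
  also have "\<dots> \<le> (\<Sum>p\<in>primes_upto n. ln (real n))" by (intro sum_mono fib)
  finally show ?thesis by simp
qed (simp add: chebyshev_psi_def)

lemma chebyshev_theta_le_psi: "chebyshev_theta n \<le> chebyshev_psi n"
proof -
  have "chebyshev_theta n = (\<Sum>p\<in>primes_upto n. mangoldt p)"
    unfolding chebyshev_theta_def by (rule sum.cong) (auto simp: primes_upto_def)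
  also have "\<dots> \<le> chebyshev_psi n" unfolding chebyshev_psi_def
    by (rule sum_mono2) (auto simp: primes_upto_def mangoldt_nonneg dest: prime_gt_0_nat)
  finally show ?thesis .
qed

text \<open>Primes above n^(1 - d) weigh at least (1 - d) ln n in theta; the others are at most n^(1
  - d) in number.\<close>

lemma card_primes_upto_le:
  assumes n: "n > 1" and d: "0 < d" "d < 1"
  shows "real (card (primes_upto n)) \<le> real n powr (1 - d) + chebyshev_theta n / ((1 - d) * ln (real n))"
proof -
  define y where "y = real n powr (1 - d)"
  define A where "A = {p\<in>primes_upto n. real p \<le> y}"
  define B where "B = {p\<in>primes_upto n. real p > y}"
  have fin: "finite A" "finite B" by (auto simp: A_def B_def)
  have y: "y > 0" using n by (simp add: y_def)
  have "A \<subseteq> {1..nat \<lfloor>y\<rfloor>}"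
    by (auto simp: A_def primes_upto_def Suc_le_eq intro!: le_nat_floor dest: prime_gt_0_nat)
  hence cA: "card A \<le> nat \<lfloor>y\<rfloor>" using card_mono[of "{1..nat \<lfloor>y\<rfloor>}" A] by simp
  have A: "real (card A) \<le> y"
    by (rule order_trans[OF of_nat_mono[OF cA] of_nat_floor]) (use y in auto)
  have "real (card B) * ((1 - d) * ln (real n)) = (\<Sum>p\<in>B. ln y)"
    using n by (simp add: y_def ln_powr)
  also have "\<dots> \<le> (\<Sum>p\<in>B. ln (real p))"
    using y by (intro sum_mono) (auto simp: B_def)
  also have "\<dots> \<le> chebyshev_theta n" unfolding chebyshev_theta_def
    by (rule sum_mono2) (auto simp: B_def primes_upto_def dest: prime_gt_0_nat)
  finally have B: "real (card B) \<le> chebyshev_theta n / ((1 - d) * ln (real n))"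
    using n d by (simp add: field_simps)
  have "primes_upto n = A \<union> B" by (auto simp: A_def B_def)
  hence "card (primes_upto n) \<le> card A + card B" by (simp add: card_Un_le)
  thus ?thesis using A B by (simp add: y_def)
qed

text \<open>With d = 1/2 in \<open>card_primes_upto_le\<close>, psi(n) <= sqrt n ln n + 2 theta(n).
  The 5 is 2 + 3, from ln n <= 2 sqrt n and ln 4 <= 3/2.\<close>

lemma chebyshev_psi_le: "chebyshev_psi n \<le> 5 * real n"
proof (cases "n > 1")
  case True
  define l where "l = ln (real n)"
  have l: "l > 0" using True by (simp add: l_def)
  have "chebyshev_psi n \<le> real (card (primes_upto n)) * l"
    unfolding l_def by (rule chebyshev_psi_le_primes)
  also have "\<dots> \<le> (real n powr (1 - 1/2) + chebyshev_theta n / ((1 - 1/2) * l)) * l"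
    using card_primes_upto_le[OF True, of "1/2"] l unfolding l_def by (intro mult_right_mono) auto
  also have "\<dots> = sqrt (real n) * l + 2 * chebyshev_theta n"
    using l by (simp add: field_simps powr_half_sqrt)
  finally have 1: "chebyshev_psi n \<le> sqrt (real n) * l + 2 * chebyshev_theta n" .
  have "ln (sqrt (real n)) \<le> sqrt (real n) - 1" using True by (intro ln_le_minus_one) auto
  hence "l \<le> 2 * sqrt (real n)" using True by (simp add: l_def ln_sqrt)
  hence "sqrt (real n) * l \<le> sqrt (real n) * (2 * sqrt (real n))" by (intro mult_left_mono) auto
  moreover have "sqrt (real n) * (2 * sqrt (real n)) = 2 * real n" by (simp add: mult.left_commute)
  ultimately have 2: "sqrt (real n) * l \<le> 2 * real n" by (simp only:)
  have "ln (4::real) = 2 * ln 2" using ln_realpow[of 2 2] by simp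
  hence "ln (4::real) \<le> 3/2" using ln2_le_25_over_36 by simp
  hence "real n * ln 4 \<le> real n * (3/2)" by (intro mult_left_mono) auto
  thus ?thesis using 1 2 chebyshev_theta_le[of n] by simp
next
  case False
  hence "n = 0 \<or> n = 1" by auto
  thus ?thesis by (auto simp: chebyshev_psi_def)
qed

section \<open>The prime number theorem\<close>

text \<open>For \<open>m = n + 1\<close> this is the integral of \<open>t powr (- z - 2)\<close> over \<open>t \<in> [m, m + 1]\<close>; the case split
  removes the singularity of its closed form at \<open>- 1\<close>.\<close>

definition newman_kernel :: "nat \<Rightarrow> complex \<Rightarrow> complex" where
  "newman_kernel n z = (let k = (\<lambda>z. of_nat (Suc n) powr (- z - 1) - of_nat (Suc (Suc n)) powr (- z - 1))
     in if z = - 1 then deriv k (- 1) else (k z - k (- 1)) / (z - (- 1)))"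

lemma newman_kernel_holomorphic: "newman_kernel n holomorphic_on UNIV"
proof -
  define k where "k = (\<lambda>z. of_nat (Suc n) powr (- z - 1) - of_nat (Suc (Suc n)) powr (- z - 1) :: complex)"
  have "k holomorphic_on UNIV" unfolding k_def by (intro holomorphic_intros)
  from pole_lemma_open[OF this open_UNIV, of "-1"]
  show ?thesis unfolding newman_kernel_def k_def Let_def .
qed

lemma newman_kernel_eq:
  assumes "z \<noteq> -1"
  shows "newman_kernel n z = (of_nat (Suc n) powr (- z - 1) - of_nat (Suc (Suc n)) powr (- z - 1)) / (z + 1)"
proof -
  have "of_nat (Suc n) powr (- (- 1) - 1) = (1 :: complex)" for n
    by (simp add: powr_def del: of_nat_Suc)
  thus ?thesis using assms by (simp only: newman_kernel_def Let_def if_False) simp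
qed

lemma newman_kernel_0: "newman_kernel n 0 = 1 / (of_nat (Suc n) * of_nat (Suc (Suc n)))"
proof -
  have "of_nat (Suc n) powr (- 0 - 1) = 1 / (of_nat (Suc n) :: complex)" for n
    using powr_minus[of "of_nat (Suc n) :: complex" 1] by (simp add: inverse_eq_divide del: of_nat_Suc)
  hence "newman_kernel n 0 = 1 / of_nat (Suc n) - 1 / of_nat (Suc (Suc n))"
    by (subst newman_kernel_eq) (auto simp del: of_nat_Suc)
  also have "\<dots> = (of_nat (Suc (Suc n)) - of_nat (Suc n)) / (of_nat (Suc n) * of_nat (Suc (Suc n)))"
    by (subst diff_frac_eq) (auto simp del: of_nat_Suc simp: mult.commute)
  finally show ?thesis by simp
qed

text \<open>For t in [m, m + 1] one has m |t^(-z - 2)| <= t^(-Re z - 1), and the right side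
  integrates to the difference quotient. Together with |psi_err| = O(n) this is the bound demanded
  by \<open>newman_tauberian\<close>.\<close>

lemma norm_newman_kernel_le:
  assumes "z \<noteq> -1" "Re z \<noteq> 0"
  shows "real (Suc n) * norm (newman_kernel n z) \<le> (real (n + 1) powr (- Re z) - real (n + 2) powr (- Re z)) / Re z"
proof -
  define m where "m = real (Suc n)"
  have m: "m > 0" by (simp add: m_def)
  have z: "z + 1 \<noteq> 0" using assms(1) by (metis add.inverse_inverse eq_neg_iff_add_eq_0)
  define f where "f = (\<lambda>t::real. - (of_real m * of_real t powr (- z - 1)) / (z + 1))"
  define f' where "f' = (\<lambda>t::real. of_real m * of_real t powr (- z - 2))"
  define p where "p = (\<lambda>t::real. - (t powr (- Re z)) / Re z)"
  define p' where "p' = (\<lambda>t::real. t powr (- Re z - 1))"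
  have df: "(f has_vector_derivative f' t) (at t)" if "t \<ge> m" for t
  proof -
    have t: "t > 0" using that m by simp
    have "((\<lambda>w. - (of_real m * w powr (- z - 1)) / (z + 1)) has_field_derivative
             (- (of_real m * ((- z - 1) * of_real t powr (- z - 1 - 1))) / (z + 1))) (at (of_real t))"
      using t by (intro DERIV_cdivide DERIV_minus DERIV_cmult has_field_derivative_powr) auto
    also have "- (of_real m * ((- z - 1) * of_real t powr (- z - 1 - 1))) / (z + 1) = f' t"
      using z by (simp add: f'_def field_simps)
    finally show ?thesis unfolding f_def by (rule has_vector_derivative_real_field)
  qed
  have dp: "(p has_real_derivative p' t) (at t)" if "t \<ge> m" for t
    using that m assms(2) unfolding p_def p'_def
    by (auto intro!: derivative_eq_intros simp: field_simps)
  have "norm (f (m + 1) - f m) \<le> p (m + 1) - p m"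
  proof (rule differentiable_bound_general[where f' = f' and \<phi>' = p'])
    show "continuous_on {m..m + 1} f"
      by (intro continuous_at_imp_continuous_on ballI has_vector_derivative_continuous[OF df]) auto
    show "continuous_on {m..m + 1} p"
      by (intro continuous_at_imp_continuous_on ballI DERIV_isCont[OF dp]) auto
    fix t assume t: "m < t" "t < m + 1"
    show "(f has_vector_derivative f' t) (at t)" using t df by simp
    show "(p has_vector_derivative p' t) (at t)"
      using dp[of t] t by (simp add: has_real_derivative_iff_has_vector_derivative)
    have "norm (f' t) = m * t powr (- Re z - 2)"
      using t m by (simp add: f'_def norm_mult norm_powr_real_powr)
    also have "\<dots> \<le> t * t powr (- Re z - 2)" using t m by (intro mult_right_mono) auto
    also have "\<dots> = t powr (1 + (- Re z - 2))" using t m by (intro powr_mult_base) auto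
    also have "1 + (- Re z - 2) = - Re z - 1" by simp
    also have "t powr (- Re z - 1) = p' t" by (simp add: p'_def)
    finally show "norm (f' t) \<le> p' t" .
  qed auto
  also have "f (m + 1) - f m = of_nat (Suc n) * newman_kernel n z"
    unfolding newman_kernel_eq[OF assms(1)] f_def m_def
    by (simp add: diff_divide_distrib right_diff_distrib add_ac)
  also have "p (m + 1) - p m = (real (n + 1) powr (- Re z) - real (n + 2) powr (- Re z)) / Re z"
    unfolding p_def m_def by (simp add: diff_divide_distrib add_ac)
  finally show ?thesis by (simp add: norm_mult del: of_nat_Suc)
qed

text \<open>The constant value of psi(t) - floor(t) on n + 1 <= t < n + 2. Comparing with floor(t)
  instead of t keeps it a partial sum of the von Mangoldt function minus 1.\<close>

definition psi_err :: "nat \<Rightarrow> real" where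
  "psi_err n = chebyshev_psi (Suc n) - real (Suc n)"

lemma abs_psi_err_le: "\<bar>psi_err n\<bar> \<le> 5 * real (Suc n)"
proof -
  have "chebyshev_psi (Suc n) \<ge> 0"
    unfolding chebyshev_psi_def by (intro sum_nonneg mangoldt_nonneg)
  thus ?thesis using chebyshev_psi_le[of "Suc n"] by (simp add: psi_err_def)
qed

lemma psi_err_conv_sum: "psi_err n = (\<Sum>i\<le>n. mangoldt (Suc i) - 1)"
proof -
  have "chebyshev_psi (Suc n) = (\<Sum>i\<le>n. mangoldt (Suc i))"
    unfolding chebyshev_psi_def
    by (rule sum.reindex_bij_witness[where i = Suc and j = "\<lambda>k. k - 1"]) auto
  thus ?thesis by (simp add: psi_err_def sum_subtractf)
qed

text \<open>Abel summation, since \<open>newman_kernel\<close> is a difference of consecutive powers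
  over z + 1. The boundary term is O(N^(-Re z)).\<close>

lemma psi_err_series:
  assumes z: "Re z > 0"
  shows "(\<lambda>n. of_real (psi_err n) * newman_kernel n z) sums
           ((mangoldt_series (z + 1) - zeta_series (z + 1)) / (z + 1))"
proof -
  define b where "b = (\<lambda>n. of_nat (Suc n) powr (- (z + 1)) :: complex)"
  define c where "c = (\<lambda>n. mangoldt (Suc n) - 1 :: complex)"
  have err: "of_real (psi_err n) = (\<Sum>i\<le>n. c i)" for n
    by (simp add: psi_err_conv_sum c_def)
  have parts: "(\<Sum>n<N. of_real (psi_err n) * (b n - b (Suc n))) = (\<Sum>n<Suc N. c n * b n) - of_real (psi_err N) * b N" for N
  proof (induction N)
    case (Suc N)
    have "of_real (psi_err (Suc N)) = of_real (psi_err N) + c (Suc N)" by (simp add: err)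
    thus ?case using Suc by (simp add: algebra_simps)
  qed (simp add: err)
  have "(\<lambda>n. mangoldt (Suc n) * b n - b n) sums (mangoldt_series (z + 1) - zeta_series (z + 1))"
    unfolding b_def by (intro sums_diff mangoldt_series_sums zeta_series_sums) (use z in auto)
  hence "(\<lambda>N. \<Sum>n<Suc N. c n * b n) \<longlonglongrightarrow> mangoldt_series (z + 1) - zeta_series (z + 1)"
    unfolding sums_def by (intro LIMSEQ_Suc) (simp add: c_def left_diff_distrib)
  moreover have "(\<lambda>N. of_real (psi_err N) * b N) \<longlonglongrightarrow> 0"
  proof (rule Lim_null_comparison)
    show "\<forall>\<^sub>F N in sequentially. norm (of_real (psi_err N) * b N) \<le> 5 * real (Suc N) * real (Suc N) powr (- (Re z + 1))"
    proof (intro always_eventually allI)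
      fix N
      have "norm (b N) = real (Suc N) powr (- (Re z + 1))" unfolding b_def norm_nat_powr by simp
      thus "norm (of_real (psi_err N) * b N) \<le> 5 * real (Suc N) * real (Suc N) powr (- (Re z + 1))"
        unfolding norm_mult using abs_psi_err_le[of N] by (auto intro!: mult_right_mono simp del: of_nat_Suc)
    qed
    show "(\<lambda>N. 5 * real (Suc N) * real (Suc N) powr (- (Re z + 1))) \<longlonglongrightarrow> 0"
      using z by real_asymp
  qed
  ultimately have "(\<lambda>N. \<Sum>n<N. of_real (psi_err n) * (b n - b (Suc n))) \<longlonglongrightarrow> (mangoldt_series (z + 1) - zeta_series (z + 1)) - 0"
    unfolding parts by (intro tendsto_diff)
  hence "(\<lambda>n. of_real (psi_err n) * (b n - b (Suc n))) sums (mangoldt_series (z + 1) - zeta_series (z + 1))"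
    by (simp add: sums_def)
  hence "(\<lambda>n. of_real (psi_err n) * (b n - b (Suc n)) / (z + 1)) sums ((mangoldt_series (z + 1) - zeta_series (z + 1)) / (z + 1))"
    by (rule sums_divide)
  moreover have "of_real (psi_err n) * (b n - b (Suc n)) / (z + 1) = of_real (psi_err n) * newman_kernel n z" for n
  proof -
    have "z \<noteq> -1" using z by auto
    thus ?thesis by (simp add: newman_kernel_eq b_def del: of_nat_Suc)
  qed
  ultimately show ?thesis by simp
qed

text \<open>Convergence of the integral of (psi(t) - floor(t)) / t^2 from 1 to infinity, written
  over unit intervals. Newman's theorem applies because -zeta'/zeta - zeta extends analytically
  across Re s = 1.\<close>

lemma psi_err_sum_converges: "convergent (\<lambda>N. \<Sum>n<N. psi_err n / (real (Suc n) * real (Suc (Suc n))))"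
proof -
  define q where "q = (\<lambda>s. if s = 1 then deriv reg_zeta 1 else (reg_zeta s - reg_zeta 1) / (s - 1))"
  \<comment> \<open>At s = z + 1 both -zeta'/zeta and zeta have the principal part 1 / (s - 1).
    Their difference is written through the regular functions \<open>q\<close> and
    reg_zeta'/reg_zeta, so the cancellation is built in.\<close>
  define G where "G = (\<lambda>z. (- q (z + 1) - deriv reg_zeta (z + 1) / reg_zeta (z + 1)) / (z + 1))"
  define S where "S = {s. Re s > 0} \<inter> reg_zeta -` (- {0})"
  have op: "open {s. Re s > 0}" by (rule open_halfspace_Re_gt)
  have S: "open S" unfolding S_def
    by (rule continuous_open_preimage[OF holomorphic_on_imp_continuous_on[OF holomorphic_reg_zeta] op]) auto
  have q: "q holomorphic_on {s. Re s > 0}"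
    unfolding q_def by (rule pole_lemma_open[OF holomorphic_reg_zeta op])
  define T where "T = (\<lambda>z. z + 1) -` S"
  have T: "open T" unfolding T_def by (intro open_vimage S continuous_intros)
  have T_pos: "Re (z + 1) > 0" "reg_zeta (z + 1) \<noteq> 0" if "z \<in> T" for z
    using that by (auto simp: T_def S_def)
  have comp: "(\<lambda>z. f (z + 1)) holomorphic_on T" if "f holomorphic_on {s. Re s > 0}" for f
    by (rule holomorphic_on_compose_gen[OF _ that, of "\<lambda>z. z + 1" T, unfolded o_def])
       (use T_pos in \<open>auto intro!: holomorphic_intros\<close>)
  have "z + 1 \<noteq> 0" if "z \<in> T" for z
    using T_pos(1)[OF that] by (metis less_irrefl zero_complex.sel(1))
  hence G: "G holomorphic_on T" unfolding G_def
    by (intro holomorphic_intros comp q holomorphic_reg_zeta holomorphic_deriv op) (use T_pos in auto)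
  have sub: "{z. Re z \<ge> 0} \<subseteq> T"
    using reg_zeta_nonzero by (auto simp: T_def S_def)
  have G_eq: "G z = (mangoldt_series (z + 1) - zeta_series (z + 1)) / (z + 1)" if z: "Re z > 0" for z
  proof -
    define s where "s = z + 1"
    have s: "Re s > 1" "s \<noteq> 1" using z by (auto simp: s_def)
    have nz: "reg_zeta s \<noteq> 0" using reg_zeta_nonzero s by simp
    have "mangoldt_series s = 1 / (s - 1) - deriv reg_zeta s / reg_zeta s"
    proof -
      have "mangoldt_series s = mangoldt_series s * reg_zeta s / reg_zeta s" using nz by simp
      also have "\<dots> = reg_zeta s / (s - 1) / reg_zeta s - deriv reg_zeta s / reg_zeta s"
        unfolding deriv_reg_zeta[OF s(1)] by (simp add: diff_divide_distrib)
      finally show ?thesis using nz by simp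
    qed
    moreover have "zeta_series s = reg_zeta s / (s - 1)" using reg_zeta_eq[OF s(1)] s by simp
    moreover have "q s = reg_zeta s / (s - 1) - 1 / (s - 1)"
      using s by (simp add: q_def reg_zeta_1 diff_divide_distrib)
    ultimately show ?thesis unfolding G_def s_def[symmetric] by (simp add: diff_divide_distrib)
  qed
  \<comment> \<open>Newman's theorem is stated for F(0) = 0. The value G(0) is removed through the
    term n = 0 alone; the factor 2 is there because \<open>newman_kernel 0 0\<close> is 1/2.\<close>
  define a where "a = (\<lambda>n z. (of_real (psi_err n) - (if n = 0 then 2 * G 0 else 0)) * newman_kernel n z)"
  define F where "F = (\<lambda>z. G z - 2 * G 0 * newman_kernel 0 z)"
  define C where "C = 5 + 2 * norm (G 0)"
  have "(\<lambda>N. \<Sum>n<N. a n 0) \<longlonglongrightarrow> 0"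
  proof (rule newman_tauberian[where F = F and S = T and C = C])
    show "a n holomorphic_on UNIV" for n
      unfolding a_def by (intro holomorphic_intros newman_kernel_holomorphic)
    show "F holomorphic_on T" unfolding F_def
      by (intro holomorphic_intros G holomorphic_on_subset[OF newman_kernel_holomorphic]) auto
    show "C > 0" by (auto simp: C_def intro: add_pos_nonneg)
    show "F 0 = 0" by (simp add: F_def newman_kernel_0)
    show "(\<lambda>n. a n z) sums F z" if "Re z > 0" for z
    proof -
      have "(\<lambda>n. of_real (psi_err n) * newman_kernel n z - (if n = 0 then 2 * G 0 * newman_kernel n z else 0)) sums
             (G z - 2 * G 0 * newman_kernel 0 z)"
        unfolding G_eq[OF that] by (intro sums_diff psi_err_series that) (rule sums_single)
      moreover have "a n z = of_real (psi_err n) * newman_kernel n z - (if n = 0 then 2 * G 0 * newman_kernel n z else 0)" for n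
        by (simp add: a_def left_diff_distrib)
      ultimately show ?thesis by (simp add: F_def)
    qed
    show "norm (a n z) \<le> C * ((real (n + 1) powr (- Re z) - real (n + 2) powr (- Re z)) / Re z)"
      if "norm z > 1" "Re z \<noteq> 0" for n z
    proof -
      have "norm (of_real (psi_err n) - (if n = 0 then 2 * G 0 else 0)) \<le> \<bar>psi_err n\<bar> + norm (if n = 0 then 2 * G 0 else 0)"
        using norm_triangle_ineq4[of "of_real (psi_err n)" "if n = 0 then 2 * G 0 else 0"] by simp
      also have "\<dots> \<le> 5 * real (Suc n) + 2 * norm (G 0) * real (Suc n)"
        using abs_psi_err_le[of n] by (intro add_mono) (auto simp: norm_mult)
      also have "\<dots> = C * real (Suc n)" by (simp add: C_def algebra_simps)
      finally have "norm (a n z) \<le> C * real (Suc n) * norm (newman_kernel n z)"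
        unfolding a_def norm_mult by (rule mult_right_mono) auto
      also have "\<dots> = C * (real (Suc n) * norm (newman_kernel n z))" by simp
      also have "\<dots> \<le> C * ((real (n + 1) powr (- Re z) - real (n + 2) powr (- Re z)) / Re z)"
        using that by (intro mult_left_mono norm_newman_kernel_le) (auto simp: C_def)
      finally show ?thesis .
    qed
  qed (use T sub in auto)
  hence "(\<lambda>N. (\<Sum>n<N. a n 0) + G 0) \<longlonglongrightarrow> 0 + G 0" by (intro tendsto_intros)
  moreover have "\<forall>\<^sub>F N in sequentially. (\<Sum>n<N. a n 0) + G 0 = of_real (\<Sum>n<N. psi_err n / (real (Suc n) * real (Suc (Suc n))))"
    using eventually_gt_at_top[of 0]
  proof eventually_elim
    case (elim N)
    have "(\<Sum>n<N. a n 0) = (\<Sum>n<N. of_real (psi_err n / (real (Suc n) * real (Suc (Suc n)))) - (if n = 0 then G 0 else 0))"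
      by (rule sum.cong) (auto simp: a_def newman_kernel_0 left_diff_distrib)
    also have "\<dots> = of_real (\<Sum>n<N. psi_err n / (real (Suc n) * real (Suc (Suc n)))) - G 0"
      using elim by (simp add: sum_subtractf)
    finally show ?case by simp
  qed
  ultimately have "(\<lambda>N. of_real (\<Sum>n<N. psi_err n / (real (Suc n) * real (Suc (Suc n))))) \<longlonglongrightarrow> 0 + G 0"
    by (rule Lim_transform_eventually)
  hence "(\<lambda>N. \<Sum>n<N. psi_err n / (real (Suc n) * real (Suc (Suc n)))) \<longlonglongrightarrow> Re (0 + G 0)"
    using tendsto_Re by fastforce
  thus ?thesis by (auto simp: convergent_def)
qed

section \<open>From convergence of the integral to the prime number theorem\<close>

lemma chebyshev_psi_mono: "m \<le> n \<Longrightarrow> chebyshev_psi m \<le> chebyshev_psi n"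
  unfolding chebyshev_psi_def by (rule sum_mono2) (auto simp: mangoldt_nonneg)

text \<open>At least e N / 2 terms, each at least (e N / 2) / (2 N * 3 N), add up to e^2 / 24. The
  sign \<open>s\<close> lets one statement serve an excess and a deficit of psi.\<close>

lemma chebyshev_psi_block_bound:
  assumes e: "0 < e" "e \<le> 1" and ab: "a < b" "real b \<le> 2 * real N" "N > 0"
    and card: "real (b - a) \<ge> e * real N / 2"
    and t: "\<And>n. n \<in> {a..<b} \<Longrightarrow> s * psi_err n \<ge> e * real N / 2" and s: "\<bar>s\<bar> = 1"
  shows "\<bar>\<Sum>n\<in>{a..<b}. psi_err n / (real (Suc n) * real (Suc (Suc n)))\<bar> \<ge> e\<^sup>2 / 24"
proof -
  have term_ge: "e / (12 * real N) \<le> s * (psi_err n / (real (Suc n) * real (Suc (Suc n))))" if n: "n \<in> {a..<b}" for n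
  proof -
    have "real (Suc n) \<le> 2 * real N" using n ab by auto
    moreover have "real (Suc (Suc n)) \<le> 3 * real N"
    proof -
      have "real n + 1 \<le> real b" "real N \<ge> 1" using n ab by auto
      from this ab(2) show ?thesis unfolding of_nat_Suc by linarith
    qed
    ultimately have "real (Suc n) * real (Suc (Suc n)) \<le> (2 * real N) * (3 * real N)"
      by (intro mult_mono) auto
    hence "(e * real N / 2) / ((2 * real N) * (3 * real N)) \<le> (e * real N / 2) / (real (Suc n) * real (Suc (Suc n)))"
      using e ab by (intro divide_left_mono) auto
    also have "\<dots> \<le> s * psi_err n / (real (Suc n) * real (Suc (Suc n)))"
      using t[OF n] by (intro divide_right_mono) auto
    also have "(e * real N / 2) / ((2 * real N) * (3 * real N)) = e / (12 * real N)"
      using ab by (simp add: field_simps)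
    finally show ?thesis by simp
  qed
  have "e\<^sup>2 / 24 = (e * real N / 2) * (e / (12 * real N))"
    using ab by (simp add: field_simps power2_eq_square)
  also have "\<dots> \<le> real (b - a) * (e / (12 * real N))"
    using e card by (intro mult_right_mono) auto
  also have "\<dots> = (\<Sum>n\<in>{a..<b}. e / (12 * real N))" by simp
  also have "\<dots> \<le> (\<Sum>n\<in>{a..<b}. s * (psi_err n / (real (Suc n) * real (Suc (Suc n)))))"
    by (intro sum_mono term_ge)
  also have "\<dots> = s * (\<Sum>n\<in>{a..<b}. psi_err n / (real (Suc n) * real (Suc (Suc n))))"
    by (simp only: sum_distrib_left)
  also have "\<dots> \<le> \<bar>s * (\<Sum>n\<in>{a..<b}. psi_err n / (real (Suc n) * real (Suc (Suc n))))\<bar>" by (rule abs_ge_self)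
  finally show ?thesis by (simp add: abs_mult s)
qed

text \<open>By monotonicity of psi, an excess psi(N) >= (1 + e) N persists at half its size up to N
  + e N / 2, and a deficit persists down to N - e N / 2. Either one gives a block sum of fixed size
  arbitrarily far out, contradicting the Cauchy criterion.\<close>

lemma chebyshev_psi_asymptotic: "(\<lambda>n. chebyshev_psi n / real n) \<longlonglongrightarrow> 1"
proof -
  define f where "f = (\<lambda>n. psi_err n / (real (Suc n) * real (Suc (Suc n))))"
  have ev: "\<forall>\<^sub>F N in sequentially. \<bar>chebyshev_psi N - real N\<bar> < e * real N" if e: "0 < e" "e \<le> 1" for e :: real
  proof -
    have "Cauchy (\<lambda>N. \<Sum>n<N. f n)"
      using psi_err_sum_converges unfolding f_def by (rule convergent_Cauchy)
    moreover have "e\<^sup>2 / 24 > 0" using e by simp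
    ultimately obtain M where M: "\<And>m n. m \<ge> M \<Longrightarrow> n \<ge> M \<Longrightarrow> norm ((\<Sum>i<m. f i) - (\<Sum>i<n. f i)) < e\<^sup>2 / 24"
      unfolding Cauchy_iff by blast
    have block: "\<bar>\<Sum>n\<in>{a..<b}. f n\<bar> < e\<^sup>2 / 24" if "M \<le> a" "a < b" for a b
    proof -
      have "(\<Sum>i<b. f i) - (\<Sum>i<a. f i) = (\<Sum>n\<in>{a..<b}. f n)"
        using that by (simp add: sum_diff_nat_ivl lessThan_atLeast0)
      thus ?thesis using M[of b a] that by simp
    qed
    \<comment> \<open>Since the block length parameter is at most N / 2, N > 2 M + 2 puts both kinds
      of block beyond M.\<close>
    have "\<forall>\<^sub>F N in sequentially. N > 2 * M + 2 \<and> real N > 4 / e"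
      by (intro eventually_conj eventually_gt_at_top) real_asymp
    thus ?thesis
    proof eventually_elim
      case (elim N)
      define L where "L = nat \<lfloor>e * real N / 2\<rfloor>"
      have L: "real L \<le> e * real N / 2" "e * real N / 2 < real L + 1"
        unfolding L_def using e by (intro of_nat_floor, simp) linarith
      have eN: "e * real N / 2 \<le> real N / 2" using e by (simp add: mult_left_le_one_le)
      have N: "N > 0" "real N > 2 * real M + 2" using elim by auto
      have LN: "L < N" using L eN N by linarith
      show ?case
      proof (rule ccontr)
        assume "\<not> ?thesis"
        then consider "chebyshev_psi N \<ge> (1 + e) * real N" | "chebyshev_psi N \<le> (1 - e) * real N"
          by (auto simp: algebra_simps abs_if split: if_splits)
        thus False
        proof cases
          case 1
          \<comment> \<open>Index n stands for the argument n + 1, so the block from N - 1 starts at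
            psi(N) and has L + 1 > e N / 2 members.\<close>
          have "e\<^sup>2 / 24 \<le> \<bar>\<Sum>n\<in>{N - 1..<N + L}. psi_err n / (real (Suc n) * real (Suc (Suc n)))\<bar>"
          proof (rule chebyshev_psi_block_bound[where s = 1 and N = N])
            show "e * real N / 2 \<le> 1 * psi_err n" if "n \<in> {N - 1..<N + L}" for n
            proof -
              have "chebyshev_psi N \<le> chebyshev_psi (Suc n)" using that by (intro chebyshev_psi_mono) auto
              moreover have "real (Suc n) \<le> real N + real L" using that by auto
              ultimately show ?thesis using 1 L by (simp add: psi_err_def algebra_simps)
            qed
            show "real (N + L) \<le> 2 * real N" using LN by simp
            show "e * real N / 2 \<le> real (N + L - (N - 1))" using L N by (simp add: of_nat_diff)
          qed (use e N in auto)
          moreover have "\<bar>\<Sum>n\<in>{N - 1..<N + L}. f n\<bar> < e\<^sup>2 / 24" using N elim by (intro block) auto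
          ultimately show False by (simp add: f_def)
        next
          case 2
          have "e\<^sup>2 / 24 \<le> \<bar>\<Sum>n\<in>{N - L - 1..<N}. psi_err n / (real (Suc n) * real (Suc (Suc n)))\<bar>"
          proof (rule chebyshev_psi_block_bound[where s = "-1" and N = N])
            show "e * real N / 2 \<le> - 1 * psi_err n" if "n \<in> {N - L - 1..<N}" for n
            proof -
              have "chebyshev_psi (Suc n) \<le> chebyshev_psi N" using that by (intro chebyshev_psi_mono) auto
              moreover have "real (Suc n) \<ge> real N - real L" using that LN by auto
              ultimately show ?thesis using 2 L by (simp add: psi_err_def algebra_simps)
            qed
            show "e * real N / 2 \<le> real (N - (N - L - 1))" using L LN by (simp add: of_nat_diff)
          qed (use e N in auto)
          moreover have "\<bar>\<Sum>n\<in>{N - L - 1..<N}. f n\<bar> < e\<^sup>2 / 24"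
            using N elim L eN by (intro block) linarith+
          ultimately show False by (simp add: f_def)
        qed
      qed
    qed
  qed
  show ?thesis
  proof (rule tendstoI)
    fix e :: real assume "e > 0"
    define e' where "e' = min e 1"
    have e': "0 < e'" "e' \<le> 1" "e' \<le> e" using \<open>e > 0\<close> by (auto simp: e'_def)
    show "\<forall>\<^sub>F n in sequentially. dist (chebyshev_psi n / real n) 1 < e"
      using ev[OF e'(1,2)] eventually_gt_at_top[of 0]
    proof eventually_elim
      case (elim n)
      have "chebyshev_psi n / real n - 1 = (chebyshev_psi n - real n) / real n"
        using elim by (simp add: field_simps)
      hence "\<bar>chebyshev_psi n / real n - 1\<bar> = \<bar>chebyshev_psi n - real n\<bar> / real n"
        by (simp only: abs_divide abs_of_nat)
      also have "\<dots> < e'" using elim by (simp add: field_simps)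
      finally show ?case using e' by (simp add: dist_real_def)
    qed
  qed
qed

text \<open>The quotient lies between psi(n) / n and n^(-d) ln n + psi(n) / ((1 - d) n), by the two
  comparisons of psi with the number of primes; d is chosen small in terms of e.\<close>

lemma prime_number_theorem_nat:
  "(\<lambda>n. real (card (primes_upto n)) * ln (real n) / real n) \<longlonglongrightarrow> 1"
proof (rule tendstoI)
  fix e :: real assume e: "e > 0"
  obtain d :: real where d: "0 < d" "d < 1" "1 / (1 - d) < 1 + e"
  proof -
    \<comment> \<open>With d = e / (2 + 2 e), 1 / (1 - d) = 1 + e / (2 + e).\<close>
    have "0 < e / (2 + 2 * e)" "e / (2 + 2 * e) < 1" "1 / (1 - e / (2 + 2 * e)) < 1 + e"
      using e by (auto simp: field_simps add_pos_pos)
    thus ?thesis by (rule that)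
  qed
  have "(\<lambda>n. real n powr (- d) * ln (real n) + (chebyshev_psi n / real n) / (1 - d)) \<longlonglongrightarrow> 0 + 1 / (1 - d)"
    using d(1,2) by (intro tendsto_add tendsto_divide chebyshev_psi_asymptotic tendsto_const) (real_asymp, simp)
  hence up: "\<forall>\<^sub>F n in sequentially. real n powr (- d) * ln (real n) + (chebyshev_psi n / real n) / (1 - d) < 1 + e"
    using d(3) by (intro order_tendstoD) auto
  have lo: "\<forall>\<^sub>F n in sequentially. chebyshev_psi n / real n > 1 - e"
    using e chebyshev_psi_asymptotic by (intro order_tendstoD) auto
  show "\<forall>\<^sub>F n in sequentially. dist (real (card (primes_upto n)) * ln (real n) / real n) 1 < e"
    using up lo eventually_gt_at_top[of 1]
  proof eventually_elim
    case (elim n)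
    define p where "p = real (card (primes_upto n))"
    define l where "l = ln (real n)"
    have l: "l > 0" using elim by (simp add: l_def)
    have lower: "chebyshev_psi n / real n \<le> p * l / real n"
      using chebyshev_psi_le_primes[of n] by (auto simp: p_def l_def intro!: divide_right_mono)
    have "p \<le> real n powr (1 - d) + chebyshev_psi n / ((1 - d) * l)"
    proof -
      have "chebyshev_theta n / ((1 - d) * l) \<le> chebyshev_psi n / ((1 - d) * l)"
        using d l by (intro divide_right_mono chebyshev_theta_le_psi) auto
      thus ?thesis using card_primes_upto_le[of n d] d elim by (simp add: p_def l_def)
    qed
    hence "p * l / real n \<le> (real n powr (1 - d) + chebyshev_psi n / ((1 - d) * l)) * l / real n"
      using l elim by (intro divide_right_mono mult_right_mono) auto
    also have "\<dots> = real n powr (- d) * l + (chebyshev_psi n / real n) / (1 - d)"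
    proof -
      have "real n powr (1 - d) = real n * real n powr (- d)"
        using elim by (simp add: powr_diff powr_minus field_simps)
      thus ?thesis using l elim d by (simp add: field_simps)
    qed
    finally have "\<bar>p * l / real n - 1\<bar> < e" using lower elim unfolding l_def[symmetric] by linarith
    thus ?case by (simp add: dist_real_def p_def l_def)
  qed
qed

theorem prime_number_theorem:
  "(\<lambda>x::real. real (card {p::nat. prime p \<and> real p \<le> x})) \<sim>[at_top] (\<lambda>x. x / ln x)"
proof -
  have fl: "filterlim (\<lambda>x::real. nat \<lfloor>x\<rfloor>) sequentially at_top"
    by (intro filterlim_compose[OF filterlim_nat_sequentially filterlim_floor_sequentially])
  have "((\<lambda>x::real. real (card (primes_upto (nat \<lfloor>x\<rfloor>))) * ln (real (nat \<lfloor>x\<rfloor>)) / real (nat \<lfloor>x\<rfloor>)) \<longlongrightarrow> 1) at_top"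
    by (rule filterlim_compose[OF prime_number_theorem_nat fl])
  moreover have "((\<lambda>x::real. (real_of_int \<lfloor>x\<rfloor> / ln (real_of_int \<lfloor>x\<rfloor>)) / (x / ln x)) \<longlongrightarrow> 1) at_top"
    by real_asymp
  ultimately have "((\<lambda>x::real. (real (card (primes_upto (nat \<lfloor>x\<rfloor>))) * ln (real (nat \<lfloor>x\<rfloor>)) / real (nat \<lfloor>x\<rfloor>)) *
      ((real_of_int \<lfloor>x\<rfloor> / ln (real_of_int \<lfloor>x\<rfloor>)) / (x / ln x))) \<longlongrightarrow> 1 * 1) at_top"
    by (rule tendsto_mult)
  moreover have "\<forall>\<^sub>F x::real in at_top. (real (card (primes_upto (nat \<lfloor>x\<rfloor>))) * ln (real (nat \<lfloor>x\<rfloor>)) / real (nat \<lfloor>x\<rfloor>)) *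
      ((real_of_int \<lfloor>x\<rfloor> / ln (real_of_int \<lfloor>x\<rfloor>)) / (x / ln x)) = real (card {p::nat. prime p \<and> real p \<le> x}) / (x / ln x)"
    using eventually_ge_at_top[of 3]
  proof eventually_elim
    case (elim x)
    have eq: "real (nat \<lfloor>x\<rfloor>) = real_of_int \<lfloor>x\<rfloor>" using elim by simp
    have "{p::nat. prime p \<and> real p \<le> x} = primes_upto (nat \<lfloor>x\<rfloor>)"
      using elim by (auto simp: primes_upto_def le_nat_iff le_floor_iff)
    moreover define y where "y = real_of_int \<lfloor>x\<rfloor>"
    have "y > 1" unfolding y_def using elim by linarith
    ultimately show ?case unfolding eq y_def[symmetric] by simp
  qed
  ultimately have "((\<lambda>x::real. real (card {p::nat. prime p \<and> real p \<le> x}) / (x / ln x)) \<longlongrightarrow> 1 * 1) at_top"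
    by (rule Lim_transform_eventually)
  thus ?thesis
    by (intro asymp_equivI') simp
qed

section \<open>The sum-of-divisors function\<close>

lemma divisor_sum_mult:
  assumes "coprime a b" "a > 0" "b > 0"
  shows "divisor_sum (a * b) = divisor_sum a * divisor_sum b"
proof -
  have inj: "inj_on (\<lambda>(d, e). d * e) ({d. d dvd a} \<times> {e. e dvd b})"
  proof (rule inj_onI, clarify)
    fix d e d' e' assume *: "d dvd a" "e dvd b" "d' dvd a" "e' dvd b" "d * e = d' * e'"
    have cop: "coprime u w" if "u dvd a" "w dvd b" for u w
      using assms(1) that coprime_divisors by blast
    have "d dvd d' * e'" "d' dvd d * e" using *(5) by (metis dvd_triv_left)+
    hence "d dvd d'" "d' dvd d"
      using cop[OF *(1,4)] cop[OF *(3,2)] by (simp_all add: coprime_dvd_mult_left_iff)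
    hence "d = d'" by (rule dvd_antisym)
    moreover have "d > 0" using *(1) assms(2) dvd_pos_nat by blast
    ultimately show "d = d' \<and> e = e'" using *(5) by simp
  qed
  have "{d. d dvd a * b} = (\<lambda>(d, e). d * e) ` ({d. d dvd a} \<times> {e. e dvd b})"
  proof (intro equalityI subsetI)
    fix d assume "d \<in> {d. d dvd a * b}"
    then obtain u w where "d = u * w" "u dvd a" "w dvd b" using division_decomp by blast
    thus "d \<in> (\<lambda>(d, e). d * e) ` ({d. d dvd a} \<times> {e. e dvd b})" by auto
  qed (auto intro: mult_dvd_mono)
  hence "divisor_sum (a * b) = (\<Sum>(d, e)\<in>{d. d dvd a} \<times> {e. e dvd b}. d * e)"
    unfolding divisor_sum_def using sum.reindex[OF inj, of "\<lambda>d. d"]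
    by (simp add: o_def case_prod_unfold)
  thus ?thesis
    unfolding divisor_sum_def sum_product by (simp add: sum.cartesian_product)
qed

lemma divisor_sum_ge: "n > 0 \<Longrightarrow> n \<le> divisor_sum n"
  unfolding divisor_sum_def by (rule member_le_sum) auto

lemma divisor_sum_gt: "n > 1 \<Longrightarrow> n < divisor_sum n"
proof -
  assume n: "n > 1"
  have "(\<Sum>d\<in>{1, n}. d) \<le> divisor_sum n"
    unfolding divisor_sum_def using n by (intro sum_mono2) auto
  thus ?thesis using n by simp
qed

lemma divisor_sum_prime: "prime p \<Longrightarrow> divisor_sum p = p + 1"
proof -
  assume p: "prime p"
  hence "{d. d dvd p} = {1, p}" by (auto simp: prime_nat_iff)
  thus ?thesis using p prime_gt_1_nat[OF p] by (simp add: divisor_sum_def)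
qed

lemma divisor_sum_le_square:
  assumes "n > 0"
  shows "divisor_sum n \<le> n\<^sup>2"
proof -
  have sub: "{d. d dvd n} \<subseteq> {1..n}" using assms by (auto dest: dvd_imp_le simp: Suc_le_eq dvd_pos_nat)
  have "divisor_sum n \<le> (\<Sum>d | d dvd n. n)"
    unfolding divisor_sum_def using assms by (intro sum_mono) (auto dest: dvd_imp_le)
  also have "\<dots> \<le> card {1..n} * n" using card_mono[OF _ sub] by simp
  finally show ?thesis by (simp add: power2_eq_square)
qed

lemma sum_inverse_le_ln: "(\<Sum>k\<in>{1..n}. 1 / real k) \<le> 1 + ln (real n)" if "n > 0"
  using that
proof (induction n rule: nat_induct_non_zero)
  case (Suc n)
  have "ln (real n / real (Suc n)) \<le> real n / real (Suc n) - 1"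
    using Suc by (intro ln_le_minus_one) auto
  also have "\<dots> = - (1 / real (Suc n))" by (simp add: field_simps)
  finally have "1 / real (Suc n) \<le> ln (real (Suc n)) - ln (real n)"
    using Suc by (simp add: ln_div)
  thus ?case using Suc by simp
qed auto

lemma divisor_sum_le_ln:
  assumes n: "n > 0"
  shows "real (divisor_sum n) \<le> real n * (1 + ln (real n))"
proof -
  have bij: "(\<Sum>d | d dvd n. real d) = (\<Sum>d | d dvd n. real n / real d)"
    by (rule sum.reindex_bij_witness[where i = "\<lambda>d. n div d" and j = "\<lambda>d. n div d"])
       (use n in \<open>auto simp: real_of_nat_div\<close>)
  have sub: "{d. d dvd n} \<subseteq> {1..n}" using n by (auto dest: dvd_imp_le simp: Suc_le_eq dvd_pos_nat)
  have "real (divisor_sum n) = (\<Sum>d | d dvd n. real n / real d)"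
    unfolding divisor_sum_def using bij by simp
  also have "\<dots> \<le> (\<Sum>d\<in>{1..n}. real n / real d)"
    using sub by (intro sum_mono2) auto
  also have "\<dots> = real n * (\<Sum>d\<in>{1..n}. 1 / real d)" by (simp add: sum_distrib_left)
  also have "\<dots> \<le> real n * (1 + ln (real n))" using n by (intro mult_left_mono sum_inverse_le_ln) auto
  finally show ?thesis .
qed

lemma divisor_sum_prime_power_le:
  assumes p: "prime p"
  shows "(1 - 1 / real p) * real (divisor_sum (p ^ e)) \<le> real (p ^ e)"
proof -
  have p1: "p > 1" using prime_gt_1_nat[OF p] .
  have "{d. d dvd p ^ e} = (\<lambda>i. p ^ i) ` {..e}"
    using divides_primepow_nat[OF p] by auto
  moreover have "inj_on (\<lambda>i. p ^ i) {..e}" using p1 by (auto intro!: inj_onI)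
  ultimately have "divisor_sum (p ^ e) = (\<Sum>i\<le>e. p ^ i)"
    unfolding divisor_sum_def by (simp add: sum.reindex)
  hence "(real p - 1) * real (divisor_sum (p ^ e)) = (real p - 1) * (\<Sum>i\<le>e. real p ^ i)" by simp
  also have "\<dots> = real p ^ Suc e - 1"
    using power_diff_1_eq[of "real p" "Suc e"] by (simp add: lessThan_Suc_atMost)
  finally have "(real p - 1) * real (divisor_sum (p ^ e)) \<le> real p * real (p ^ e)" by simp
  thus ?thesis using p1 by (simp add: field_simps)
qed

lemma prime_power_cofactor:
  assumes "n > 1" "prime p" "p dvd n"
  obtains e m where "n = p ^ e * m" "e > 0" "\<not> p dvd m" "m > 0" "m < (n::nat)" "coprime (p ^ e) m"
proof -
  have "\<not> is_unit p" using assms by auto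
  then obtain m where m: "n = p ^ multiplicity p n * m" "\<not> p dvd m"
    using multiplicity_decompose'[of n p] assms by auto
  have e: "multiplicity p n > 0" using assms by (simp add: prime_multiplicity_gt_zero_iff)
  have "m > 0" using m assms by (intro Nat.gr0I) auto
  moreover have "p ^ multiplicity p n > 1" using assms e by (intro one_less_power prime_gt_1_nat) auto
  ultimately have "m < p ^ multiplicity p n * m" by (intro n_less_m_mult_n) auto
  hence "m < n" using m(1) by linarith
  have "coprime (p ^ multiplicity p n) m"
    using m(2) assms(2) by (simp add: prime_imp_coprime)
  thus ?thesis using \<open>m > 0\<close> \<open>m < n\<close> by (intro that[OF m(1) e m(2)])
qed

text \<open>n / sigma(n) is at least the product of 1 - 1/p over p | n, which is at least 1 minus
  the sum of 1/p. With denominators cleared, the induction remains valid when that difference is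
  negative.\<close>

lemma divisor_sum_abundancy:
  assumes "n > 0"
  shows "(1 - (\<Sum>p\<in>prime_factors n. 1 / real p)) * real (divisor_sum n) \<le> real n"
  using assms
proof (induction n rule: less_induct)
  case (less n)
  show ?case
  proof (cases "n = 1")
    case True
    thus ?thesis by (simp add: divisor_sum_def)
  next
    case False
    hence "n > 1" using less by simp
    then obtain p where p: "prime p" "p dvd n" using prime_factor_nat[of n] by auto
    obtain e m where em: "n = p ^ e * m" "e > 0" "\<not> p dvd m" "m > 0" "m < n" "coprime (p ^ e) m"
      using prime_power_cofactor[OF \<open>n > 1\<close> p] by blast
    define S where "S = (\<Sum>q\<in>prime_factors m. 1 / real q)"
    have p1: "p > 1" using prime_gt_1_nat[OF p(1)] .
    have "prime_factors n = insert p (prime_factors m)"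
      using em p p1 primes_dvd_imp_eq[of _ p]
      by (auto simp: in_prime_factors_iff prime_dvd_mult_iff prime_dvd_power_iff)
    moreover have "p \<notin> prime_factors m" using em by auto
    ultimately have sumS: "(\<Sum>q\<in>prime_factors n. 1 / real q) = 1 / real p + S" by (simp add: S_def)
    have S0: "S \<ge> 0" by (auto simp: S_def intro: sum_nonneg)
    have "1 - (1 / real p + S) \<le> (1 - S) * (1 - 1 / real p)"
      using S0 p1 by (simp add: algebra_simps divide_right_mono)
    hence "(1 - (1 / real p + S)) * real (divisor_sum n) \<le> (1 - S) * (1 - 1 / real p) * real (divisor_sum n)"
      by (rule mult_right_mono) auto
    also have "\<dots> = ((1 - S) * real (divisor_sum m)) * ((1 - 1 / real p) * real (divisor_sum (p ^ e)))"
      using em p1 by (simp add: divisor_sum_mult)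
    also have "\<dots> \<le> real m * ((1 - 1 / real p) * real (divisor_sum (p ^ e)))"
      using less.IH[OF em(5,4)] p1 by (intro mult_right_mono) (auto simp: S_def)
    also have "\<dots> \<le> real m * real (p ^ e)"
      by (intro mult_left_mono divisor_sum_prime_power_le p) auto
    also have "\<dots> = real n" using em by simp
    finally show ?thesis unfolding sumS .
  qed
qed

text \<open>The primes of B are so few and so large that the sum of 1/p is below 1/2. Then B <
  sigma(B) < 2 B, and no multiple of B lies in between.\<close>

lemma not_dvd_divisor_sum:
  assumes B: "B > 1" and y: "y > 0" "\<And>p. p \<in> prime_factors B \<Longrightarrow> real p > y"
    and card: "2 * real (card (prime_factors B)) \<le> y"
  shows "\<not> B dvd divisor_sum B"
proof
  assume dvd: "B dvd divisor_sum B"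
  obtain q where "prime q" "q dvd B" using prime_factor_nat[of B] B by auto
  hence "q \<in> prime_factors B" using B by (simp add: in_prime_factors_iff)
  hence "prime_factors B \<noteq> {}" by blast
  hence "(\<Sum>p\<in>prime_factors B. 1 / real p) < (\<Sum>p\<in>prime_factors B. 1 / y)"
    using y by (intro sum_strict_mono) (auto intro!: divide_strict_left_mono mult_pos_pos simp: in_prime_factors_iff dest: prime_gt_0_nat)
  also have "\<dots> = real (card (prime_factors B)) / y" by simp
  also have "\<dots> \<le> 1 / 2" using card y by (simp add: field_simps)
  finally have "1 / 2 * real (divisor_sum B) < (1 - (\<Sum>p\<in>prime_factors B. 1 / real p)) * real (divisor_sum B)"
    using divisor_sum_gt[OF B] by (intro mult_strict_right_mono) auto
  also have "\<dots> \<le> real B" using B by (intro divisor_sum_abundancy) auto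
  finally have "divisor_sum B < 2 * B" by linarith
  moreover obtain k where k: "divisor_sum B = B * k" using dvd by (elim dvdE)
  ultimately have "k < 2" using B by simp
  hence "divisor_sum B \<le> B" using k by (cases k) auto
  thus False using divisor_sum_gt[OF B] by simp
qed

section \<open>Counting integers with a prescribed abundancy denominator\<close>

text \<open>When D is supported on Q, these are the members of T whose part composed of primes in Q
  is exactly D.\<close>

definition coprime_part_set :: "nat set \<Rightarrow> nat set \<Rightarrow> nat \<Rightarrow> nat set" where
  "coprime_part_set T Q D = {n \<in> T. \<exists>m. n = D * m \<and> (\<forall>p\<in>Q. \<not> p dvd m)}"

text \<open>The length of a unary code for the exponents at the primes of P, in which a recorded
  exponent e takes e + 1 bits. Testing p | v sigma(n), which every recorded prime satisfies, makes
  the length independent of the order of recording.\<close>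

definition kraft_exponent :: "nat \<Rightarrow> nat set \<Rightarrow> nat \<Rightarrow> nat" where
  "kraft_exponent v P n = (\<Sum>p\<in>P. multiplicity p n + (if p dvd v * divisor_sum n then 1 else 0))"

lemma sum_geometric_half_le: "(\<Sum>e\<le>n. (1 / 2 :: real) ^ Suc e) \<le> 1"
proof -
  have "(\<Sum>e\<le>n. (1 / 2 :: real) ^ Suc e) = 1 - (1 / 2) ^ Suc n" by (induction n) auto
  thus ?thesis by simp
qed

text \<open>Every \<^term>\<open>n\<close> is encoded by its part \<^term>\<open>D\<close> supported on \<^term>\<open>Q0\<close> and a list of
  exponents: as long as some new prime divides \<^term>\<open>v * divisor_sum D\<close>, its exponent \<^term>\<open>e \<ge> 0\<close> in
  \<^term>\<open>n\<close> is recorded at cost \<^term>\<open>e + 1\<close> and \<^term>\<open>D\<close> is enlarged. When no such prime is left, the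
  cofactor divides its own divisor sum, so it is 1 and \<^term>\<open>n\<close> has been recovered.\<close>

lemma kraft_inequality:
  fixes T Q0 U :: "nat set" and v :: nat
  assumes finT: "finite T" and finU: "finite U" and primeU: "\<And>p. p \<in> U \<Longrightarrow> prime p"
    and T: "\<And>n. n \<in> T \<Longrightarrow> n > 0 \<and> n dvd v * divisor_sum n \<and> prime_factors (v * divisor_sum n) \<subseteq> U"
    and v: "v > 0"
    and bad: "\<And>n B. n \<in> T \<Longrightarrow> B dvd n \<Longrightarrow> B > 1 \<Longrightarrow> (\<forall>p\<in>Q0. \<not> p dvd B) \<Longrightarrow> \<not> B dvd divisor_sum B"
    and Q: "Q0 \<subseteq> Q" "\<And>p. p \<in> Q \<Longrightarrow> prime p" and D: "D > 0" "prime_factors D \<subseteq> Q"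
  shows "(\<Sum>n\<in>coprime_part_set T Q D. (1 / 2 :: real) ^ kraft_exponent v (U - Q) n) \<le> 1"
  using Q D
proof (induction "card (U - Q)" arbitrary: Q D rule: less_induct)
  case (less Q D)
  note Q = less.prems(1,2) and D = less.prems(3,4)
  have D_cop: "coprime D m" if "\<forall>p\<in>Q. \<not> p dvd m" for m
  proof (rule ccontr)
    assume "\<not> coprime D m"
    hence "gcd D m \<noteq> 1" by (simp add: coprime_iff_gcd_eq_1)
    then obtain p where p: "prime p" "p dvd gcd D m" using prime_factor_nat by blast
    hence "p \<in> Q" "p dvd m" using D by (auto simp: in_prime_factors_iff)
    thus False using that by blast
  qed
  show ?case
  proof (cases "\<exists>p\<in>U - Q. p dvd v * divisor_sum D")
    case False
    have "coprime_part_set T Q D \<subseteq> {D}"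
    proof
      fix n assume "n \<in> coprime_part_set T Q D"
      then obtain m where n: "n \<in> T" "n = D * m" "\<forall>p\<in>Q. \<not> p dvd m"
        by (auto simp: coprime_part_set_def)
      have m0: "m > 0" using T[OF n(1)] n(2) by (intro Nat.gr0I) auto
      have sig: "divisor_sum n = divisor_sum D * divisor_sum m"
        unfolding n(2) by (rule divisor_sum_mult) (use D_cop n m0 D in auto)
      have "m = 1"
      proof (rule ccontr)
        assume "m \<noteq> 1"
        hence m1: "m > 1" using m0 by simp
        \<comment> \<open>A common prime divides v sigma(n), hence lies in U, and divides m, hence
          lies outside Q; in this case no such prime is left.\<close>
        have "coprime m (v * divisor_sum D)"
        proof (rule ccontr)
          assume "\<not> coprime m (v * divisor_sum D)"
          hence "gcd m (v * divisor_sum D) \<noteq> 1" by (simp add: coprime_iff_gcd_eq_1)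
          then obtain p where p: "prime p" "p dvd gcd m (v * divisor_sum D)" using prime_factor_nat by blast
          hence pd: "p dvd m" "p dvd v * divisor_sum D" by auto
          have "p dvd v * divisor_sum n" using pd(2) unfolding sig by (metis dvd_mult2 mult.assoc)
          moreover have "v * divisor_sum n \<noteq> 0" using v T[OF n(1)] divisor_sum_ge[of n] by auto
          ultimately have "p \<in> U" using T[OF n(1)] p(1) by (auto simp: in_prime_factors_iff)
          moreover have "p \<notin> Q" using pd n(3) by auto
          ultimately show False using False pd by auto
        qed
        moreover have "m dvd (v * divisor_sum D) * divisor_sum m"
          using T[OF n(1)] n(2) unfolding sig by (metis dvd_mult_right mult.assoc)
        ultimately have "m dvd divisor_sum m" by (simp add: coprime_dvd_mult_right_iff)
        thus False using bad[OF n(1) _ m1] n Q(1) by auto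
      qed
      thus "n \<in> {D}" using n by simp
    qed
    hence "(\<Sum>n\<in>coprime_part_set T Q D. (1 / 2 :: real) ^ kraft_exponent v (U - Q) n)
        \<le> (\<Sum>n\<in>{D}. (1 / 2) ^ kraft_exponent v (U - Q) n)"
      by (intro sum_mono2) auto
    also have "\<dots> \<le> 1" by (simp add: power_le_one)
    finally show ?thesis .
  next
    case True
    then obtain p where p: "p \<in> U" "p \<notin> Q" "p dvd v * divisor_sum D" by blast
    have prp: "prime p" using p primeU by simp
    let ?Q = "insert p Q"
    have card: "card (U - ?Q) < card (U - Q)"
      using p finU by (intro psubset_card_mono) auto
    \<comment> \<open>A bound for the exponents e below, because e < p^e <= n; the inserted 0 covers
      an empty T.\<close>
    define X where "X = Max (insert 0 T)"
    have X: "n \<le> X" if "n \<in> T" for n using that finT by (simp add: X_def)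
    have finS: "finite (coprime_part_set T Q' D')" for Q' D'
      using finT by (simp add: coprime_part_set_def)
    have IH: "(\<Sum>n\<in>coprime_part_set T ?Q (D * p ^ e). (1 / 2 :: real) ^ kraft_exponent v (U - ?Q) n) \<le> 1" for e
    proof (rule less.hyps[OF card])
      show "prime_factors (D * p ^ e) \<subseteq> ?Q"
      proof
        fix q assume q: "q \<in> prime_factors (D * p ^ e)"
        hence "prime q" "q dvd D \<or> q dvd p ^ e" by (auto simp: in_prime_factors_iff prime_dvd_mult_iff)
        thus "q \<in> ?Q" using D prp primes_dvd_imp_eq[of q p] prime_dvd_power[of q p e]
          by (auto simp: in_prime_factors_iff)
      qed
    qed (use Q D prp in \<open>auto simp: prime_gt_0_nat\<close>)
    have split: "\<exists>e\<le>X. n \<in> coprime_part_set T ?Q (D * p ^ e) \<and>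
        (1 / 2 :: real) ^ kraft_exponent v (U - Q) n = (1 / 2) ^ Suc e * (1 / 2) ^ kraft_exponent v (U - ?Q) n"
      if n: "n \<in> coprime_part_set T Q D" for n
    proof -
      from n obtain m where m: "n \<in> T" "n = D * m" "\<forall>p\<in>Q. \<not> p dvd m"
        by (auto simp: coprime_part_set_def)
      have m0: "m > 0" using T[OF m(1)] m(2) by (intro Nat.gr0I) auto
      have "\<not> is_unit p" using prp by auto
      then obtain m' where m': "m = p ^ multiplicity p m * m'" "\<not> p dvd m'"
        using multiplicity_decompose'[of m p] m0 by auto
      define e where "e = multiplicity p m"
      have mult_n: "multiplicity p n = e"
      proof -
        have "\<not> p dvd D" using D p(2) prp by (auto simp: in_prime_factors_iff)
        hence "multiplicity p D = 0" by (rule not_dvd_imp_multiplicity_0)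
        thus ?thesis unfolding m(2) e_def using prp D(1) m0
          by (subst prime_elem_multiplicity_mult_distrib) auto
      qed
      have "e < p ^ e" using prime_gt_1_nat[OF prp] by (intro power_gt_expt) simp
      moreover have "p ^ e \<le> n" using T[OF m(1)] mult_n multiplicity_dvd[of p n] by (auto intro: dvd_imp_le)
      ultimately have eX: "e \<le> X" using X[OF m(1)] by simp
      have "divisor_sum n = divisor_sum D * divisor_sum m"
        unfolding m(2) by (rule divisor_sum_mult) (use D_cop m m0 D in auto)
      \<comment> \<open>sigma(D) divides sigma(n), so p passes the divisibility test in
        \<open>kraft_exponent\<close> for every n of this class; removing p from the code therefore
        saves exactly e + 1.\<close>
      hence pn: "p dvd v * divisor_sum n" using p(3) by (metis dvd_mult2 mult.assoc)
      define W where "W = U - ?Q"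
      have W: "U - Q = insert p W" "p \<notin> W" "finite W" using p finU by (auto simp: W_def)
      have "kraft_exponent v (insert p W) n = Suc e + kraft_exponent v W n"
        unfolding kraft_exponent_def using W(2,3) pn mult_n by simp
      hence "kraft_exponent v (U - Q) n = Suc e + kraft_exponent v (U - ?Q) n"
        unfolding W(1) W_def .
      hence "(1 / 2 :: real) ^ kraft_exponent v (U - Q) n = (1 / 2) ^ Suc e * (1 / 2) ^ kraft_exponent v (U - ?Q) n"
        by (simp add: power_add)
      moreover have "n \<in> coprime_part_set T ?Q (D * p ^ e)"
      proof -
        have "n = D * p ^ e * m'" using m(2) m'(1) by (simp add: e_def mult.assoc)
        moreover have "\<not> q dvd m'" if "q \<in> Q" for q
          using m(3) that m'(1) dvd_mult by metis
        ultimately show ?thesis using m(1) m'(2) unfolding coprime_part_set_def by auto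
      qed
      ultimately show ?thesis using eX by blast
    qed
    have "(\<Sum>n\<in>coprime_part_set T Q D. (1 / 2 :: real) ^ kraft_exponent v (U - Q) n)
       \<le> (\<Sum>n\<in>coprime_part_set T Q D. \<Sum>e\<le>X. if n \<in> coprime_part_set T ?Q (D * p ^ e) then (1 / 2) ^ Suc e * (1 / 2) ^ kraft_exponent v (U - ?Q) n else 0)"
    proof (rule sum_mono)
      fix n assume "n \<in> coprime_part_set T Q D"
      then obtain e where e: "e \<le> X" "n \<in> coprime_part_set T ?Q (D * p ^ e)"
        "(1 / 2 :: real) ^ kraft_exponent v (U - Q) n = (1 / 2) ^ Suc e * (1 / 2) ^ kraft_exponent v (U - ?Q) n"
        using split by blast
      have "(if n \<in> coprime_part_set T ?Q (D * p ^ e) then (1 / 2) ^ Suc e * (1 / 2) ^ kraft_exponent v (U - ?Q) n else 0)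
         \<le> (\<Sum>e\<le>X. if n \<in> coprime_part_set T ?Q (D * p ^ e) then (1 / 2 :: real) ^ Suc e * (1 / 2) ^ kraft_exponent v (U - ?Q) n else 0)"
        by (rule member_le_sum) (use e in auto)
      thus "(1 / 2 :: real) ^ kraft_exponent v (U - Q) n \<le> (\<Sum>e\<le>X. if n \<in> coprime_part_set T ?Q (D * p ^ e) then (1 / 2) ^ Suc e * (1 / 2) ^ kraft_exponent v (U - ?Q) n else 0)"
        using e by simp
    qed
    also have "\<dots> = (\<Sum>e\<le>X. \<Sum>n\<in>coprime_part_set T Q D. if n \<in> coprime_part_set T ?Q (D * p ^ e) then (1 / 2) ^ Suc e * (1 / 2) ^ kraft_exponent v (U - ?Q) n else 0)"
      by (rule sum.swap)
    also have "\<dots> \<le> (\<Sum>e\<le>X. \<Sum>n\<in>coprime_part_set T ?Q (D * p ^ e). (1 / 2) ^ Suc e * (1 / 2) ^ kraft_exponent v (U - ?Q) n)"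
      unfolding sum.inter_restrict[OF finS, symmetric]
      by (intro sum_mono sum_mono2) (auto simp: finS)
    also have "\<dots> = (\<Sum>e\<le>X. (1 / 2) ^ Suc e * (\<Sum>n\<in>coprime_part_set T ?Q (D * p ^ e). (1 / 2) ^ kraft_exponent v (U - ?Q) n))"
      by (simp only: sum_distrib_left)
    also have "\<dots> \<le> (\<Sum>e\<le>X. (1 / 2) ^ Suc e * 1)"
      by (intro sum_mono mult_left_mono IH) auto
    also have "\<dots> \<le> 1" using sum_geometric_half_le[of X] by simp
    finally show ?thesis .
  qed
qed

text \<open>D is determined by its exponents at the primes of Q, each at most ln x / ln 2.\<close>

lemma card_smooth_le:
  assumes x: "x \<ge> 1" and Q: "finite Q" "\<And>p. p \<in> Q \<Longrightarrow> prime p"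
  shows "finite {D. D > 0 \<and> real D \<le> x \<and> prime_factors D \<subseteq> Q}"
    and "real (card {D. D > 0 \<and> real D \<le> x \<and> prime_factors D \<subseteq> Q}) \<le> (ln x / ln 2 + 1) ^ card Q"
proof -
  let ?A = "{D. D > 0 \<and> real D \<le> x \<and> prime_factors D \<subseteq> Q}"
  have "?A \<subseteq> {..nat \<lfloor>x\<rfloor>}" by (auto intro!: le_nat_floor)
  thus fin: "finite ?A" by (rule finite_subset) auto
  define L where "L = nat \<lfloor>ln x / ln 2\<rfloor>"
  define f where "f = (\<lambda>D. restrict (\<lambda>p. multiplicity p D) Q)"
  have "inj_on f ?A"
  proof (rule inj_onI)
    fix D E assume D: "D \<in> ?A" and E: "E \<in> ?A" and eq: "f D = f E"
    show "D = E"
    proof (rule multiplicity_eq_nat)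
      fix p :: nat assume p: "prime p"
      show "multiplicity p D = multiplicity p E"
      proof (cases "p \<in> Q")
        case True
        thus ?thesis using fun_cong[OF eq, of p] by (simp add: f_def)
      next
        case False
        hence "\<not> p dvd D" "\<not> p dvd E" using D E p by (auto simp: in_prime_factors_iff)
        thus ?thesis by (simp add: not_dvd_imp_multiplicity_0)
      qed
    qed (use D E in auto)
  qed
  moreover have "f ` ?A \<subseteq> PiE Q (\<lambda>_. {..L})"
  proof (rule image_subsetI)
    fix D assume D: "D \<in> ?A"
    have "multiplicity p D \<le> L" if p: "p \<in> Q" for p
    proof -
      have "2 ^ multiplicity p D \<le> p ^ multiplicity p D"
        using prime_ge_2_nat[OF Q(2)[OF p]] by (rule power_mono) simp
      also have "\<dots> \<le> D" using D multiplicity_dvd[of p D] by (auto intro: dvd_imp_le)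
      finally have "real (2 ^ multiplicity p D) \<le> real D" by (rule of_nat_mono)
      also have "real D \<le> x" using D by blast
      finally have "2 ^ multiplicity p D \<le> x" by simp
      hence "ln (2 ^ multiplicity p D) \<le> ln x" using x by (subst ln_le_cancel_iff) auto
      hence "real (multiplicity p D) \<le> ln x / ln 2" by (simp add: ln_realpow field_simps)
      thus ?thesis unfolding L_def by (rule le_nat_floor)
    qed
    thus "f D \<in> PiE Q (\<lambda>_. {..L})" by (auto simp: f_def)
  qed
  ultimately have "card ?A \<le> card (PiE Q (\<lambda>_. {..L}))"
    by (rule card_inj_on_le) (use Q in \<open>auto intro: finite_PiE\<close>)
  also have "\<dots> = (L + 1) ^ card Q" using Q(1) by (simp add: card_PiE)
  finally have "real (card ?A) \<le> real ((L + 1) ^ card Q)" by (rule of_nat_mono)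
  also have "\<dots> = (real L + 1) ^ card Q" by (simp add: add.commute)
  also have "\<dots> \<le> (ln x / ln 2 + 1) ^ card Q"
  proof (rule power_mono)
    have "real L \<le> ln x / ln 2" unfolding L_def by (rule of_nat_floor) (use x in auto)
    thus "real L + 1 \<le> ln x / ln 2 + 1" by simp
  qed simp
  finally show "real (card ?A) \<le> (ln x / ln 2 + 1) ^ card Q" .
qed

text \<open>The part of n supported on P divides n, and each of its prime factors, counted with
  multiplicity, exceeds y.\<close>

lemma power_card_large_primes_le:
  assumes P: "finite P" "\<And>p. p \<in> P \<Longrightarrow> prime p" "\<And>p. p \<in> P \<Longrightarrow> y < real p" and y: "y > 1"
    and n: "n > 0"
  shows "y ^ (\<Sum>p\<in>P. multiplicity p n) \<le> real n"
proof -
  have "y ^ (\<Sum>p\<in>P. multiplicity p n) = (\<Prod>p\<in>P. y ^ multiplicity p n)" by (rule power_sum)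
  also have "\<dots> \<le> (\<Prod>p\<in>P. real p ^ multiplicity p n)"
    using P y by (intro prod_mono conjI power_mono) (auto intro: less_imp_le)
  also have "\<dots> = real (\<Prod>p\<in>P. p ^ multiplicity p n)" by simp
  also have "\<dots> \<le> real n"
  proof (intro of_nat_mono dvd_imp_le n)
    have "(\<Prod>p\<in>P. p ^ multiplicity p n) = (\<Prod>p\<in>P \<inter> prime_factors n. p ^ multiplicity p n)"
    proof (rule prod.mono_neutral_right)
      show "\<forall>p\<in>P - P \<inter> prime_factors n. p ^ multiplicity p n = 1"
      proof
        fix p assume "p \<in> P - P \<inter> prime_factors n"
        hence "\<not> p dvd n" using P(2) n by (auto simp: in_prime_factors_iff)
        thus "p ^ multiplicity p n = 1" by (simp add: not_dvd_imp_multiplicity_0)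
      qed
    qed (use P in auto)
    also have "\<dots> dvd (\<Prod>p\<in>prime_factors n. p ^ multiplicity p n)"
      by (rule prod_dvd_prod_subset) auto
    also have "\<dots> = n" using prime_factorization_nat[OF n] by simp
    finally show "(\<Prod>p\<in>P. p ^ multiplicity p n) dvd n" .
  qed
  finally show ?thesis .
qed

text \<open>Sort the n by their y-smooth part D. There are at most (ln x / ln 2 + 1)^pi(y) values of
  D, and for each of them the weights 2^(-code length) sum to at most 1 while each is at least
  2^(-K), so D has at most 2^K members.\<close>

lemma card_denominator_dvd_le:
  fixes x y :: real and v :: nat
  assumes x: "x \<ge> 1" and y: "y > 1" "2 * ln x / ln y \<le> y" and v: "v > 0" "real v \<le> x"
  shows "real (card {n. n > 0 \<and> real n \<le> x \<and> n dvd v * divisor_sum n})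
      \<le> 2 powr (4 * ln x / ln y) * (ln x / ln 2 + 1) ^ card {p::nat. prime p \<and> real p \<le> y}"
proof -
  define T where "T = {n. n > 0 \<and> real n \<le> x \<and> n dvd v * divisor_sum n}"
  define Q0 where "Q0 = {p::nat. prime p \<and> real p \<le> y}"
  define U where "U = (\<Union>n\<in>T. prime_factors (v * divisor_sum n))"
  define A where "A = {D. D > 0 \<and> real D \<le> x \<and> prime_factors D \<subseteq> Q0}"
  define K where "K = 4 * ln x / ln y"
  have "T \<subseteq> {..nat \<lfloor>x\<rfloor>}" by (auto simp: T_def intro!: le_nat_floor)
  hence finT: "finite T" by (rule finite_subset) auto
  have "Q0 \<subseteq> {..nat \<lfloor>y\<rfloor>}" by (auto simp: Q0_def intro!: le_nat_floor)
  hence finQ: "finite Q0" by (rule finite_subset) auto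
  have finU: "finite U" using finT by (auto simp: U_def)
  have pU: "prime p" if "p \<in> U" for p using that by (auto simp: U_def)
  have lny: "ln y > 0" using y by simp
  have finA: "finite A" and cardA: "real (card A) \<le> (ln x / ln 2 + 1) ^ card Q0"
    unfolding A_def using card_smooth_le[OF x finQ] by (auto simp: Q0_def)
  \<comment> \<open>A number B <= x with all primes above y has at most ln x / ln y of them; the
    hypothesis 2 ln x / ln y <= y makes that few enough for
    \<open>not_dvd_divisor_sum\<close>.\<close>
  have bad: "\<not> B dvd divisor_sum B" if "n \<in> T" "B dvd n" "B > 1" "\<forall>p\<in>Q0. \<not> p dvd B" for n B
  proof (rule not_dvd_divisor_sum[OF \<open>B > 1\<close>])
    have B: "real B \<le> x" using that by (auto simp: T_def dest!: dvd_imp_le)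
    show large: "real p > y" if "p \<in> prime_factors B" for p
      using that \<open>\<forall>p\<in>Q0. \<not> p dvd B\<close> by (auto simp: Q0_def in_prime_factors_iff)
    have "y ^ card (prime_factors B) \<le> y ^ (\<Sum>p\<in>prime_factors B. multiplicity p B)"
    proof (rule power_increasing)
      have "card (prime_factors B) = (\<Sum>p\<in>prime_factors B. 1)" by simp
      also have "\<dots> \<le> (\<Sum>p\<in>prime_factors B. multiplicity p B)"
        by (rule sum_mono) (use that in \<open>auto simp: in_prime_factors_iff Suc_le_eq prime_multiplicity_gt_zero_iff\<close>)
      finally show "card (prime_factors B) \<le> (\<Sum>p\<in>prime_factors B. multiplicity p B)" .
    qed (use y in auto)
    also have "\<dots> \<le> real B" by (rule power_card_large_primes_le) (use large y that in auto)
    finally have "y ^ card (prime_factors B) \<le> x" using B by simp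
    hence "ln (y ^ card (prime_factors B)) \<le> ln x" using y x by (subst ln_le_cancel_iff) auto
    hence "real (card (prime_factors B)) \<le> ln x / ln y" using y lny by (simp add: ln_realpow field_simps)
    thus "2 * real (card (prime_factors B)) \<le> y" using y(2) by simp
  qed (use y in auto)
  have kraft: "(\<Sum>n\<in>coprime_part_set T Q0 D. (1 / 2 :: real) ^ kraft_exponent v (U - Q0) n) \<le> 1" if "D \<in> A" for D
  proof (rule kraft_inequality[where ?Q0.0 = Q0])
    show "n > 0 \<and> n dvd v * divisor_sum n \<and> prime_factors (v * divisor_sum n) \<subseteq> U" if "n \<in> T" for n
      using that by (auto simp: T_def U_def)
    show "\<not> B dvd divisor_sum B" if "n \<in> T" "B dvd n" "B > 1" "\<forall>p\<in>Q0. \<not> p dvd B" for n B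
      by (rule bad[OF that])
    show "D > 0" "prime_factors D \<subseteq> Q0" using that by (auto simp: A_def)
  qed (use finT finU pU v in \<open>auto simp: Q0_def\<close>)
  \<comment> \<open>Each bit of the code is paid by a prime above y dividing n or v sigma(n), so
    y^(code length) <= n v sigma(n) <= x^4. This is the 4 in K.\<close>
  have weight: "(1 / 2 :: real) ^ kraft_exponent v (U - Q0) n \<ge> 2 powr (- K)" if n: "n \<in> T" for n
  proof -
    have n': "n > 0" "real n \<le> x" using n by (auto simp: T_def)
    define P where "P = U - Q0"
    define R where "R = {p\<in>P. p dvd v * divisor_sum n}"
    have P: "finite P" "\<And>p. p \<in> P \<Longrightarrow> prime p" "\<And>p. p \<in> P \<Longrightarrow> y < real p"
      using finU pU by (auto simp: P_def Q0_def not_le)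
    have sn: "v * divisor_sum n > 0" using v n' divisor_sum_ge[of n] by auto
    have "(\<Sum>p\<in>P. if p dvd v * divisor_sum n then 1 else 0 :: nat) = card R"
      using P(1) by (simp add: R_def sum.If_cases Int_def)
    hence ke: "kraft_exponent v P n = (\<Sum>p\<in>P. multiplicity p n) + card R"
      by (simp add: kraft_exponent_def sum.distrib)
    have "y ^ card R = (\<Prod>p\<in>R. y)" by simp
    also have "\<dots> \<le> (\<Prod>p\<in>R. real p)"
      by (rule prod_mono) (use P y in \<open>auto simp: R_def intro: less_imp_le\<close>)
    also have "\<dots> = real (\<Prod>R)" by simp
    also have "\<dots> \<le> real (v * divisor_sum n)"
      by (intro of_nat_mono dvd_imp_le prod_primes_dvd sn) (use P in \<open>auto simp: R_def\<close>)
    also have "\<dots> \<le> real (v * n\<^sup>2)"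
      by (intro of_nat_mono mult_left_mono divisor_sum_le_square n') auto
    also have "\<dots> = real v * real n ^ 2" by simp
    also have "\<dots> \<le> x * x ^ 2" using v n' x by (intro mult_mono power_mono) auto
    finally have R: "y ^ card R \<le> x * x ^ 2" .
    have "y ^ kraft_exponent v P n = y ^ (\<Sum>p\<in>P. multiplicity p n) * y ^ card R"
      by (simp add: ke power_add)
    also have "\<dots> \<le> x * (x * x ^ 2)"
      using power_card_large_primes_le[OF P y(1) n'(1)] R n' x y by (intro mult_mono) auto
    also have "\<dots> = x ^ 4" by (simp add: power4_eq_xxxx power2_eq_square)
    finally have "ln (y ^ kraft_exponent v P n) \<le> ln (x ^ 4)"
      using y x by (subst ln_le_cancel_iff) auto
    hence "real (kraft_exponent v P n) * ln y \<le> 4 * ln x" using x y by (simp add: ln_realpow)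
    hence le: "real (kraft_exponent v P n) \<le> K" using lny by (simp add: K_def field_simps)
    have "(2::real) powr (- K) \<le> 2 powr (- real (kraft_exponent v P n))"
      using le by (intro powr_mono) auto
    also have "\<dots> = (1 / 2) ^ kraft_exponent v P n"
      by (simp add: powr_minus powr_realpow power_one_over inverse_eq_divide)
    finally show ?thesis by (simp add: P_def)
  qed
  have cover: "T \<subseteq> (\<Union>D\<in>A. coprime_part_set T Q0 D)"
  proof
    fix n assume n: "n \<in> T"
    have n0: "n > 0" "real n \<le> x" using n by (auto simp: T_def)
    define D where "D = (\<Prod>p\<in>prime_factors n \<inter> Q0. p ^ multiplicity p n)"
    define m where "m = (\<Prod>p\<in>prime_factors n - Q0. p ^ multiplicity p n)"
    have nDm: "n = D * m"
      using prime_factorization_nat[OF n0(1)] unfolding D_def m_def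
      by (metis finite_set_mset prod.Int_Diff)
    have "\<not> p dvd m" if "p \<in> Q0" for p
    proof
      assume "p dvd m"
      moreover have "prime p" using that by (simp add: Q0_def)
      ultimately obtain q where "q \<in> prime_factors n - Q0" "p dvd q ^ multiplicity q n"
        unfolding m_def by (auto simp: prime_dvd_prod_iff)
      hence "p = q" using \<open>prime p\<close> prime_dvd_power primes_dvd_imp_eq by (metis DiffD1 in_prime_factors_iff)
      thus False using \<open>q \<in> _\<close> that by auto
    qed
    moreover have "D \<in> A"
    proof -
      have "D dvd n" using nDm by simp
      hence "D > 0" "D \<le> n" using n0 by (auto intro: dvd_imp_le dvd_pos_nat)
      moreover have "p \<in> Q0" if "p \<in> prime_factors D" for p
      proof -
        have "prime p" "p dvd D" using that by (auto simp: in_prime_factors_iff)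
        then obtain q where "q \<in> prime_factors n \<inter> Q0" "p dvd q ^ multiplicity q n"
          unfolding D_def by (auto simp: prime_dvd_prod_iff)
        hence "p = q" using \<open>prime p\<close> prime_dvd_power primes_dvd_imp_eq by (metis IntD1 in_prime_factors_iff)
        thus ?thesis using \<open>q \<in> _\<close> by auto
      qed
      ultimately show ?thesis using n0 by (auto simp: A_def)
    qed
    ultimately show "n \<in> (\<Union>D\<in>A. coprime_part_set T Q0 D)"
      using n nDm by (auto simp: coprime_part_set_def)
  qed
  have piece: "real (card (coprime_part_set T Q0 D)) \<le> 2 powr K" if "D \<in> A" for D
  proof -
    have "real (card (coprime_part_set T Q0 D)) * 2 powr (- K) = (\<Sum>n\<in>coprime_part_set T Q0 D. 2 powr (- K))" by simp
    also have "\<dots> \<le> (\<Sum>n\<in>coprime_part_set T Q0 D. (1 / 2 :: real) ^ kraft_exponent v (U - Q0) n)"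
      by (intro sum_mono weight) (auto simp: coprime_part_set_def)
    also have "\<dots> \<le> 1" by (rule kraft[OF that])
    finally show ?thesis by (simp add: powr_minus field_simps)
  qed
  have "card T \<le> card (\<Union>D\<in>A. coprime_part_set T Q0 D)"
    by (rule card_mono[OF _ cover]) (use finA finT in \<open>auto simp: coprime_part_set_def\<close>)
  also have "\<dots> \<le> (\<Sum>D\<in>A. card (coprime_part_set T Q0 D))" using finA by (rule card_UN_le)
  finally have "real (card T) \<le> (\<Sum>D\<in>A. real (card (coprime_part_set T Q0 D)))"
    by (simp flip: of_nat_sum)
  also have "\<dots> \<le> (\<Sum>D\<in>A. 2 powr K)" by (intro sum_mono piece)
  also have "\<dots> = real (card A) * 2 powr K" by simp
  also have "\<dots> \<le> (ln x / ln 2 + 1) ^ card Q0 * 2 powr K"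
    using cardA by (intro mult_right_mono) auto
  finally show ?thesis by (simp add: T_def Q0_def K_def mult.commute)
qed

section \<open>Sporadic solutions\<close>

text \<open>The set does not mention k: for its members that also lie in \<open>sol_set\<close>, the
  equation forces k = a m.\<close>

definition main_solutions :: "int \<Rightarrow> int \<Rightarrow> nat set" where
  "main_solutions a b = {n. \<exists>p m. prime p \<and> n = p * m \<and> \<not> p dvd m \<and> b * int (divisor_sum m) = a * int m}"

text \<open>Members of one residue class mod q are separated by their quotients by q, which are at
  most Y / q.\<close>

lemma card_congruent_le:
  fixes A :: "nat set" and Y :: real
  assumes q: "q > 0" and le: "\<And>s. s \<in> A \<Longrightarrow> real s \<le> Y" and Y: "Y \<ge> 0"
    and cong: "\<And>s t. s \<in> A \<Longrightarrow> t \<in> A \<Longrightarrow> s mod q = t mod q"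
  shows "real (card A) \<le> 1 + Y / real q"
proof -
  have inj: "inj_on (\<lambda>s. s div q) A"
    by (rule inj_onI) (metis cong mult_div_mod_eq)
  have "(\<lambda>s. s div q) ` A \<subseteq> {..nat \<lfloor>Y / real q\<rfloor>}"
  proof
    fix t assume "t \<in> (\<lambda>s. s div q) ` A"
    then obtain s where s: "s \<in> A" "t = s div q" by auto
    have "real t \<le> real s / real q" using s(2) by (simp add: of_nat_div_le_of_nat)
    also have "\<dots> \<le> Y / real q" using le[OF s(1)] by (intro divide_right_mono) auto
    finally show "t \<in> {..nat \<lfloor>Y / real q\<rfloor>}" by (auto intro!: le_nat_floor)
  qed
  from card_mono[OF _ this] have "card A \<le> Suc (nat \<lfloor>Y / real q\<rfloor>)"
    using card_image[OF inj] by simp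
  hence "real (card A) \<le> real (Suc (nat \<lfloor>Y / real q\<rfloor>))" by (rule of_nat_mono)
  moreover have "real (nat \<lfloor>Y / real q\<rfloor>) \<le> Y / real q"
    by (rule of_nat_floor) (use Y in auto)
  ultimately show ?thesis by simp
qed

lemma card_multiples_le:
  assumes q: "q > 0" and x: "x \<ge> 0"
  shows "finite {n. n > 0 \<and> real n \<le> x \<and> q dvd n}"
    and "real (card {n. n > 0 \<and> real n \<le> x \<and> q dvd n}) \<le> x / real q"
proof -
  have sub: "{n. n > 0 \<and> real n \<le> x \<and> q dvd n} \<subseteq> (\<lambda>k. q * k) ` {1..nat \<lfloor>x / real q\<rfloor>}"
  proof
    fix n assume n: "n \<in> {n. n > 0 \<and> real n \<le> x \<and> q dvd n}"
    then obtain k where k: "n = q * k" by (auto elim: dvdE)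
    have "real k \<le> x / real q" using n k q by (simp add: field_simps)
    hence "k \<le> nat \<lfloor>x / real q\<rfloor>" by (rule le_nat_floor)
    moreover have "k \<ge> 1" using n k by (cases k) auto
    ultimately show "n \<in> (\<lambda>k. q * k) ` {1..nat \<lfloor>x / real q\<rfloor>}" using k by auto
  qed
  thus fin: "finite {n. n > 0 \<and> real n \<le> x \<and> q dvd n}" by (rule finite_subset) auto
  have "card {n. n > 0 \<and> real n \<le> x \<and> q dvd n} \<le> card ((\<lambda>k. q * k) ` {1..nat \<lfloor>x / real q\<rfloor>})"
    by (rule card_mono[OF _ sub]) auto
  also have "\<dots> \<le> nat \<lfloor>x / real q\<rfloor>" using card_image_le[of "{1..nat \<lfloor>x / real q\<rfloor>}"] by force
  finally have "real (card {n. n > 0 \<and> real n \<le> x \<and> q dvd n}) \<le> real (nat \<lfloor>x / real q\<rfloor>)" by (rule of_nat_mono)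
  also have "\<dots> \<le> x / real q" by (rule of_nat_floor) (use x in auto)
  finally show "real (card {n. n > 0 \<and> real n \<le> x \<and> q dvd n}) \<le> x / real q" .
qed

lemma card_UN_real_le:
  assumes "finite I" "\<And>i. i \<in> I \<Longrightarrow> real (card (A i)) \<le> f i"
  shows "real (card (\<Union>i\<in>I. A i)) \<le> (\<Sum>i\<in>I. f i)"
proof -
  have "real (card (\<Union>i\<in>I. A i)) \<le> real (\<Sum>i\<in>I. card (A i))"
    by (rule of_nat_mono, rule card_UN_le[OF assms(1)])
  also have "\<dots> \<le> (\<Sum>i\<in>I. f i)" using assms(2) by (simp add: sum_mono)
  finally show ?thesis .
qed

lemma sum_inverse_upto_le:
  assumes x: "x \<ge> 1" and I: "I \<subseteq> {k. k > 0 \<and> real k \<le> x}"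
  shows "finite I" "(\<Sum>k\<in>I. 1 / real k) \<le> 1 + ln x"
proof -
  define N where "N = nat \<lfloor>x\<rfloor>"
  have N: "N > 0" "real N \<le> x" using x by (auto simp: N_def)
  have sub: "I \<subseteq> {1..N}" using I by (auto simp: N_def Suc_le_eq intro!: le_nat_floor)
  thus "finite I" by (rule finite_subset) auto
  have "(\<Sum>k\<in>I. 1 / real k) \<le> (\<Sum>k\<in>{1..N}. 1 / real k)" by (rule sum_mono2) (use sub in auto)
  also have "\<dots> \<le> 1 + ln (real N)" by (rule sum_inverse_le_ln[OF N(1)])
  also have "ln (real N) \<le> ln x" using N x by simp
  finally show "(\<Sum>k\<in>I. 1 / real k) \<le> 1 + ln x" by simp
qed

text \<open>For p > z already p^2 divides n, and the sum of x / d^2 over d > z is at most z^2 times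
  a harmonic sum. For p <= z a single power of p just beyond z^2 divides n; it has at most x / z^2 =
  z multiples, and there are at most z such p.\<close>

lemma card_large_prime_power_le:
  fixes z x :: real
  assumes z: "z \<ge> 1" "x = z ^ 3"
  shows "real (card {n. n > 0 \<and> real n \<le> x \<and> (\<exists>p e. prime (p::nat) \<and> e \<ge> 2 \<and> p ^ e dvd n \<and> real (p ^ e) > z\<^sup>2)})
     \<le> z\<^sup>2 * (2 + ln x)" (is "real (card ?A) \<le> _")
proof -
  have x: "x \<ge> 1" using z by simp
  define I where "I = {d. real d > z \<and> real d \<le> x}"
  define J where "J = {p::nat. prime p \<and> real p \<le> z}"
  \<comment> \<open>The least admissible exponent depends on p alone, so all n belonging to a small
    prime p are multiples of one fixed number.\<close>
  define e0 where "e0 = (\<lambda>p::nat. LEAST e. real (p ^ e) > z\<^sup>2)"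
  define M where "M = (\<lambda>q. {n. n > 0 \<and> real n \<le> x \<and> q dvd n})"
  have I: "I \<subseteq> {k. k > 0 \<and> real k \<le> x}" using z by (auto simp: I_def intro: Nat.gr0I)
  have finI: "finite I" by (rule sum_inverse_upto_le(1)[OF x I])
  have "J \<subseteq> {1..nat \<lfloor>z\<rfloor>}" by (auto simp: J_def Suc_le_eq dest: prime_gt_0_nat intro!: le_nat_floor)
  hence finJ: "finite J" and "card J \<le> card {1..nat \<lfloor>z\<rfloor>}"
    using finite_subset card_mono[of "{1..nat \<lfloor>z\<rfloor>}" J] by auto
  hence "real (card J) \<le> real (nat \<lfloor>z\<rfloor>)" by simp
  also have "\<dots> \<le> z" by (rule of_nat_floor) (use z in auto)
  finally have cardJ: "real (card J) \<le> z" .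
  have sub: "?A \<subseteq> (\<Union>d\<in>I. M (d\<^sup>2)) \<union> (\<Union>p\<in>J. M (p ^ e0 p))"
  proof
    fix n assume "n \<in> ?A"
    then obtain p e where n: "n > 0" "real n \<le> x" "prime p" "e \<ge> 2" "p ^ e dvd n" "real (p ^ e) > z\<^sup>2" by auto
    show "n \<in> (\<Union>d\<in>I. M (d\<^sup>2)) \<union> (\<Union>p\<in>J. M (p ^ e0 p))"
    proof (cases "real p > z")
      case True
      have "p\<^sup>2 dvd n" using n(4,5) by (meson dvd_trans le_imp_power_dvd)
      moreover have "p dvd p ^ e" using n(4) by (intro dvd_power) auto
      hence "p dvd n" using n(5) by (rule dvd_trans)
      hence "real p \<le> x" using n(1,2) by (auto dest!: dvd_imp_le)
      ultimately have "p \<in> I" "n \<in> M (p\<^sup>2)" using True n by (auto simp: I_def M_def)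
      thus ?thesis by blast
    next
      case False
      have "e0 p \<le> e" unfolding e0_def by (rule Least_le) (use n in auto)
      hence "p ^ e0 p dvd n" using n(5) by (meson dvd_trans le_imp_power_dvd)
      thus ?thesis using False n by (auto simp: J_def M_def)
    qed
  qed
  have M: "finite (M q)" "real (card (M q)) \<le> x / real q" if "q > 0" for q
    using card_multiples_le[OF that, of x] x by (auto simp: M_def)
  have posI: "d\<^sup>2 > 0" if "d \<in> I" for d using that I by auto
  have posJ: "p ^ e0 p > 0" if "p \<in> J" for p using that by (auto simp: J_def prime_gt_0_nat)
  have "card ?A \<le> card ((\<Union>d\<in>I. M (d\<^sup>2)) \<union> (\<Union>p\<in>J. M (p ^ e0 p)))"
    by (rule card_mono[OF _ sub]) (use finI finJ M posI posJ in blast)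
  also have "\<dots> \<le> card (\<Union>d\<in>I. M (d\<^sup>2)) + card (\<Union>p\<in>J. M (p ^ e0 p))" by (rule card_Un_le)
  finally have 1: "real (card ?A) \<le> real (card (\<Union>d\<in>I. M (d\<^sup>2))) + real (card (\<Union>p\<in>J. M (p ^ e0 p)))"
    by linarith
  have "real (card (\<Union>d\<in>I. M (d\<^sup>2))) \<le> (\<Sum>d\<in>I. z\<^sup>2 * (1 / real d))"
  proof (rule card_UN_real_le[OF finI])
    fix d assume d: "d \<in> I"
    have "real (card (M (d\<^sup>2))) \<le> x / real (d\<^sup>2)" using M(2)[OF posI[OF d]] .
    also have "\<dots> \<le> z\<^sup>2 * (1 / real d)"
    proof -
      have "z / real d \<le> 1" using d z by (auto simp: I_def)
      hence "z\<^sup>2 * (1 / real d) * (z / real d) \<le> z\<^sup>2 * (1 / real d) * 1" by (intro mult_left_mono) auto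
      moreover have "x / real (d\<^sup>2) = z\<^sup>2 * (1 / real d) * (z / real d)"
        using z by (simp add: power2_eq_square power3_eq_cube)
      ultimately show ?thesis by simp
    qed
    finally show "real (card (M (d\<^sup>2))) \<le> z\<^sup>2 * (1 / real d)" .
  qed
  also have "\<dots> = z\<^sup>2 * (\<Sum>d\<in>I. 1 / real d)" by (simp only: sum_distrib_left)
  also have "\<dots> \<le> z\<^sup>2 * (1 + ln x)" by (intro mult_left_mono sum_inverse_upto_le(2)[OF x I]) auto
  finally have 2: "real (card (\<Union>d\<in>I. M (d\<^sup>2))) \<le> z\<^sup>2 * (1 + ln x)" .
  have "real (card (\<Union>p\<in>J. M (p ^ e0 p))) \<le> (\<Sum>p\<in>J. z)"
  proof (rule card_UN_real_le[OF finJ])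
    fix p assume p: "p \<in> J"
    have p1: "real p > 1" using p prime_gt_1_nat by (auto simp: J_def)
    obtain e where e: "z\<^sup>2 < real p ^ e" using real_arch_pow[OF p1] by blast
    have "real (p ^ e0 p) > z\<^sup>2"
      unfolding e0_def by (rule LeastI[of "\<lambda>e. z\<^sup>2 < real (p ^ e)" e]) (use e in simp)
    hence "x / real (p ^ e0 p) \<le> x / z\<^sup>2" using x z p1 by (intro divide_left_mono mult_pos_pos) auto
    also have "\<dots> = z" using z by (simp add: power2_eq_square power3_eq_cube)
    finally show "real (card (M (p ^ e0 p))) \<le> z" using M(2)[OF posJ[OF p]] by linarith
  qed
  also have "\<dots> \<le> z\<^sup>2" using cardJ z by (simp add: power2_eq_square mult_right_mono)
  finally show ?thesis using 1 2 by (simp add: algebra_simps)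
qed

text \<open>Let M be the largest unitary divisor up to z^2, and suppose M <= z. Take a full prime
  power q of n / M: if q <= z, then M q is a larger unitary divisor up to z^2, a contradiction; if z
  < q <= z^2, then q itself is in the window; otherwise q is a large prime power or a large
  prime.\<close>

lemma unitary_divisor_cases:
  fixes z :: real
  assumes z: "z \<ge> 1" and n: "real n > z\<^sup>2"
  obtains (middle) m d where "n = m * d" "coprime m d" "z < real m" "real m \<le> z\<^sup>2"
    | (power) p e where "prime p" "e \<ge> 2" "p ^ e dvd n" "real (p ^ e) > z\<^sup>2"
    | (prime) p m where "prime p" "n = p * m" "\<not> p dvd m" "real p > z\<^sup>2"
proof -
  have "z * 1 \<le> z * z" using z by (intro mult_left_mono) auto
  hence zz: "z\<^sup>2 \<ge> z" "z\<^sup>2 \<ge> 1" unfolding power2_eq_square using z by linarith+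
  have n0: "n > 0" using n zz by (intro Nat.gr0I) auto
  define U where "U = {m. \<exists>d. n = m * d \<and> coprime m d \<and> real m \<le> z\<^sup>2}"
  have "U \<subseteq> {..n}" using n0 by (auto simp: U_def)
  hence finU: "finite U" by (rule finite_subset) auto
  have "1 \<in> U" using zz by (auto simp: U_def)
  hence "Max U \<in> U" using finU Max_in by blast
  define M where "M = Max U"
  have maxM: "m \<le> M" if "m \<in> U" for m using that finU by (simp add: M_def)
  obtain d where d: "n = M * d" "coprime M d" "real M \<le> z\<^sup>2"
    using \<open>Max U \<in> U\<close> by (auto simp: U_def M_def)
  show ?thesis
  proof (cases "real M > z")
    case True
    thus ?thesis using middle d by blast
  next
    case False
    have "d \<noteq> 1" using d n by auto
    moreover have "d > 0" "M > 0" using d n0 by (auto intro: Nat.gr0I)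
    ultimately have d1: "d > 1" by simp
    then obtain p where p: "prime p" "p dvd d" using prime_factor_nat[of d] by auto
    obtain e r where er: "d = p ^ e * r" "e > 0" "\<not> p dvd r" "r > 0" "r < d" "coprime (p ^ e) r"
      using prime_power_cofactor[OF d1 p] by blast
    define q where "q = p ^ e"
    have q1: "q > 1" unfolding q_def using er(2) p by (intro one_less_power prime_gt_1_nat) auto
    have copM: "coprime M q" "coprime M r" using d(2) er(1) by (auto simp: q_def)
    have nq: "n = q * (M * r)" using d er by (simp add: q_def mult_ac)
    consider "real q > z\<^sup>2" | "z < real q" "real q \<le> z\<^sup>2" | "real q \<le> z" by linarith
    thus ?thesis
    proof cases
      case 1
      show ?thesis
      proof (cases "e \<ge> 2")
        case True
        thus ?thesis using power[of p e] p 1 nq by (auto simp: q_def)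
      next
        case False
        hence "e = 1" using er by simp
        hence qp: "q = p" by (simp add: q_def)
        have "\<not> p dvd M"
        proof
          assume "p dvd M"
          hence "p dvd 1" using copM(1) unfolding qp by (meson coprime_common_divisor dvd_refl)
          thus False using p by auto
        qed
        hence "\<not> p dvd M * r" using er p by (simp add: prime_dvd_mult_iff)
        thus ?thesis using prime[of p "M * r"] p nq 1 qp by auto
      qed
    next
      case 2
      have "coprime q (M * r)" using copM er by (simp add: q_def coprime_commute)
      thus ?thesis using middle[OF nq] 2 by blast
    next
      case 3
      have "real (M * q) \<le> z * z" using 3 False z by (simp add: mult_mono)
      moreover have "coprime (M * q) r" using copM er by (simp add: q_def)
      moreover have "n = (M * q) * r" using nq by simp
      ultimately have "M * q \<in> U" unfolding U_def power2_eq_square by blast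
      hence "M * q \<le> M" by (rule maxM)
      thus ?thesis using q1 \<open>M > 0\<close> by simp
    qed
  qed
qed

text \<open>n -> m is injective, because outside \<open>main_solutions\<close> the coefficient of p
  in the equation is nonzero, and m <= x / z^2 = z.\<close>

lemma card_prime_cofactor_le:
  fixes z x :: real
  assumes z: "z \<ge> 1" "x = z ^ 3" and b: "b > (0::int)"
  shows "real (card {n \<in> sol_set_upto a b k x. n \<notin> main_solutions a b \<and> (\<exists>p m. prime p \<and> n = p * m \<and> \<not> p dvd m \<and> real p > z\<^sup>2)}) \<le> z"
    (is "real (card ?A) \<le> _")
proof -
  define f where "f = (\<lambda>n. SOME m. \<exists>p. prime p \<and> n = p * m \<and> \<not> p dvd m \<and> real p > z\<^sup>2)"
  have f: "\<exists>p. prime p \<and> n = p * f n \<and> \<not> p dvd f n \<and> real p > z\<^sup>2" if "n \<in> ?A" for n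
    unfolding f_def by (rule someI_ex) (use that in blast)
  have z2: "z\<^sup>2 > 0" using z by auto
  have eq: "int p * (b * int (divisor_sum (f n)) - a * int (f n)) = k - b * int (divisor_sum (f n))"
    if n: "n \<in> ?A" and p: "prime p" "n = p * f n" "\<not> p dvd f n" for n p
  proof -
    have n1: "n > 0" "b * int (divisor_sum n) = a * int n + k" using n by (auto simp: sol_set_upto_def sol_set_def)
    have "divisor_sum (p * f n) = divisor_sum p * divisor_sum (f n)"
      by (rule divisor_sum_mult) (use p n1 prime_imp_coprime prime_gt_0_nat in \<open>auto intro: Nat.gr0I\<close>)
    hence "divisor_sum n = (p + 1) * divisor_sum (f n)" using p divisor_sum_prime by simp
    hence "b * (int (p + 1) * int (divisor_sum (f n))) = a * (int p * int (f n)) + k"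
      using n1(2) p(2) by (metis of_nat_mult)
    thus ?thesis by (simp add: algebra_simps)
  qed
  have "inj_on f ?A"
  proof (rule inj_onI)
    fix n n' assume n: "n \<in> ?A" "n' \<in> ?A" "f n = f n'"
    obtain p where p: "prime p" "n = p * f n" "\<not> p dvd f n" using f[OF n(1)] by blast
    obtain p' where p': "prime p'" "n' = p' * f n'" "\<not> p' dvd f n'" using f[OF n(2)] by blast
    have "b * int (divisor_sum (f n)) - a * int (f n) \<noteq> 0"
      using n(1) p unfolding main_solutions_def by auto
    moreover have "int p * (b * int (divisor_sum (f n)) - a * int (f n)) = int p' * (b * int (divisor_sum (f n)) - a * int (f n))"
      using eq[OF n(1) p] eq[OF n(2) p'] n(3) by simp
    ultimately have "p = p'" by simp
    thus "n = n'" using p p' n(3) by simp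
  qed
  moreover have "f ` ?A \<subseteq> {1..nat \<lfloor>z\<rfloor>}"
  proof (rule image_subsetI)
    fix n assume n: "n \<in> ?A"
    obtain p where p: "n = p * f n" "real p > z\<^sup>2" using f[OF n] by blast
    have n1: "n > 0" "real n \<le> x" using n by (auto simp: sol_set_upto_def sol_set_def)
    have f0: "f n > 0" using n1 p by (intro Nat.gr0I) auto
    have "z\<^sup>2 * real (f n) \<le> real p * real (f n)" using p by (intro mult_right_mono) auto
    also have "\<dots> = real n" using p(1) by (metis of_nat_mult)
    also have "\<dots> \<le> z\<^sup>2 * z" using n1 z by (simp add: power2_eq_square power3_eq_cube)
    finally have "real (f n) \<le> z" using z2 by simp
    thus "f n \<in> {1..nat \<lfloor>z\<rfloor>}" using f0 by (auto intro!: le_nat_floor)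
  qed
  ultimately have "card ?A \<le> card {1..nat \<lfloor>z\<rfloor>}" by (rule card_inj_on_le) auto
  hence "real (card ?A) \<le> real (nat \<lfloor>z\<rfloor>)" by simp
  also have "\<dots> \<le> z" by (rule of_nat_floor) (use z in auto)
  finally show ?thesis .
qed

lemma dvd_mult_imp_div_gcd_dvd:
  fixes m c t :: int
  assumes "m dvd c * t" "m \<noteq> 0"
  shows "m div gcd m c dvd t"
proof -
  have g: "gcd m c \<noteq> 0" using assms by simp
  have "(m div gcd m c) * gcd m c dvd ((c div gcd m c) * t) * gcd m c"
    using assms(1) by (simp add: mult_ac)
  hence "m div gcd m c dvd (c div gcd m c) * t"
    using g by (simp only: dvd_mult_cancel_right) simp
  moreover have "coprime (m div gcd m c) (c div gcd m c)" using assms by (intro div_gcd_coprime) auto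
  ultimately show ?thesis by (simp add: coprime_dvd_mult_right_iff)
qed

text \<open>The sum of the complementary unitary divisor determines \<^term>\<open>n\<close> and lies in a fixed residue class.\<close>

lemma card_unitary_divisor_le:
  fixes x :: real
  assumes a: "a > 0" and b: "b > (0::int)" and m: "m > 0" and x: "x \<ge> 1"
  shows "real (card {n \<in> sol_set_upto a b k x. \<exists>d. n = m * d \<and> coprime m d})
     \<le> 1 + x * (1 + ln x) * real_of_int b * (real (gcd m (divisor_sum m)) / real m ^ 2)"
    (is "real (card ?A) \<le> _")
proof -
  define c where "c = b * int (divisor_sum m)"
  \<comment> \<open>Since m divides n, c s is congruent to k mod m for every s = sigma(d) that
    occurs; this fixes s modulo m / gcd(m, c).\<close>
  define q where "q = nat (int m div gcd (int m) c)"
  define g where "g = gcd (int m) c"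
  define s where "s = (\<lambda>n. divisor_sum (n div m))"
  \<comment> \<open>The bound for sigma(d) when d <= x / m.\<close>
  define Y where "Y = x / real m * (1 + ln x)"
  have g: "g > 0" "g dvd int m" using m by (auto simp: g_def)
  have qg: "int q * g = int m" "q > 0"
  proof -
    have "int m div g > 0" using g m by (metis dvd_div_mult_self mult_pos_pos of_nat_0_less_iff pos_imp_zdiv_pos_iff zdvd_imp_le)
    thus "int q * g = int m" "q > 0" using g by (auto simp: q_def g_def)
  qed
  have A: "\<exists>d. n = m * d \<and> s n = divisor_sum d \<and> d > 0 \<and> real d \<le> x / real m \<and> c * int (s n) = a * int n + k"
    if n: "n \<in> ?A" for n
  proof -
    from n obtain d where d: "n = m * d" "coprime m d" by auto
    have n1: "n > 0" "real n \<le> x" "b * int (divisor_sum n) = a * int n + k"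
      using n by (auto simp: sol_set_upto_def sol_set_def)
    have d0: "d > 0" using n1 d by (intro Nat.gr0I) auto
    have "divisor_sum n = divisor_sum m * divisor_sum d"
      unfolding d(1) by (rule divisor_sum_mult) (use d m d0 in auto)
    moreover have "s n = divisor_sum d" using d m by (simp add: s_def)
    moreover have "real d \<le> x / real m" using n1 d m by (simp add: field_simps)
    ultimately show ?thesis using d d0 n1(3) by (auto simp: c_def mult_ac)
  qed
  \<comment> \<open>c s(n) = a n + k with a nonzero, so s(n) determines n. Apart from its sign, a
    plays no quantitative part in the estimate.\<close>
  have "inj_on s ?A"
  proof (rule inj_onI)
    fix n n' assume n: "n \<in> ?A" "n' \<in> ?A" "s n = s n'"
    have "a * int n + k = a * int n' + k" using A[OF n(1)] A[OF n(2)] n(3) by metis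
    thus "n = n'" using a by simp
  qed
  hence "card ?A = card (s ` ?A)" by (simp add: card_image)
  moreover have "real (card (s ` ?A)) \<le> 1 + Y / real q"
  proof (rule card_congruent_le[OF qg(2)])
    show "Y \<ge> 0" using x m by (auto simp: Y_def)
    fix t assume "t \<in> s ` ?A"
    then obtain n where n: "n \<in> ?A" "t = s n" by auto
    obtain d where d: "s n = divisor_sum d" "d > 0" "real d \<le> x / real m" using A[OF n(1)] by blast
    have "x / real m \<le> x" using x m by (simp add: field_simps)
    hence dx: "real d \<le> x" using d by simp
    have "real (divisor_sum d) \<le> real d * (1 + ln (real d))" by (rule divisor_sum_le_ln[OF d(2)])
    also have "\<dots> \<le> x / real m * (1 + ln x)"
      using d dx x m by (intro mult_mono) auto
    finally show "real t \<le> Y" using n d by (simp add: Y_def)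
  next
    fix t t' assume "t \<in> s ` ?A" "t' \<in> s ` ?A"
    then obtain n n' where n: "n \<in> ?A" "n' \<in> ?A" "t = s n" "t' = s n'" by auto
    have "c * (int t - int t') = a * (int n - int n')"
      using A[OF n(1)] A[OF n(2)] n(3,4) by (auto simp: right_diff_distrib)
    moreover have "int m dvd int n - int n'" using n by (auto simp flip: right_diff_distrib)
    ultimately have "int m dvd c * (int t - int t')" by simp
    hence "int m div gcd (int m) c dvd int t - int t'" using m by (intro dvd_mult_imp_div_gcd_dvd) auto
    hence "int q dvd int t - int t'" using qg(2) by (simp add: q_def)
    hence "int t mod int q = int t' mod int q" by (simp add: mod_eq_dvd_iff)
    thus "t mod q = t' mod q" by (metis of_nat_eq_iff of_nat_mod)
  qed
  moreover have "Y / real q \<le> x * (1 + ln x) * real_of_int b * (real (gcd m (divisor_sum m)) / real m ^ 2)"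
  proof -
    \<comment> \<open>The passage from gcd(m, b sigma(m)) to b gcd(m, sigma(m)) is where the factor
      b arises.\<close>
    have "g dvd gcd (b * int m) (b * int (divisor_sum m))" using g(2) by (auto simp: g_def c_def)
    also have "\<dots> = b * int (gcd m (divisor_sum m))" using b by (simp add: gcd_mult_left abs_mult)
    finally have "g \<le> b * int (gcd m (divisor_sum m))" using b m by (intro zdvd_imp_le) auto
    hence gb: "real_of_int g \<le> real_of_int b * real (gcd m (divisor_sum m))"
      by (metis of_int_le_iff of_int_mult of_int_of_nat_eq)
    have "real m = real q * real_of_int g" using qg(1) by (metis of_int_mult of_int_of_nat_eq)
    hence "1 / real q = real_of_int g / real m" using qg(2) g by simp
    hence "Y / real q = Y * (real_of_int g / real m)" by (metis times_divide_eq_right mult.right_neutral)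
    also have "\<dots> \<le> Y * (real_of_int b * real (gcd m (divisor_sum m)) / real m)"
      using gb x m by (intro mult_left_mono divide_right_mono) (auto simp: Y_def)
    also have "\<dots> = x * (1 + ln x) * real_of_int b * (real (gcd m (divisor_sum m)) / real m ^ 2)"
      by (simp add: Y_def power2_eq_square)
    finally show ?thesis .
  qed
  ultimately show ?thesis by linarith
qed

text \<open>With w the reduced denominator of sigma(m) / m, gcd(m, sigma(m)) / m^2 = 1 / (m w) <= 1
  / (z w). At most R values of m share w = v, because then m divides v sigma(m), and the sum of 1 /
  v over v <= x costs the logarithm.\<close>

lemma sum_gcd_divisor_sum_le:
  fixes z x R :: real
  assumes x: "x \<ge> 1" and z: "z \<ge> 1" "z\<^sup>2 \<le> x"
    and R: "\<And>v. v > 0 \<Longrightarrow> real v \<le> x \<Longrightarrow> real (card {n. n > 0 \<and> real n \<le> x \<and> n dvd v * divisor_sum n}) \<le> R"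
  shows "(\<Sum>m | z < real m \<and> real m \<le> z\<^sup>2. real (gcd m (divisor_sum m)) / real m ^ 2) \<le> R * (1 + ln x) / z"
proof -
  let ?M = "{m. z < real m \<and> real m \<le> z\<^sup>2}"
  define V where "V = {v. v > 0 \<and> real v \<le> x}"
  define w where "w = (\<lambda>m. m div gcd m (divisor_sum m))"
  have M: "?M \<subseteq> {k. k > 0 \<and> real k \<le> x}" using z by (auto intro: Nat.gr0I)
  have finM: "finite ?M" by (rule sum_inverse_upto_le(1)[OF x M])
  have finV: "finite V" unfolding V_def by (rule sum_inverse_upto_le(1)[OF x order_refl])
  have w: "w m * gcd m (divisor_sum m) = m" "w m > 0" "w m \<le> m" "m dvd w m * divisor_sum m" if "m > 0" for m
  proof -
    show 1: "w m * gcd m (divisor_sum m) = m" by (simp add: w_def)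
    show "w m > 0" using 1 that by (intro Nat.gr0I) auto
    show "w m \<le> m" by (simp add: w_def)
    have "w m * gcd m (divisor_sum m) dvd w m * divisor_sum m" by (intro mult_dvd_mono) auto
    thus "m dvd w m * divisor_sum m" using 1 by simp
  qed
  have R0: "R \<ge> 0" using R[of 1] x by (intro order_trans[OF _ R[of 1]]) auto
  have "(\<Sum>m\<in>?M. real (gcd m (divisor_sum m)) / real m ^ 2) \<le> (\<Sum>m\<in>?M. 1 / z * (1 / real (w m)))"
  proof (rule sum_mono)
    fix m assume m: "m \<in> ?M"
    hence m0: "m > 0" using M by auto
    have "real m = real (w m) * real (gcd m (divisor_sum m))"
      using w(1)[OF m0] by (metis of_nat_mult)
    hence "real (gcd m (divisor_sum m)) / real m = 1 / real (w m)" using m0 w(2)[OF m0] by (simp add: field_simps)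
    moreover have "real (gcd m (divisor_sum m)) / real m ^ 2 = 1 / real m * (real (gcd m (divisor_sum m)) / real m)"
      by (simp add: power2_eq_square)
    ultimately have "real (gcd m (divisor_sum m)) / real m ^ 2 = 1 / real m * (1 / real (w m))"
      by (simp only:)
    also have "\<dots> \<le> 1 / z * (1 / real (w m))"
      using m z by (intro mult_right_mono divide_left_mono) auto
    finally show "real (gcd m (divisor_sum m)) / real m ^ 2 \<le> 1 / z * (1 / real (w m))" .
  qed
  also have "\<dots> = 1 / z * (\<Sum>m\<in>?M. 1 / real (w m))" by (simp only: sum_distrib_left)
  also have "(\<Sum>m\<in>?M. 1 / real (w m)) = (\<Sum>v\<in>V. \<Sum>m | m \<in> ?M \<and> w m = v. 1 / real (w m))"
  proof (rule sum.group[symmetric, OF finM finV])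
    show "w ` ?M \<subseteq> V"
    proof (rule image_subsetI)
      fix m assume m: "m \<in> ?M"
      hence "m > 0" "real m \<le> x" using M by auto
      thus "w m \<in> V" using w(2,3)[of m] by (auto simp: V_def intro: order_trans)
    qed
  qed
  also have "\<dots> \<le> (\<Sum>v\<in>V. R * (1 / real v))"
  proof (rule sum_mono)
    fix v assume v: "v \<in> V"
    have "(\<Sum>m | m \<in> ?M \<and> w m = v. 1 / real (w m)) = real (card {m. m \<in> ?M \<and> w m = v}) * (1 / real v)"
      by simp
    also have "\<dots> \<le> R * (1 / real v)"
    proof (rule mult_right_mono)
      have fin: "finite {n. n > 0 \<and> real n \<le> x \<and> n dvd v * divisor_sum n}"
        by (rule finite_subset[OF _ finV]) (auto simp: V_def)
      have "{m. m \<in> ?M \<and> w m = v} \<subseteq> {n. n > 0 \<and> real n \<le> x \<and> n dvd v * divisor_sum n}"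
        using M w(4) by auto
      from card_mono[OF fin this]
      show "real (card {m. m \<in> ?M \<and> w m = v}) \<le> R"
        using R[of v] v by (auto simp: V_def)
    qed auto
    finally show "(\<Sum>m | m \<in> ?M \<and> w m = v. 1 / real (w m)) \<le> R * (1 / real v)" .
  qed
  also have "\<dots> = R * (\<Sum>v\<in>V. 1 / real v)" by (simp only: sum_distrib_left)
  also have "\<dots> \<le> R * (1 + ln x)"
    by (intro mult_left_mono sum_inverse_upto_le(2)[OF x] R0) (auto simp: V_def)
  finally show ?thesis using z by (simp add: divide_right_mono)
qed

text \<open>Here z = x^(1/3). Small n, large prime powers and large primes cost z^2 up to a
  logarithm. The rest is covered by the m in (z, z^2], at cost \<open>card M\<close> plus x (1 + ln
  x) b times the sum of gcd(m, sigma(m)) / m^2. One logarithm comes from the size of sigma(d), the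
  other from the sum over denominators.\<close>

theorem card_sporadic_solutions_le:
  fixes x R :: real
  assumes a: "a > 0" and b: "b > (0::int)" and x: "x \<ge> 1" and R1: "R \<ge> 1"
    and R: "\<And>v. v > 0 \<Longrightarrow> real v \<le> x \<Longrightarrow> real (card {n. n > 0 \<and> real n \<le> x \<and> n dvd v * divisor_sum n}) \<le> R"
  shows "real (card (sol_set_upto a b k x - main_solutions a b)) \<le> 6 * real_of_int b * x powr (2 / 3) * (1 + ln x)\<^sup>2 * R"
proof -
  define z where "z = x powr (1 / 3)"
  have z1: "z \<ge> 1" using x by (simp add: z_def ge_one_powr_ge_zero)
  have z3: "x = z ^ 3" using x by (simp add: z_def powr_powr flip: powr_realpow)
  have z2: "x powr (2 / 3) = z\<^sup>2" using x by (simp add: z_def powr_powr flip: powr_realpow)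
  have zx: "z\<^sup>2 \<le> x" unfolding z3 using z1 by (intro power_increasing) auto
  let ?S = "sol_set_upto a b k x"
  define A1 where "A1 = {n. n > 0 \<and> real n \<le> z\<^sup>2}"
  define A2 where "A2 = {n. n > 0 \<and> real n \<le> x \<and> (\<exists>p e. prime (p::nat) \<and> e \<ge> 2 \<and> p ^ e dvd n \<and> real (p ^ e) > z\<^sup>2)}"
  define A3 where "A3 = {n \<in> ?S. n \<notin> main_solutions a b \<and> (\<exists>p m. prime p \<and> n = p * m \<and> \<not> p dvd m \<and> real p > z\<^sup>2)}"
  define M where "M = {m. z < real m \<and> real m \<le> z\<^sup>2}"
  define B where "B = (\<lambda>m. {n \<in> ?S. \<exists>d. n = m * d \<and> coprime m d})"
  define l where "l = 1 + ln x"
  have l: "l \<ge> 1" using x by (simp add: l_def)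
  have S: "?S \<subseteq> {k. k > 0 \<and> real k \<le> x}" by (auto simp: sol_set_upto_def sol_set_def)
  have fin_x: "finite {k. k > 0 \<and> real k \<le> x}" by (rule sum_inverse_upto_le(1)[OF x order_refl])
  have finS: "finite ?S" by (rule finite_subset[OF S fin_x])
  have finM: "finite M" by (rule finite_subset[OF _ fin_x]) (use z1 zx in \<open>auto simp: M_def intro: Nat.gr0I\<close>)
  have fin: "finite A1" "finite A2" "finite A3" "finite (\<Union>m\<in>M. B m)"
  proof -
    show "finite A1" by (rule finite_subset[OF _ fin_x]) (use zx in \<open>auto simp: A1_def\<close>)
    show "finite A2" by (rule finite_subset[OF _ fin_x]) (auto simp: A2_def)
  qed (use finS finM in \<open>auto simp: A3_def B_def\<close>)
  have sub: "?S - main_solutions a b \<subseteq> A1 \<union> A2 \<union> A3 \<union> (\<Union>m\<in>M. B m)"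
  proof
    fix n assume n: "n \<in> ?S - main_solutions a b"
    hence n': "n > 0" "real n \<le> x" using S by auto
    show "n \<in> A1 \<union> A2 \<union> A3 \<union> (\<Union>m\<in>M. B m)"
    proof (cases "real n \<le> z\<^sup>2")
      case True
      thus ?thesis using n' by (simp add: A1_def)
    next
      case False
      hence "real n > z\<^sup>2" by simp
      from z1 this show ?thesis
      proof (cases rule: unitary_divisor_cases)
        case (middle m d)
        hence "m \<in> M" "n \<in> B m" using n by (auto simp: M_def B_def)
        thus ?thesis by blast
      next
        case (power p e)
        hence "n \<in> A2" using n' unfolding A2_def by blast
        thus ?thesis by blast
      next
        case (prime p m)
        hence "n \<in> A3" using n unfolding A3_def by blast
        thus ?thesis by blast
      qed
    qed
  qed
  have c1: "real (card A1) \<le> z\<^sup>2"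
  proof -
    have "A1 \<subseteq> {1..nat \<lfloor>z\<^sup>2\<rfloor>}" by (auto simp: A1_def Suc_le_eq intro!: le_nat_floor)
    hence "card A1 \<le> card {1..nat \<lfloor>z\<^sup>2\<rfloor>}" by (rule card_mono[rotated]) simp
    hence "card A1 \<le> nat \<lfloor>z\<^sup>2\<rfloor>" by simp
    hence "real (card A1) \<le> real (nat \<lfloor>z\<^sup>2\<rfloor>)" by (rule of_nat_mono)
    also have "\<dots> \<le> z\<^sup>2" by (rule of_nat_floor) auto
    finally show ?thesis .
  qed
  have c2: "real (card A2) \<le> z\<^sup>2 * (1 + l)"
    using card_large_prime_power_le[OF z1 z3] by (simp add: A2_def l_def)
  have c3: "real (card A3) \<le> z"
    unfolding A3_def by (rule card_prime_cofactor_le[OF z1 z3 b])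
  have c4: "real (card (\<Union>m\<in>M. B m)) \<le> z\<^sup>2 + real_of_int b * z\<^sup>2 * l\<^sup>2 * R"
  proof -
    have "real (card (\<Union>m\<in>M. B m)) \<le> (\<Sum>m\<in>M. 1 + x * l * real_of_int b * (real (gcd m (divisor_sum m)) / real m ^ 2))"
    proof (rule card_UN_real_le[OF finM])
      fix m assume "m \<in> M"
      hence "m > 0" using z1 by (auto simp: M_def intro: Nat.gr0I)
      thus "real (card (B m)) \<le> 1 + x * l * real_of_int b * (real (gcd m (divisor_sum m)) / real m ^ 2)"
        unfolding B_def l_def by (intro card_unitary_divisor_le a b x)
    qed
    also have "\<dots> = real (card M) + x * l * real_of_int b * (\<Sum>m\<in>M. real (gcd m (divisor_sum m)) / real m ^ 2)"
      by (simp add: sum.distrib sum_distrib_left)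
    also have "(\<Sum>m\<in>M. real (gcd m (divisor_sum m)) / real m ^ 2) \<le> R * l / z"
      unfolding M_def l_def by (rule sum_gcd_divisor_sum_le[OF x z1 zx R])
    also have "card M \<le> card A1" by (rule card_mono[OF fin(1)]) (use z1 in \<open>auto simp: M_def A1_def intro: Nat.gr0I\<close>)
    also note c1
    also have "x * l * real_of_int b * (R * l / z) = real_of_int b * z\<^sup>2 * l\<^sup>2 * R"
      using z1 by (simp add: z3 power2_eq_square power3_eq_cube)
    finally show ?thesis using x l b by simp
  qed
  have "card (?S - main_solutions a b) \<le> card (A1 \<union> A2 \<union> A3 \<union> (\<Union>m\<in>M. B m))"
    by (rule card_mono[OF _ sub]) (use fin in blast)
  also have "\<dots> \<le> card A1 + card A2 + card A3 + card (\<Union>m\<in>M. B m)"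
    by (intro order_trans[OF card_Un_le] add_mono order_refl)
  finally have "real (card (?S - main_solutions a b)) \<le> real (card A1) + real (card A2) + real (card A3) + real (card (\<Union>m\<in>M. B m))"
    by linarith
  also have "\<dots> \<le> z\<^sup>2 + z\<^sup>2 * (1 + l) + z + (z\<^sup>2 + real_of_int b * z\<^sup>2 * l\<^sup>2 * R)"
    by (intro add_mono c1 c2 c3 c4)
  also have "\<dots> \<le> 6 * (real_of_int b * z\<^sup>2 * l\<^sup>2 * R)"
  proof -
    \<comment> \<open>All terms fit into z^2 (4 + l + W), and 1 <= W and l <= W turn this into 6 z^2
      W.\<close>
    define W where "W = real_of_int b * l\<^sup>2 * R"
    have b1: "real_of_int b \<ge> 1" using b by linarith
    have "l * 1 \<le> l * l" using l by (intro mult_left_mono) auto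
    hence ll: "l \<le> l\<^sup>2" by (simp add: power2_eq_square)
    have "1 * l * 1 \<le> real_of_int b * l\<^sup>2 * R"
      using b1 ll l R1 by (intro mult_mono) auto
    hence W: "l \<le> W" "1 \<le> W" using l by (auto simp: W_def)
    have "z * 1 \<le> z * z" using z1 by (intro mult_left_mono) auto
    hence zz: "z \<le> z\<^sup>2" by (simp add: power2_eq_square)
    have "z\<^sup>2 + z\<^sup>2 * (1 + l) + z + (z\<^sup>2 + z\<^sup>2 * W) \<le> z\<^sup>2 * (4 + l + W)"
      using zz by (simp add: algebra_simps)
    also have "\<dots> \<le> z\<^sup>2 * (6 * W)" using W by (intro mult_left_mono) auto
    finally show ?thesis by (simp add: W_def mult_ac)
  qed
  finally show ?thesis by (simp add: z2 l_def mult_ac)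
qed

section \<open>The two asymptotic statements\<close>

text \<open>The exponent and the threshold are common to all a, b, k because the quantity R of the
  preceding theorem can be chosen in terms of x alone.\<close>

lemma card_sporadic_solutions_asymptotic_bound:
  obtains \<eta> :: "real \<Rightarrow> real" and x0 :: real where "(\<eta> \<longlongrightarrow> 0) at_top" "x0 \<ge> 1"
    "\<forall>a b k x. a > 0 \<longrightarrow> b > 0 \<longrightarrow> x \<ge> x0 \<longrightarrow>
       real (card (sol_set_upto a b k x - main_solutions a b)) \<le> 6 * real_of_int b * x powr (2 / 3 + \<eta> x)"
proof -
  \<comment> \<open>Since ln y ~ ln (ln x), this y is eventually above 2 ln x / ln y, as the
    Wirsing-type bound requires, and still small enough that (ln x)^pi(y) = x^(o(1)); both factors
    of that bound are then x^(O(1 / ln (ln x))).\<close>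
  define y where "y = (\<lambda>x::real. 4 * ln x / ln (ln x))"
  define \<pi> where "\<pi> = (\<lambda>y. card {p::nat. prime p \<and> real p \<le> y})"
  \<comment> \<open>Chosen so that x^d is the Wirsing-type bound with pi(y) replaced by 2 y / ln y,
    which the prime number theorem permits for large y.\<close>
  define d where "d = (\<lambda>x. 4 * ln 2 / ln (y x) + 2 * y x / ln (y x) * ln (ln x / ln 2 + 1) / ln x)"
  \<comment> \<open>The absolute value ensures R = x powr |d x| >= 1; the second summand rewrites (1
    + ln x)^2 as a power of x.\<close>
  define \<eta> where "\<eta> = (\<lambda>x. \<bar>d x\<bar> + 2 * ln (1 + ln x) / ln x)"
  have d: "(d \<longlongrightarrow> 0) at_top" unfolding d_def y_def by real_asymp
  have "((\<lambda>x. \<bar>d x\<bar> + 2 * ln (1 + ln x) / ln x) \<longlongrightarrow> \<bar>0\<bar> + 0) at_top"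
    by (intro tendsto_add tendsto_rabs d) real_asymp
  hence \<eta>: "(\<eta> \<longlongrightarrow> 0) at_top" by (simp add: \<eta>_def)
  have y_top: "filterlim y at_top at_top" unfolding y_def by real_asymp
  have "((\<lambda>y. real (\<pi> y) / (y / ln y)) \<longlongrightarrow> 1) at_top"
    using prime_number_theorem unfolding \<pi>_def
    by (rule asymp_equivD_strong) (use eventually_gt_at_top[of 1] in \<open>eventually_elim, simp\<close>)
  hence "\<forall>\<^sub>F y in at_top. real (\<pi> y) / (y / ln y) < 2" by (rule order_tendstoD) simp
  from this y_top have 1: "\<forall>\<^sub>F x in at_top. real (\<pi> (y x)) / (y x / ln (y x)) < 2"
    by (rule eventually_compose_filterlim)
  have 2: "\<forall>\<^sub>F x in at_top. 2 * ln x / ln (y x) \<le> y x" unfolding y_def by real_asymp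
  have 3: "\<forall>\<^sub>F x in at_top. y x > 1" unfolding y_def by real_asymp
  have "\<forall>\<^sub>F x in at_top. x > 1 \<and> y x > 1 \<and> 2 * ln x / ln (y x) \<le> y x \<and> real (\<pi> (y x)) / (y x / ln (y x)) < 2"
    using eventually_gt_at_top[of 1] 1 2 3 by eventually_elim auto
  then obtain x1 where x1: "\<And>x. x \<ge> x1 \<Longrightarrow> x > 1 \<and> y x > 1 \<and> 2 * ln x / ln (y x) \<le> y x \<and> real (\<pi> (y x)) / (y x / ln (y x)) < 2"
    unfolding eventually_at_top_linorder by blast
  define x0 where "x0 = max 1 x1"
  have main: "real (card (sol_set_upto a b k x - main_solutions a b)) \<le> 6 * real_of_int b * x powr (2 / 3 + \<eta> x)"
    if a: "a > 0" and b: "b > 0" and x: "x \<ge> x0" for a b k x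
  proof -
    have *: "x > 1" "y x > 1" "2 * ln x / ln (y x) \<le> y x" "real (\<pi> (y x)) / (y x / ln (y x)) < 2"
      using x1[of x] x by (auto simp: x0_def)
    have pos: "ln x > 0" "ln (y x) > 0" using * by auto
    have \<pi>_le: "real (\<pi> (y x)) \<le> 2 * y x / ln (y x)" using *(2,4) pos by (simp add: field_simps)
    define s where "s = ln x / ln 2 + 1"
    have s: "s > 1" using pos by (simp add: s_def)
    have R: "real (card {n. n > 0 \<and> real n \<le> x \<and> n dvd v * divisor_sum n}) \<le> x powr \<bar>d x\<bar>"
      if v: "v > 0" "real v \<le> x" for v
    proof -
      have "real (card {n. n > 0 \<and> real n \<le> x \<and> n dvd v * divisor_sum n})
          \<le> 2 powr (4 * ln x / ln (y x)) * s ^ \<pi> (y x)"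
        unfolding s_def \<pi>_def by (rule card_denominator_dvd_le) (use * v in auto)
      also have "s ^ \<pi> (y x) = s powr real (\<pi> (y x))" using s by (simp add: powr_realpow)
      also have "\<dots> \<le> s powr (2 * y x / ln (y x))" using s \<pi>_le by (intro powr_mono) auto
      also have "2 powr (4 * ln x / ln (y x)) * s powr (2 * y x / ln (y x)) = x powr d x"
      proof -
        have "d x * ln x = 4 * ln x / ln (y x) * ln 2 + 2 * y x / ln (y x) * ln s"
          using pos by (simp add: d_def s_def distrib_right)
        thus ?thesis using s * by (simp add: powr_def exp_add[symmetric])
      qed
      also have "\<dots> \<le> x powr \<bar>d x\<bar>" using * by (intro powr_mono) auto
      finally show ?thesis by simp
    qed
    have "real (card (sol_set_upto a b k x - main_solutions a b))
        \<le> 6 * real_of_int b * x powr (2 / 3) * (1 + ln x)\<^sup>2 * x powr \<bar>d x\<bar>"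
      by (rule card_sporadic_solutions_le[OF a b _ _ R]) (use * in \<open>auto intro: ge_one_powr_ge_zero\<close>)
    also have "(1 + ln x)\<^sup>2 = x powr (2 * ln (1 + ln x) / ln x)"
    proof -
      define w where "w = 1 + ln x"
      have w: "w > 0" using pos by (simp add: w_def)
      have "x powr (2 * ln w / ln x) = w powr 2" using w pos * by (simp add: powr_def)
      also have "\<dots> = w\<^sup>2" using w by (intro powr_numeral) auto
      finally show ?thesis by (simp add: w_def)
    qed
    also have "6 * real_of_int b * x powr (2 / 3) * x powr (2 * ln (1 + ln x) / ln x) * x powr \<bar>d x\<bar>
        = 6 * real_of_int b * x powr (2 / 3 + \<eta> x)"
      by (simp add: \<eta>_def powr_add)
    finally show ?thesis .
  qed
  have "x0 \<ge> 1" by (simp add: x0_def)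
  thus ?thesis using main by (intro that[OF \<eta>]) blast+
qed

section \<open>Main solutions and the exceptional case\<close>

lemma main_solutionsD:
  assumes n: "n \<in> sol_set a b k" and main: "n \<in> main_solutions a b" and b: "b > 0"
  obtains p m where "prime p" "n = p * m" "\<not> p dvd m" "m > 0" "k = b * int (divisor_sum m)" "k = a * int m"
proof -
  obtain p m where pm: "prime p" "n = p * m" "\<not> p dvd m" "b * int (divisor_sum m) = a * int m"
    using main by (auto simp: main_solutions_def)
  have n0: "n > 0" "b * int (divisor_sum n) = a * int n + k" using n by (auto simp: sol_set_def)
  have m0: "m > 0" using n0 pm by (intro Nat.gr0I) auto
  have "divisor_sum n = (p + 1) * divisor_sum m"
    unfolding pm(2) using pm m0 prime_imp_coprime[of p m] prime_gt_0_nat[of p]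
    by (subst divisor_sum_mult) (auto simp: divisor_sum_prime)
  hence "(int p + 1) * (b * int (divisor_sum m)) = int p * (a * int m) + k"
    using n0(2) pm(2) by (simp add: algebra_simps)
  hence "k = a * int m" unfolding pm(4) by (simp add: algebra_simps)
  thus ?thesis using that[of p m] pm m0 by simp
qed

lemma no_main_solutions:
  assumes "a > b" "b \<ge> 1" "gcd a b = 1" "\<not> exceptional a b k"
  shows "sol_set_upto a b k x \<inter> main_solutions a b = {}"
proof (rule ccontr)
  assume "sol_set_upto a b k x \<inter> main_solutions a b \<noteq> {}"
  then obtain n where n: "n \<in> sol_set a b k" "n \<in> main_solutions a b" by (auto simp: sol_set_upto_def)
  have b: "b > 0" "a > 0" using assms by auto
  obtain p m where m: "m > 0" "k = b * int (divisor_sum m)" "k = a * int m"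
    by (rule main_solutionsD[OF n b(1)])
  have "k > 0" unfolding m(3) using m(1) b by (intro mult_pos_pos) auto
  hence "k \<ge> 1" by simp
  moreover have "a * b dvd k"
  proof (rule divides_mult)
    show "a dvd k" unfolding m(3) by simp
    show "b dvd k" unfolding m(2) by simp
    show "coprime a b" using assms(3) by (simp add: coprime_iff_gcd_eq_1)
  qed
  moreover have "k div a = int m" using m(3) b by simp
  moreover have "k div b = int (divisor_sum m)" using m(2) b by simp
  ultimately have "exceptional a b k" by (simp add: exceptional_def)
  thus False using assms(4) by contradiction
qed

lemma main_solutions_exceptional:
  assumes "a > b" "b \<ge> 1" "exceptional a b k"
  obtains m :: nat where "m > 0" "k = a * int m"
    "\<forall>x. sol_set_upto a b k x \<inter> main_solutions a b =
            (\<lambda>p. p * m) ` {p. prime p \<and> real p \<le> x / real m \<and> \<not> p dvd m}"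
proof -
  have ab: "a > 0" "b > 0" using assms by auto
  have k: "k \<ge> 1" "a * b dvd k" "int (divisor_sum (nat (k div a))) = k div b"
    using assms(3) by (auto simp: exceptional_def)
  define m where "m = nat (k div a)"
  have "a dvd k" "b dvd k" using k(2) by (auto intro: dvd_mult_left dvd_mult_right)
  have "k div a > 0" using \<open>a dvd k\<close> k(1) ab by (simp add: pos_imp_zdiv_pos_iff zdvd_imp_le)
  hence m: "m > 0" "int m = k div a" by (auto simp: m_def)
  have km: "k = a * int m" using m(2) \<open>a dvd k\<close> by simp
  have kb: "k = b * int (divisor_sum m)" using k(3) \<open>b dvd k\<close> by (simp add: m_def)
  show ?thesis
  proof (rule that[OF m(1) km], rule allI)
    fix x :: real
    show "sol_set_upto a b k x \<inter> main_solutions a b =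
            (\<lambda>p. p * m) ` {p. prime p \<and> real p \<le> x / real m \<and> \<not> p dvd m}"
    proof (intro equalityI subsetI)
      fix n assume n: "n \<in> sol_set_upto a b k x \<inter> main_solutions a b"
      hence "n \<in> sol_set a b k" "real n \<le> x" by (auto simp: sol_set_upto_def)
      moreover obtain p m' where pm: "prime p" "n = p * m'" "\<not> p dvd m'" "k = a * int m'"
        by (rule main_solutionsD[of n a b k]) (use n ab calculation in auto)
      moreover have "m' = m" using pm(4) km ab by simp
      ultimately show "n \<in> (\<lambda>p. p * m) ` {p. prime p \<and> real p \<le> x / real m \<and> \<not> p dvd m}"
        using m(1) by (auto simp: field_simps)
    next
      fix n assume "n \<in> (\<lambda>p. p * m) ` {p. prime p \<and> real p \<le> x / real m \<and> \<not> p dvd m}"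
      then obtain p where p: "prime p" "real p \<le> x / real m" "\<not> p dvd m" "n = p * m" by auto
      have "divisor_sum n = (p + 1) * divisor_sum m"
        unfolding p(4) using p m(1) prime_imp_coprime[of p m] prime_gt_0_nat[of p]
        by (subst divisor_sum_mult) (auto simp: divisor_sum_prime)
      hence "b * int (divisor_sum n) = (int p + 1) * (b * int (divisor_sum m))" by (simp add: algebra_simps)
      also have "\<dots> = int p * (a * int m) + k" unfolding kb[symmetric] by (simp add: km algebra_simps)
      finally have "b * int (divisor_sum n) = a * int n + k" by (simp add: p(4) algebra_simps)
      moreover have "real n \<le> x" using p m(1) by (simp add: field_simps)
      moreover have "n \<ge> 1" using p m(1) prime_gt_0_nat[of p] by simp
      ultimately have "n \<in> sol_set_upto a b k x" by (simp add: sol_set_upto_def sol_set_def)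
      moreover have "n \<in> main_solutions a b"
        unfolding main_solutions_def using p km kb by auto
      ultimately show "n \<in> sol_set_upto a b k x \<inter> main_solutions a b" by blast
    qed
  qed
qed

lemma finite_real_le: "finite {n::nat. real n \<le> x}"
  by (rule finite_subset[of _ "{..nat \<lfloor>x\<rfloor>}"]) (auto intro!: le_nat_floor)

text \<open>The excluded primes divide m and so are at most m in number, a bounded error.\<close>

lemma card_prime_multiples_bounds:
  fixes m :: nat and x :: real
  assumes m: "m > 0"
  defines "A \<equiv> {p. prime p \<and> real p \<le> x \<and> \<not> p dvd m}"
  shows "card A \<le> card {p::nat. prime p \<and> real p \<le> x}" "card {p::nat. prime p \<and> real p \<le> x} \<le> card A + m"
proof -
  have fin: "finite {p::nat. prime p \<and> real p \<le> x}"
    by (rule finite_subset[OF _ finite_real_le[of x]]) auto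
  show "card A \<le> card {p::nat. prime p \<and> real p \<le> x}"
    unfolding A_def by (rule card_mono[OF fin]) auto
  have "{p::nat. prime p \<and> real p \<le> x} \<subseteq> A \<union> {1..m}"
    using m by (auto simp: A_def Suc_le_eq prime_gt_0_nat dest: dvd_imp_le)
  moreover have "finite A" unfolding A_def by (rule finite_subset[OF _ fin]) auto
  ultimately have "card {p::nat. prime p \<and> real p \<le> x} \<le> card (A \<union> {1..m})"
    by (intro card_mono) auto
  also have "\<dots> \<le> card A + card {1..m}" by (rule card_Un_le)
  finally show "card {p::nat. prime p \<and> real p \<le> x} \<le> card A + m" by simp
qed

lemma finite_sol_set_upto: "finite (sol_set_upto a b k x)"
  by (rule finite_subset[OF _ finite_real_le[of x]]) (auto simp: sol_set_upto_def)

text \<open>Up to boundedly many primes, the main solutions are counted by pi(x / m) with m = k / a;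
  the sporadic ones are of smaller order than x / ln x.\<close>

lemma card_sol_set_upto_exceptional:
  assumes ab: "a > b" "b \<ge> 1" and exc: "exceptional a b k"
  shows "(\<lambda>x::real. real (card (sol_set_upto a b k x))) \<sim>[at_top]
           (\<lambda>x. real_of_int a / real_of_int k * (x / ln (real_of_int a * x / real_of_int k)))"
proof -
  obtain m :: nat where m: "m > 0" "k = a * int m"
    "\<forall>x. sol_set_upto a b k x \<inter> main_solutions a b =
            (\<lambda>p. p * m) ` {p. prime p \<and> real p \<le> x / real m \<and> \<not> p dvd m}"
    by (rule main_solutions_exceptional[OF ab exc])
  obtain \<eta> x0 where \<eta>: "(\<eta> \<longlongrightarrow> 0) at_top" "x0 \<ge> 1"
    "\<forall>a b k x. a > 0 \<longrightarrow> b > 0 \<longrightarrow> x \<ge> x0 \<longrightarrow>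
       real (card (sol_set_upto a b k x - main_solutions a b)) \<le> 6 * real_of_int b * x powr (2 / 3 + \<eta> x)"
    by (rule card_sporadic_solutions_asymptotic_bound)
  define M where "M = real m"
  have M: "M > 0" using m by (simp add: M_def)
  have a: "real_of_int a > 0" "a > 0" using ab by auto
  have kM: "real_of_int k = real_of_int a * M" using m(2) by (simp add: M_def)
  define \<pi> where "\<pi> = (\<lambda>y. card {p::nat. prime p \<and> real p \<le> y})"
  define g where "g = (\<lambda>x. x / M / ln (x / M))"
  \<comment> \<open>M covers the primes dividing m. The exponent 3/4 = 2/3 + 1/12 leaves room for
    the error exponent once that is below 1/12.\<close>
  define E where "E = (\<lambda>x. M + 6 * real_of_int b * x powr (3 / 4))"
  have "((\<lambda>y. real (\<pi> y) / (y / ln y)) \<longlongrightarrow> 1) at_top"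
    using prime_number_theorem unfolding \<pi>_def
    by (rule asymp_equivD_strong) (use eventually_gt_at_top[of 1] in \<open>eventually_elim, simp\<close>)
  moreover have "filterlim (\<lambda>x. x / M) at_top at_top" using M by real_asymp
  ultimately have lim: "((\<lambda>x. real (\<pi> (x / M)) / g x) \<longlongrightarrow> 1) at_top"
    unfolding g_def by (rule filterlim_compose)
  have E: "((\<lambda>x. E x / g x) \<longlongrightarrow> 0) at_top"
    unfolding E_def g_def using M by real_asymp
  have "\<forall>\<^sub>F x in at_top. \<eta> x < 1 / 12" by (rule order_tendstoD[OF \<eta>(1)]) simp
  hence close: "\<forall>\<^sub>F x in at_top. norm (real (card (sol_set_upto a b k x)) / g x - real (\<pi> (x / M)) / g x) \<le> E x / g x"
    using eventually_ge_at_top[of x0] eventually_gt_at_top[of M]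
  proof eventually_elim
    case (elim x)
    have x1: "x \<ge> 1" using elim \<eta>(2) by simp
    have "x / M > 1" using elim M by simp
    hence "0 < x / M" "0 < ln (x / M)" by (linarith, rule ln_gt_zero)
    hence g: "g x > 0" unfolding g_def by (rule divide_pos_pos)
    let ?S = "sol_set_upto a b k x"
    let ?A = "{p. prime p \<and> real p \<le> x / real m \<and> \<not> p dvd m}"
    have "inj_on (\<lambda>p. p * m) ?A" using m(1) by (auto intro: inj_onI)
    hence "card (?S \<inter> main_solutions a b) = card ?A" unfolding m(3)[rule_format] by (rule card_image)
    moreover have "card ?S = card (?S \<inter> main_solutions a b) + card (?S - main_solutions a b)"
      using card_Int_Diff[OF finite_sol_set_upto] by blast
    ultimately have S: "real (card ?S) = real (card ?A) + real (card (?S - main_solutions a b))" by simp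
    have A: "real (card ?A) \<le> real (\<pi> (x / M))" "real (\<pi> (x / M)) \<le> real (card ?A) + M"
      using card_prime_multiples_bounds[OF m(1), of "x / real m"] unfolding \<pi>_def M_def
      by (simp_all flip: of_nat_add)
    have "real (card (?S - main_solutions a b)) \<le> 6 * real_of_int b * x powr (2 / 3 + \<eta> x)"
      using elim ab a by (intro \<eta>(3)[rule_format]) auto
    also have "\<dots> \<le> 6 * real_of_int b * x powr (3 / 4)"
      using elim x1 ab by (intro mult_left_mono powr_mono) auto
    finally have "\<bar>real (card ?S) - real (\<pi> (x / M))\<bar> \<le> E x"
      using S A M by (simp add: E_def abs_le_iff)
    hence "\<bar>real (card ?S) - real (\<pi> (x / M))\<bar> / g x \<le> E x / g x" using g by (intro divide_right_mono) auto
    thus ?case using g by (simp add: abs_divide flip: diff_divide_distrib)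
  qed
  have "((\<lambda>x. real (card (sol_set_upto a b k x)) / g x - real (\<pi> (x / M)) / g x) \<longlongrightarrow> 0) at_top"
    by (rule Lim_null_comparison[OF close E])
  from tendsto_add[OF this lim] have "((\<lambda>x. real (card (sol_set_upto a b k x)) / g x) \<longlongrightarrow> 1) at_top" by simp
  hence "(\<lambda>x. real (card (sol_set_upto a b k x))) \<sim>[at_top] g" by (rule asymp_equivI')
  moreover have "g = (\<lambda>x. real_of_int a / real_of_int k * (x / ln (real_of_int a * x / real_of_int k)))"
    using a by (simp add: g_def kM)
  ultimately show ?thesis by simp
qed

lemma card_sol_set_upto_le:
  assumes "x \<ge> 1"
  shows "real (card (sol_set_upto a b k x)) \<le> x"
proof -
  have "sol_set_upto a b k x \<subseteq> {1..nat \<lfloor>x\<rfloor>}" by (auto simp: sol_set_upto_def sol_set_def intro!: le_nat_floor)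
  hence "card (sol_set_upto a b k x) \<le> card {1..nat \<lfloor>x\<rfloor>}" by (rule card_mono[rotated]) simp
  hence "card (sol_set_upto a b k x) \<le> nat \<lfloor>x\<rfloor>" by simp
  hence "real (card (sol_set_upto a b k x)) \<le> real (nat \<lfloor>x\<rfloor>)" by (rule of_nat_mono)
  also have "\<dots> \<le> x" by (rule of_nat_floor) (use assms in auto)
  finally show ?thesis .
qed

theorem proposition2p7:
  shows "(\<forall>k a b :: int.
            k \<noteq> 0 \<and> a > b \<and> b \<ge> 1 \<and> gcd a b = 1 \<and> exceptional a b k \<longrightarrow>
            (\<lambda>x::real. real (card (sol_set_upto a b k x)))
              \<sim>[at_top]
            (\<lambda>x. real_of_int a / real_of_int k *
                   (x / ln (real_of_int a * x / real_of_int k))))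
       \<and> (\<exists>(C::real) (\<epsilon> :: real \<Rightarrow> real). (\<epsilon> \<longlongrightarrow> 0) at_top \<and>
            (\<forall>k a b :: int.
               k \<noteq> 0 \<and> a > b \<and> b \<ge> 1 \<and> gcd a b = 1 \<and> \<not> exceptional a b k \<longrightarrow>
               (\<forall>x::real. x \<ge> 1 \<longrightarrow>
                  real (card (sol_set_upto a b k x))
                    \<le> C * (real_of_int b)\<^sup>2 * x powr (2/3 + \<epsilon> x))))"
proof (intro conjI allI impI)
  fix k a b :: int
  assume "k \<noteq> 0 \<and> a > b \<and> b \<ge> 1 \<and> gcd a b = 1 \<and> exceptional a b k"
  thus "(\<lambda>x::real. real (card (sol_set_upto a b k x))) \<sim>[at_top]
          (\<lambda>x. real_of_int a / real_of_int k * (x / ln (real_of_int a * x / real_of_int k)))"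
    using card_sol_set_upto_exceptional by blast
next
  obtain \<eta> x0 where \<eta>: "(\<eta> \<longlongrightarrow> 0) at_top" "x0 \<ge> 1"
    "\<forall>a b k x. a > 0 \<longrightarrow> b > 0 \<longrightarrow> x \<ge> x0 \<longrightarrow>
       real (card (sol_set_upto a b k x - main_solutions a b)) \<le> 6 * real_of_int b * x powr (2 / 3 + \<eta> x)"
    by (rule card_sporadic_solutions_asymptotic_bound)
  define \<epsilon> where "\<epsilon> = (\<lambda>x. if x \<ge> x0 then \<eta> x else 0)"
  \<comment> \<open>For x < x0 the trivial bound x is below C, and \<open>\<epsilon>\<close> is set
    to 0 so that b^2 x^(2/3) >= 1 can be multiplied in; from x0 on the constant 6 suffices.\<close>
  define C where "C = max 6 x0"
  have "\<forall>\<^sub>F x in at_top. \<eta> x = \<epsilon> x"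
    using eventually_ge_at_top[of x0] by eventually_elim (simp add: \<epsilon>_def)
  hence "(\<epsilon> \<longlongrightarrow> 0) at_top" by (rule Lim_transform_eventually[OF \<eta>(1)])
  moreover have "real (card (sol_set_upto a b k x)) \<le> C * (real_of_int b)\<^sup>2 * x powr (2/3 + \<epsilon> x)"
    if h: "k \<noteq> 0 \<and> a > b \<and> b \<ge> 1 \<and> gcd a b = 1 \<and> \<not> exceptional a b k" and x: "x \<ge> 1" for k a b :: int and x :: real
  proof (cases "x \<ge> x0")
    case True
    have "sol_set_upto a b k x - main_solutions a b = sol_set_upto a b k x"
      using no_main_solutions[of b a k x] h by blast
    hence "real (card (sol_set_upto a b k x)) \<le> 6 * real_of_int b * x powr (2 / 3 + \<eta> x)"
      using \<eta>(3)[rule_format, of a b x k] h True by simp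
    also have "\<dots> \<le> C * (real_of_int b)\<^sup>2 * x powr (2 / 3 + \<eta> x)"
    proof (intro mult_right_mono mult_mono)
      have "real_of_int b \<ge> 1" using h by simp
      thus "real_of_int b \<le> (real_of_int b)\<^sup>2" by (simp add: power2_eq_square)
    qed (use h in \<open>auto simp: C_def\<close>)
    finally show ?thesis using True by (simp add: \<epsilon>_def)
  next
    case False
    have "real (card (sol_set_upto a b k x)) \<le> x" by (rule card_sol_set_upto_le[OF x])
    also have "\<dots> \<le> C * 1 * 1" using False by (simp add: C_def)
    also have "\<dots> \<le> C * (real_of_int b)\<^sup>2 * x powr (2 / 3 + \<epsilon> x)"
      using h x False by (intro mult_mono) (auto simp: C_def \<epsilon>_def ge_one_powr_ge_zero one_le_power)
    finally show ?thesis .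
  qed
  ultimately show "\<exists>(C::real) (\<epsilon> :: real \<Rightarrow> real). (\<epsilon> \<longlongrightarrow> 0) at_top \<and>
            (\<forall>k a b :: int.
               k \<noteq> 0 \<and> a > b \<and> b \<ge> 1 \<and> gcd a b = 1 \<and> \<not> exceptional a b k \<longrightarrow>
               (\<forall>x::real. x \<ge> 1 \<longrightarrow>
                  real (card (sol_set_upto a b k x))
                    \<le> C * (real_of_int b)\<^sup>2 * x powr (2/3 + \<epsilon> x)))"
    by (intro exI[of _ C] exI[of _ \<epsilon>] conjI allI impI)
qed

end
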